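(* Let $(P_h^n,Q_h^n,U_h^n,V_h^n)_{0\le n\le N}$ in $\mathcal V_h$ be given by the finite element fully-discrete scheme, for $n=1,\dots,N$, $$\begin{aligned}P_h^n=\;&P_h^{n-1}-\Delta t\Big(A_h\tfrac{Q_h^n+Q_h^{n-1}}2+\tfrac12\mathcal P_h\big(U_h^n(Q_h^n+Q_h^{n-1})\big)\Big)+C_1\mathcal P_h\eta_1\Delta B_1^n+\tfrac12\Delta t\,C_1\big(A_h\mathcal P_h\eta_1+\mathcal P_h(U_h^n\,\mathcal P_h\eta_1)\big)\Delta B_0^n,\\ Q_h^n=\;&Q_h^{n-1}+\Delta t\Big(A_h\tfrac{P_h^n+P_h^{n-1}}2+\tfrac12\mathcal P_h\big(U_h^n(P_h^n+P_h^{n-1})\big)\Big)-C_1\mathcal P_h\eta_1\Delta B_0^n+\tfrac12\Delta t\,C_1\big(A_h\mathcal P_h\eta_1+\mathcal P_h(U_h^n\,\mathcal P_h\eta_1)\big)\Delta B_1^n,\\ V_h^n=\;&V_h^{n-1}+\Delta t\Big(\tfrac12A_h\tfrac{U_h^n+U_h^{n-1}}2-\tfrac12\tfrac{U_h^n+U_h^{n-1}}2+\tfrac12\mathcal P_h\big((P_h^{n-1})^2+(Q_h^{n-1})^2\big)\Big)+\tfrac12C_2\mathcal P_h\eta_2\Delta B_2^n\\&+\Delta t\,C_1\mathcal P_h\big(P_h^{n-1}\,\mathcal P_h\eta_1\,\Delta B_1^n-Q_h^{n-1}\,\mathcal P_h\eta_1\,\Delta B_0^n+C_1\Delta t(\mathcal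 P_h\eta_1)^2\big),\\ U_h^n=\;&U_h^{n-1}+\Delta t(V_h^n+V_h^{n-1})+\tfrac12\Delta t\,C_2\mathcal P_h\eta_2\Delta B_2^n.\end{aligned}$$ Then for every $n\in\{0,1,\dots,N\}$ the scheme preserves the averaged charge evolution law $$\mathbb{E}[\check{\mathcal N}(P_h^n,Q_h^n)]=\mathbb{E}[\check{\mathcal N}(P_h^0,Q_h^0)]+2C_1^2(\mathcal P_h\eta_1,\mathcal P_h\eta_1)\,t_n$$ with $\check{\mathcal N}(P,Q)=(P,P)+(Q,Q)$, and the averaged energy evolution law $$\mathbb{E}[\check{\mathcal H}(P_h^n,Q_h^n,U_h^n,V_h^n)]=\mathbb{E}[\check{\mathcal H}(P_h^0,Q_h^0,U_h^0,V_h^0)]-C_2^2\check{\mathcal Q}_2t_n+4C_1^2\check{\mathcal Q}_3t_n+4C_1^2\sum_{i=0}^{n-1}\mathbb{E}[(U_h^i,(\mathcal P_h\eta_1)^2)]\,\Delta t,$$ where $$\check{\mathcal H}(P,Q,U,V)=2\big(U,\mathcal P_h(P^2)+\mathcal P_h(Q^2)\big)-(U,U)-4(V,V)+(U,A_hU)+2(P,A_hP)+2(Q,A_hQ),$$ $\check{\mathcal Q}_2=(\mathcal P_h\eta_2,\mathcal P_h\eta_2)$ and $\check{\mathcal Q}_3=(\mathcal P_h\eta_1,A_h\mathcal P_h\eta_1)$.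
   Context: $C_1,C_2\in\mathbb{R}$; $B_0,B_1,B_2$ are independent standard real Wiener processes; $\eta_1,\eta_2$ are sufficiently smooth real-valued functions on $[a,b]$. $(\cdot,\cdot)$ is the $L^2([a,b])$ inner product (of real-valued functions). With $M$ a positive integer, $h=(b-a)/M$, $x_i=a+ih$, $\mathcal V_h$ is the space of continuous functions on $[a,b]$ that are affine on each $[x_i,x_{i+1}]$, $0\le i\le M-1$, and vanish at $a$ and $b$. $A_h:\mathcal V_h\to\mathcal V_h$ is the linear operator defined by $(A_hU,\zeta)=-\sum_{i=0}^{M-1}\int_{x_i}^{x_{i+1}}U_x\zeta_x\,dx$ for all $U,\zeta\in\mathcal V_h$. $\mathcal P_h:L^2([a,b])\to\mathcal V_h$ is the $L^2$ projection: $(\mathcal P_hw,\phi)=(w,\phi)$ for all $\phi\in\mathcal V_h$. For $T>0$ and time step $\Delta t$, $t_n=n\Delta t$, $N=[T/\Delta t]$, and $\Delta B_k^n=B_k(t_n)-B_k(t_{n-1})$ for $k=0,1,2$. The initial values $P_h^0,Q_h^0,U_h^0,V_h^0\in\mathcal V_h$ are approximations of $\operatorname{Re}\varphi_0,\operatorname{Im}\varphi_0,u_0,\tfrac12\mu_0$, where $\varphi_0,u_0,\mu_0$ are the initial data ($\varphi(0)=\varphi_0$, $u(0)=u_0$, $u_t(0)=\mu_0$) of the stochastic Klein--Gordon--Schrödinger equation with homogeneous Dirichlet boundary conditions that the scheme approximates. *)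

theory Defs
  imports "HOL-Probability.Probability"
begin

section \<open>The finite element space and its operators\<close>

definition L2_space :: "real \<Rightarrow> real \<Rightarrow> (real \<Rightarrow> real) set" where
  "L2_space a b = {w. set_borel_measurable lborel {a..b} w \<and>
                      set_integrable lborel {a..b} (\<lambda>x. (w x)\<^sup>2)}"

definition L2_inner :: "real \<Rightarrow> real \<Rightarrow> (real \<Rightarrow> real) \<Rightarrow> (real \<Rightarrow> real) \<Rightarrow> real" where
  "L2_inner a b f g = (LBINT x:{a..b}. f x * g x)"

definition mesh_node :: "real \<Rightarrow> real \<Rightarrow> nat \<Rightarrow> nat \<Rightarrow> real" where
  "mesh_node a b m i = a + real i * ((b - a) / real m)"

text \<open>A function on \<open>[a,b]\<close> is represented by its extension by zero, so that two elements of
  \<open>Vh a b m\<close> agree on \<open>[a,b]\<close> iff they are equal; the definite descriptions in \<open>Ah\<close> and \<open>Ph\<close>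
  below rely on this.\<close>

definition Vh :: "real \<Rightarrow> real \<Rightarrow> nat \<Rightarrow> (real \<Rightarrow> real) set" where
  "Vh a b m = {v. continuous_on {a..b} v \<and>
      (\<forall>i<m. \<exists>c d. \<forall>x\<in>{mesh_node a b m i..mesh_node a b m (Suc i)}. v x = c * x + d) \<and>
      v a = 0 \<and> v b = 0 \<and> (\<forall>x. x \<notin> {a..b} \<longrightarrow> v x = 0)}"

text \<open>The value of \<open>deriv\<close> at the mesh nodes is unspecified, but these form a null set.\<close>

definition Ah :: "real \<Rightarrow> real \<Rightarrow> nat \<Rightarrow> (real \<Rightarrow> real) \<Rightarrow> real \<Rightarrow> real" where
  "Ah a b m U = (THE w. w \<in> Vh a b m \<and> (\<forall>\<zeta>\<in>Vh a b m. L2_inner a b w \<zeta> =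
      - (\<Sum>i<m. LBINT x:{mesh_node a b m i..mesh_node a b m (Suc i)}. deriv U x * deriv \<zeta> x)))"

definition Ph :: "real \<Rightarrow> real \<Rightarrow> nat \<Rightarrow> (real \<Rightarrow> real) \<Rightarrow> real \<Rightarrow> real" where
  "Ph a b m w = (THE v. v \<in> Vh a b m \<and> (\<forall>\<phi>\<in>Vh a b m. L2_inner a b v \<phi> = L2_inner a b w \<phi>))"

section \<open>The fully discrete scheme\<close>

text \<open>One time step, from \<open>(P0, Q0, U0, V0)\<close> to \<open>(P, Q, U, V)\<close>, with increments \<open>d0, d1, d2\<close> of
  the three Wiener processes. The step is implicit, hence a relation.\<close>

definition fe_step ::
  "real \<Rightarrow> real \<Rightarrow> nat \<Rightarrow> real \<Rightarrow> real \<Rightarrow> (real \<Rightarrow> real) \<Rightarrow> (real \<Rightarrow> real) \<Rightarrow> real \<Rightarrow>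
   real \<Rightarrow> real \<Rightarrow> real \<Rightarrow>
   (real \<Rightarrow> real) \<Rightarrow> (real \<Rightarrow> real) \<Rightarrow> (real \<Rightarrow> real) \<Rightarrow> (real \<Rightarrow> real) \<Rightarrow>
   (real \<Rightarrow> real) \<Rightarrow> (real \<Rightarrow> real) \<Rightarrow> (real \<Rightarrow> real) \<Rightarrow> (real \<Rightarrow> real) \<Rightarrow> bool" where
  "fe_step a b m C1 C2 \<eta>1 \<eta>2 dt d0 d1 d2 P0 Q0 U0 V0 P Q U V \<longleftrightarrow>
    (let A = Ah a b m; Pr = Ph a b m; p1 = Pr \<eta>1; p2 = Pr \<eta>2 in
      (\<forall>x. P x = P0 x
         - dt * (A (\<lambda>y. (Q y + Q0 y) / 2) x + 1/2 * Pr (\<lambda>y. U y * (Q y + Q0 y)) x)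
         + C1 * p1 x * d1
         + 1/2 * dt * C1 * (A p1 x + Pr (\<lambda>y. U y * p1 y) x) * d0) \<and>
      (\<forall>x. Q x = Q0 x
         + dt * (A (\<lambda>y. (P y + P0 y) / 2) x + 1/2 * Pr (\<lambda>y. U y * (P y + P0 y)) x)
         - C1 * p1 x * d0
         + 1/2 * dt * C1 * (A p1 x + Pr (\<lambda>y. U y * p1 y) x) * d1) \<and>
      (\<forall>x. V x = V0 x
         + dt * (1/2 * A (\<lambda>y. (U y + U0 y) / 2) x - 1/2 * ((U x + U0 x) / 2)
                 + 1/2 * Pr (\<lambda>y. (P0 y)\<^sup>2 + (Q0 y)\<^sup>2) x)
         + 1/2 * C2 * p2 x * d2
         + dt * C1 * Pr (\<lambda>y. P0 y * p1 y * d1 - Q0 y * p1 y * d0 + C1 * dt * (p1 y)\<^sup>2) x) \<and>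
      (\<forall>x. U x = U0 x + dt * (V x + V0 x) + 1/2 * dt * C2 * p2 x * d2))"

definition charge :: "real \<Rightarrow> real \<Rightarrow> (real \<Rightarrow> real) \<Rightarrow> (real \<Rightarrow> real) \<Rightarrow> real" where
  "charge a b P Q = L2_inner a b P P + L2_inner a b Q Q"

definition energy ::
  "real \<Rightarrow> real \<Rightarrow> nat \<Rightarrow> (real \<Rightarrow> real) \<Rightarrow> (real \<Rightarrow> real) \<Rightarrow> (real \<Rightarrow> real) \<Rightarrow> (real \<Rightarrow> real) \<Rightarrow> real" where
  "energy a b m P Q U V =
     2 * L2_inner a b U (\<lambda>x. Ph a b m (\<lambda>y. (P y)\<^sup>2) x + Ph a b m (\<lambda>y. (Q y)\<^sup>2) x)
     - L2_inner a b U U - 4 * L2_inner a b V V + L2_inner a b U (Ah a b m U)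
     + 2 * L2_inner a b P (Ah a b m P) + 2 * L2_inner a b Q (Ah a b m Q)"

section \<open>Wiener processes and random elements\<close>

definition wiener_process :: "'w measure \<Rightarrow> (real \<Rightarrow> 'w \<Rightarrow> real) \<Rightarrow> bool" where
  "wiener_process \<Omega> W \<longleftrightarrow>
     (\<forall>t\<ge>0. W t \<in> borel_measurable \<Omega>) \<and>
     (AE \<omega> in \<Omega>. W 0 \<omega> = 0) \<and>
     (AE \<omega> in \<Omega>. continuous_on {0..} (\<lambda>t. W t \<omega>)) \<and>
     (\<forall>s\<ge>0. \<forall>t>s. distributed \<Omega> lborel (\<lambda>\<omega>. W t \<omega> - W s \<omega>) (normal_density 0 (sqrt (t - s)))) \<and>
     (\<forall>(s :: nat \<Rightarrow> real) n. 0 \<le> s 0 \<and> (\<forall>i<n. s i < s (Suc i)) \<longrightarrow>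
        prob_space.indep_vars \<Omega> (\<lambda>_. borel) (\<lambda>i \<omega>. W (s (Suc i)) \<omega> - W (s i) \<omega>) {..<n})"

text \<open>The \<open>\<sigma>\<close>-algebra on \<open>\<Omega>\<close> generated by a family of real random variables.\<close>

definition gen_sigma :: "'w measure \<Rightarrow> 'i set \<Rightarrow> ('i \<Rightarrow> 'w \<Rightarrow> real) \<Rightarrow> 'w set set" where
  "gen_sigma \<Omega> I X =
     sigma_sets (space \<Omega>) {X i -` S \<inter> space \<Omega> | i S. i \<in> I \<and> S \<in> sets borel}"

text \<open>\<open>Vh\<close>-valued random variables: as \<open>Vh\<close> is finite-dimensional and its elements are determined
  by their nodal values, Borel measurability is measurability of all point evaluations.\<close>

definition Vh_random_variable ::
  "real \<Rightarrow> real \<Rightarrow> nat \<Rightarrow> 'w measure \<Rightarrow> ('w \<Rightarrow> real \<Rightarrow> real) \<Rightarrow> bool" where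
  "Vh_random_variable a b m \<Omega> X \<longleftrightarrow>
     (\<forall>\<omega>\<in>space \<Omega>. X \<omega> \<in> Vh a b m) \<and> (\<forall>x. (\<lambda>\<omega>. X \<omega> x) \<in> borel_measurable \<Omega>)"

end

theory Submission
  imports Defs "Jordan_Normal_Form.Determinant"
begin

text \<open>Put \<open>p = Ph \<eta>1\<close> and write \<open>U, V\<close> with index \<open>0\<close> for the previous step. With
  \<open>Pt = P0 + C1 d1 p\<close>, \<open>Qt = Q0 - C1 d0 p\<close>, \<open>Vt = V0 + C2 d2 Ph \<eta>2 / 2\<close> the step becomes a
  deterministic one: \<open>(P, Q)\<close> is a Crank--Nicolson step from \<open>(Pt, Qt)\<close> with the symmetric operator
  \<open>A + U\<close>, so it conserves the charge and, for the potential frozen at the new \<open>U\<close>, the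
  Schroedinger energy; testing the equation for \<open>V\<close> with \<open>V + Vt = (U - U0) / dt\<close> gives the wave
  energy. Hence the increments of charge and energy are polynomials in the Wiener increments whose
  coefficients are known at the previous time, except for the term
  \<open>2 C1\<^sup>2 (d0\<^sup>2 + d1\<^sup>2 - 2 dt) (U, p\<^sup>2)\<close>. The new \<open>U\<close> is affine in the increments, so this term has
  mean zero as well, because the odd moments of the increments vanish.

  To use independence, the iterates have to be adapted: Cramer's rule exhibits the solution of the
  implicit system for \<open>(P, Q)\<close> as a measurable function of the past and the increments. The
  pathwise charge identity propagates the fourth moments of \<open>P\<close> and \<open>Q\<close>.\<close>

text \<open>What makes the step tractable is its order. The equations for \<open>V\<close> and
  \<open>U\<close> see \<open>(P, Q)\<close> only at the old time, so \<open>U\<close> is found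
  first, from a linear problem with the deterministic form \<open>wave_form\<close>; only then does
  \<open>(P, Q)\<close> solve a linear system whose matrix contains this new, random
  \<open>U\<close>. Hence the new \<open>U\<close> is affine in the increments, while the new
  \<open>P\<close> and \<open>Q\<close> are in general only rational functions of them.

  Cramer's formula therefore serves measurability alone; the moments come from the charge identity,
  in which \<open>U\<close> does not occur. The exponents are forced by the products: the energy
  pairs \<open>U\<close> with the squares of \<open>P\<close> and \<open>Q\<close>, and the equation
  for \<open>V\<close> has these squares as its source. Four moments of \<open>P, Q\<close> and two
  of \<open>U, V\<close> form a class that one step maps into itself.

  Adaptedness is a conclusion and not a hypothesis: the given iterates are merely random variables
  that satisfy the scheme almost surely, so uniqueness of the implicit step has to identify
  them.\<close>

section \<open>Spaces of functions separated by finitely many points: orthonormal bases and Riesz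
  representation\<close>

definition fun_subspace :: "('x \<Rightarrow> real) set \<Rightarrow> bool" where
  "fun_subspace V \<longleftrightarrow> (\<lambda>_. 0) \<in> V \<and> (\<forall>u\<in>V. \<forall>v\<in>V. (\<lambda>x. u x + v x) \<in> V) \<and>
     (\<forall>c. \<forall>u\<in>V. (\<lambda>x. c * u x) \<in> V)"

definition linear_on_fun :: "('x \<Rightarrow> real) set \<Rightarrow> (('x \<Rightarrow> real) \<Rightarrow> real) \<Rightarrow> bool" where
  "linear_on_fun V l \<longleftrightarrow> (\<forall>u\<in>V. \<forall>v\<in>V. l (\<lambda>x. u x + v x) = l u + l v) \<and>
     (\<forall>c. \<forall>u\<in>V. l (\<lambda>x. c * u x) = c * l u)"

text \<open>The form is a parameter because two inner products live on the same space, that of L2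
  and \<open>wave_form\<close>. All axioms are relative to \<open>V\<close>: on arbitrary functions
  the L2 form is neither definite nor, for lack of integrability, additive.\<close>

definition inner_on_fun ::
  "('x \<Rightarrow> real) set \<Rightarrow> (('x \<Rightarrow> real) \<Rightarrow> ('x \<Rightarrow> real) \<Rightarrow> real) \<Rightarrow> bool" where
  "inner_on_fun V \<beta> \<longleftrightarrow> fun_subspace V \<and> (\<forall>u\<in>V. linear_on_fun V (\<beta> u)) \<and> (\<forall>u\<in>V. \<forall>v\<in>V. \<beta> u v = \<beta> v u) \<and>
     (\<forall>u\<in>V. u \<noteq> (\<lambda>_. 0) \<longrightarrow> 0 < \<beta> u u)"

lemma fun_subspaceD:
  assumes "fun_subspace V"
  shows "(\<lambda>_. 0) \<in> V"
    and "u \<in> V \<Longrightarrow> v \<in> V \<Longrightarrow> (\<lambda>x. u x + v x) \<in> V"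
    and "u \<in> V \<Longrightarrow> (\<lambda>x. c * u x) \<in> V"
  using assms by (auto simp: fun_subspace_def)

lemma fun_subspace_sum:
  assumes V: "fun_subspace V" and "finite I" "\<And>i. i \<in> I \<Longrightarrow> e i \<in> V"
  shows "(\<lambda>x. \<Sum>i\<in>I. c i * e i x) \<in> V"
  using assms(2,3)
proof (induction I rule: finite_induct)
  case empty
  then show ?case using fun_subspaceD(1)[OF V] by simp
next
  case (insert i I)
  then show ?case
    using fun_subspaceD(2)[OF V fun_subspaceD(3)[OF V, of "e i" "c i"]] by simp
qed

lemma linear_on_funD:
  assumes "linear_on_fun V l"
  shows "u \<in> V \<Longrightarrow> v \<in> V \<Longrightarrow> l (\<lambda>x. u x + v x) = l u + l v"
    and "u \<in> V \<Longrightarrow> l (\<lambda>x. c * u x) = c * l u"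
  using assms by (auto simp: linear_on_fun_def)

lemma linear_on_fun_sum:
  assumes V: "fun_subspace V" and l: "linear_on_fun V l"
    and "finite I" "\<And>i. i \<in> I \<Longrightarrow> e i \<in> V"
  shows "l (\<lambda>x. \<Sum>i\<in>I. c i * e i x) = (\<Sum>i\<in>I. c i * l (e i))"
  using assms(3,4)
proof (induction I rule: finite_induct)
  case empty
  then show ?case using linear_on_funD(2)[OF l fun_subspaceD(1)[OF V], of 0] by simp
next
  case (insert i I)
  then show ?case
    using linear_on_funD(1)[OF l fun_subspaceD(3)[OF V, of "e i" "c i"]
        fun_subspace_sum[OF V, of I e c]]
      linear_on_funD(2)[OF l, of "e i" "c i"] by simp
qed

lemma inner_on_funD:
  assumes "inner_on_fun V \<beta>"
  shows "u \<in> V \<Longrightarrow> linear_on_fun V (\<beta> u)"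
    and "u \<in> V \<Longrightarrow> v \<in> V \<Longrightarrow> \<beta> u v = \<beta> v u"
    and "u \<in> V \<Longrightarrow> u \<noteq> (\<lambda>_. 0) \<Longrightarrow> 0 < \<beta> u u"
    and "v \<in> V \<Longrightarrow> linear_on_fun V (\<lambda>u. \<beta> u v)"
proof -
  have "fun_subspace V" using assms by (simp add: inner_on_fun_def)
  then show "v \<in> V \<Longrightarrow> linear_on_fun V (\<lambda>u. \<beta> u v)"
    using assms unfolding inner_on_fun_def linear_on_fun_def
    by (auto simp: fun_subspaceD)
qed (use assms in \<open>auto simp: inner_on_fun_def\<close>)

text \<open>Gram--Schmidt, by induction on a set \<open>S\<close> of points that separates \<open>V\<close>: the functions that
  vanish at a point of \<open>S\<close> form a subspace separated by the remaining points.\<close>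

lemma orthonormal_basis_exists:
  fixes V :: "('x \<Rightarrow> real) set"
  assumes "finite S" and V: "fun_subspace V" and \<beta>: "inner_on_fun V \<beta>"
    and "\<And>v. v \<in> V \<Longrightarrow> (\<And>x. x \<in> S \<Longrightarrow> v x = 0) \<Longrightarrow> v = (\<lambda>_. 0)"
  shows "\<exists>(d :: nat) e. (\<forall>i<d. e i \<in> V) \<and>
    (\<forall>i<d. \<forall>j<d. \<beta> (e i) (e j) = (if i = j then 1 else 0)) \<and>
    (\<forall>v\<in>V. v = (\<lambda>x. \<Sum>i<d. \<beta> v (e i) * e i x)) \<and>
    (\<forall>i<d. \<exists>\<gamma>. \<forall>v\<in>V. \<beta> v (e i) = (\<Sum>x\<in>S. \<gamma> x * v x))"
  using assms
proof (induction S arbitrary: V rule: finite_induct)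
  case empty
  then have "\<forall>v\<in>V. v = (\<lambda>_. 0)" by auto
  then show ?case by (intro exI[of _ "0::nat"]) auto
next
  case (insert x0 S V)
  note V = insert.prems(1) and \<beta> = insert.prems(2)
  note bsym = inner_on_funD(2)[OF \<beta>]
  define V' where "V' = {v\<in>V. v x0 = 0}"
  have V': "fun_subspace V'" using V by (auto simp: fun_subspace_def V'_def)
  have sub: "V' \<subseteq> V" by (auto simp: V'_def)
  have \<beta>': "inner_on_fun V' \<beta>" using \<beta> sub V'
    unfolding inner_on_fun_def linear_on_fun_def by blast
  have "\<And>v. v \<in> V' \<Longrightarrow> (\<And>x. x \<in> S \<Longrightarrow> v x = 0) \<Longrightarrow> v = (\<lambda>_. 0)"
    using insert.prems(3) by (auto simp: V'_def)
  from insert.IH[OF V' \<beta>' this] obtain d :: nat and e where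
    e: "\<And>i. i < d \<Longrightarrow> e i \<in> V'"
    and on: "\<And>i j. i < d \<Longrightarrow> j < d \<Longrightarrow> \<beta> (e i) (e j) = (if i = j then 1 else 0)"
    and rep: "\<And>v. v \<in> V' \<Longrightarrow> v = (\<lambda>x. \<Sum>i<d. \<beta> v (e i) * e i x)"
    and co: "\<forall>i<d. \<exists>\<gamma>. \<forall>v\<in>V'. \<beta> v (e i) = (\<Sum>x\<in>S. \<gamma> x * v x)" by blast
  from co obtain \<gamma> where co: "\<And>i v. i < d \<Longrightarrow> v \<in> V' \<Longrightarrow> \<beta> v (e i) = (\<Sum>x\<in>S. \<gamma> i x * v x)"
    by metis
  have eV: "\<And>i. i < d \<Longrightarrow> e i \<in> V" using e sub by auto
  have e0: "\<And>i. i < d \<Longrightarrow> e i x0 = 0" using e by (auto simp: V'_def)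
  show ?case
  proof (cases "V' = V")
    case True
    have "\<exists>\<gamma>. \<forall>v\<in>V. \<beta> v (e i) = (\<Sum>x\<in>insert x0 S. \<gamma> x * v x)" if "i < d" for i
    proof (intro exI[of _ "\<gamma> i"] ballI)
      fix v assume v: "v \<in> V"
      then have "v x0 = 0" using True by (auto simp: V'_def)
      then show "\<beta> v (e i) = (\<Sum>x\<in>insert x0 S. \<gamma> i x * v x)"
        using co[OF that] v True insert.hyps by simp
    qed
    then show ?thesis using eV on rep True by (intro exI[of _ d] exI[of _ e]) auto
  next
    case False
    then obtain u where u: "u \<in> V" "u x0 \<noteq> 0" using sub by (auto simp: V'_def)
    \<comment> \<open>\<open>p\<close> is minus the orthogonal projection of \<open>u\<close> onto
      the span of \<open>e\<close>. As all \<open>e i\<close> vanish at \<open>x0\<close>, the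
      corrected function keeps the value \<open>u x0\<close> there, which is what makes it
      nonzero.\<close>
    define p where "p = (\<lambda>x. \<Sum>i<d. - \<beta> u (e i) * e i x)"
    have pV: "p \<in> V" unfolding p_def by (rule fun_subspace_sum[OF V]) (use eV in auto)
    define u' where "u' = (\<lambda>x. u x + p x)"
    have u'V: "u' \<in> V" unfolding u'_def by (rule fun_subspaceD(2)[OF V u(1) pV])
    have u'e: "\<beta> u' (e j) = 0" if "j < d" for j
    proof -
      have "\<beta> u' (e j) = \<beta> u (e j) + \<beta> p (e j)"
        unfolding u'_def using linear_on_funD(1)[OF inner_on_funD(4)[OF \<beta> eV[OF that]] u(1) pV] .
      also have "\<beta> p (e j) = (\<Sum>i<d. - \<beta> u (e i) * \<beta> (e i) (e j))"
        unfolding p_def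
        by (rule linear_on_fun_sum[OF V inner_on_funD(4)[OF \<beta> eV[OF that]]]) (use eV in auto)
      also have "\<dots> = (\<Sum>i<d. if i = j then - \<beta> u (e i) else 0)"
        by (rule sum.cong) (use on that in auto)
      also have "\<dots> = - \<beta> u (e j)" using that by simp
      finally show ?thesis by simp
    qed
    have u'0: "u' x0 = u x0" unfolding u'_def p_def using e0 by simp
    have "u' \<noteq> (\<lambda>_. 0)" using u'0 u by auto
    then have pos: "0 < \<beta> u' u'" using inner_on_funD(3)[OF \<beta> u'V] by simp
    define c where "c = 1 / sqrt (\<beta> u' u')"
    have cc: "c * c * \<beta> u' u' = 1" and c0: "c \<noteq> 0" using pos by (auto simp: c_def)
    define w where "w = (\<lambda>x. c * u' x)"
    have wV: "w \<in> V" unfolding w_def by (rule fun_subspaceD(3)[OF V u'V])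
    have ww: "\<beta> w w = 1"
    proof -
      have "\<beta> w w = c * \<beta> w u'" unfolding w_def
        using linear_on_funD(2)[OF inner_on_funD(1)[OF \<beta> wV] u'V] by (simp add: w_def)
      also have "\<beta> w u' = c * \<beta> u' u'" unfolding w_def
        using linear_on_funD(2)[OF inner_on_funD(4)[OF \<beta> u'V] u'V] by simp
      finally show ?thesis using cc by simp
    qed
    have we: "\<beta> w (e j) = 0" if "j < d" for j
      unfolding w_def
      using linear_on_funD(2)[OF inner_on_funD(4)[OF \<beta> eV[OF that]] u'V] u'e[OF that] by simp
    have w0: "w x0 \<noteq> 0" using c0 u'0 u by (simp add: w_def)
    \<comment> \<open>Subtracting the multiple of \<open>w\<close> that matches the value at
      \<open>x0\<close> moves \<open>v\<close> into \<open>V'\<close>. Since \<open>w\<close> is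
      orthogonal to \<open>V'\<close>, that multiplier \<open>v x0 / w x0\<close> is at the same
      time the coefficient of \<open>v\<close> along \<open>w\<close>.\<close>
    have split: "\<forall>i<d. \<beta> v (e i) = \<beta> (\<lambda>x. v x + (- v x0 / w x0) * w x) (e i)"
        "(\<lambda>x. v x + (- v x0 / w x0) * w x) \<in> V'"
        "\<beta> v w = v x0 / w x0"
        "v = (\<lambda>x. (\<Sum>i<d. \<beta> v (e i) * e i x) + \<beta> v w * w x)"
      if v: "v \<in> V" for v
    proof -
      let ?s = "\<lambda>x. (- v x0 / w x0) * w x"
      let ?r = "\<lambda>x. v x + ?s x"
      have sV: "?s \<in> V" by (rule fun_subspaceD(3)[OF V wV])
      have rV: "?r \<in> V" by (rule fun_subspaceD(2)[OF V v sV])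
      show rV': "?r \<in> V'" using rV w0 by (simp add: V'_def)
      have re: "\<beta> ?r (e j) = \<beta> v (e j)" if "j < d" for j
      proof -
        have "\<beta> ?r (e j) = \<beta> v (e j) + \<beta> ?s (e j)"
          by (rule linear_on_funD(1)[OF inner_on_funD(4)[OF \<beta> eV[OF that]] v sV])
        also have "\<beta> ?s (e j) = (- v x0 / w x0) * \<beta> w (e j)"
          by (rule linear_on_funD(2)[OF inner_on_funD(4)[OF \<beta> eV[OF that]] wV])
        finally show ?thesis using we[OF that] by simp
      qed
      have rrep: "?r = (\<lambda>x. \<Sum>i<d. \<beta> v (e i) * e i x)"
        using rep[OF rV'] re by simp
      have "\<beta> ?r w = (\<Sum>i<d. \<beta> v (e i) * \<beta> (e i) w)"
        unfolding rrep by (rule linear_on_fun_sum[OF V inner_on_funD(4)[OF \<beta> wV]]) (use eV in auto)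
      also have "\<dots> = 0" using we bsym[OF wV eV] by simp
      finally have rw: "\<beta> ?r w = 0" .
      have "\<beta> ?r w = \<beta> v w + \<beta> ?s w"
        by (rule linear_on_funD(1)[OF inner_on_funD(4)[OF \<beta> wV] v sV])
      also have "\<beta> ?s w = (- v x0 / w x0) * \<beta> w w"
        by (rule linear_on_funD(2)[OF inner_on_funD(4)[OF \<beta> wV] wV])
      finally show vw: "\<beta> v w = v x0 / w x0" using ww rw by simp
      show "v = (\<lambda>x. (\<Sum>i<d. \<beta> v (e i) * e i x) + \<beta> v w * w x)"
      proof
        fix x
        show "v x = (\<Sum>i<d. \<beta> v (e i) * e i x) + \<beta> v w * w x"
          using fun_cong[OF rrep, of x] vw by simp
      qed
      show "\<forall>i<d. \<beta> v (e i) = \<beta> ?r (e i)"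
        using re by simp
    qed
    define e' where "e' = e(d := w)"
    have e'd: "e' d = w" and e'i: "\<And>i. i < d \<Longrightarrow> e' i = e i" by (auto simp: e'_def)
    show ?thesis
    proof (intro exI[of _ "Suc d"] exI[of _ e'] conjI allI impI ballI)
      fix i assume "i < Suc d"
      then show "e' i \<in> V" using eV wV by (auto simp: e'_def)
    next
      fix i j assume "i < Suc d" "j < Suc d"
      then show "\<beta> (e' i) (e' j) = (if i = j then 1 else 0)"
        using on we ww bsym[OF eV wV] by (auto simp: e'_def)
    next
      fix v assume v: "v \<in> V"
      show "v = (\<lambda>x. \<Sum>i<Suc d. \<beta> v (e' i) * e' i x)"
        using split(4)[OF v] by (simp add: e'd e'i)
    next
      fix i assume i: "i < Suc d"
      show "\<exists>\<gamma>. \<forall>v\<in>V. \<beta> v (e' i) = (\<Sum>x\<in>insert x0 S. \<gamma> x * v x)"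
      proof (cases "i = d")
        case True
        have "\<beta> v w = (\<Sum>x\<in>insert x0 S. (if x = x0 then 1 / w x0 else 0) * v x)" if "v \<in> V" for v
          using split(3)[OF that] insert.hyps by (simp add: if_distrib[of "\<lambda>a. a * _"] sum.If_cases cong: if_cong) 
        then show ?thesis using True e'd by (intro exI[of _ "\<lambda>x. if x = x0 then 1 / w x0 else 0"]) auto
      next
        case False
        then have id: "i < d" using i by simp
        \<comment> \<open>The weights from the induction hypothesis apply to \<open>v\<close> minus
          its multiple of \<open>w\<close>. The subtracted part depends on \<open>v\<close> only
          through \<open>v x0\<close>, so its whole contribution becomes the weight at
          \<open>x0\<close>.\<close>
        have "\<beta> v (e i) = (\<Sum>x\<in>insert x0 S. (if x = x0 then - (\<Sum>y\<in>S. \<gamma> i y * w y) / w x0 else \<gamma> i x) * v x)"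
          if v: "v \<in> V" for v
        proof -
          have "\<beta> v (e i) = (\<Sum>x\<in>S. \<gamma> i x * (v x + (- v x0 / w x0) * w x))"
            using split(1,2)[OF v] co[OF id] id by simp
          also have "\<dots> = (\<Sum>x\<in>S. \<gamma> i x * v x) + (\<Sum>x\<in>S. (- v x0 / w x0) * (\<gamma> i x * w x))"
            unfolding sum.distrib[symmetric] by (rule sum.cong) (auto simp: algebra_simps)
          also have "(\<Sum>x\<in>S. (- v x0 / w x0) * (\<gamma> i x * w x)) = (- (\<Sum>y\<in>S. \<gamma> i y * w y) / w x0) * v x0"
            unfolding sum_distrib_left[symmetric] by simp
          also have "(\<Sum>x\<in>S. \<gamma> i x * v x)
              = (\<Sum>x\<in>S. (if x = x0 then - (\<Sum>y\<in>S. \<gamma> i y * w y) / w x0 else \<gamma> i x) * v x)"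
            by (rule sum.cong) (use insert.hyps in auto)
          finally show ?thesis using insert.hyps by simp
        qed
        then show ?thesis
          using e'i[OF id]
          by (intro exI[of _ "\<lambda>x. if x = x0 then - (\<Sum>y\<in>S. \<gamma> i y * w y) / w x0 else \<gamma> i x"]) auto
      qed
    qed
  qed
qed

text \<open>In an orthonormal basis the representer has the coordinates \<open>l (e i)\<close>.
  Uniqueness is part of the claim because \<open>Ah\<close> and \<open>Ph\<close> are definite
  descriptions.\<close>

lemma riesz_representation_fun:
  fixes V :: "('x \<Rightarrow> real) set"
  assumes "finite S" and V: "fun_subspace V" and \<beta>: "inner_on_fun V \<beta>"
    and "\<And>v. v \<in> V \<Longrightarrow> (\<And>x. x \<in> S \<Longrightarrow> v x = 0) \<Longrightarrow> v = (\<lambda>_. 0)"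
    and l: "linear_on_fun V l"
  shows "\<exists>!z. z \<in> V \<and> (\<forall>v\<in>V. \<beta> z v = l v)"
proof -
  from orthonormal_basis_exists[OF assms(1-4)] obtain d :: nat and e where
    e: "\<And>i. i < d \<Longrightarrow> e i \<in> V"
    and on: "\<And>i j. i < d \<Longrightarrow> j < d \<Longrightarrow> \<beta> (e i) (e j) = (if i = j then 1 else 0)"
    and rep: "\<And>v. v \<in> V \<Longrightarrow> v = (\<lambda>x. \<Sum>i<d. \<beta> v (e i) * e i x)" by blast
  define z where "z = (\<lambda>x. \<Sum>i<d. l (e i) * e i x)"
  have zV: "z \<in> V" unfolding z_def by (rule fun_subspace_sum[OF V]) (use e in auto)
  have z: "\<beta> z v = l v" if v: "v \<in> V" for v
  proof -
    have "\<beta> z v = (\<Sum>i<d. l (e i) * \<beta> (e i) v)"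
      unfolding z_def by (rule linear_on_fun_sum[OF V inner_on_funD(4)[OF \<beta> v]]) (use e in auto)
    also have "\<dots> = (\<Sum>i<d. \<beta> v (e i) * l (e i))"
      by (rule sum.cong) (use inner_on_funD(2)[OF \<beta> v e] in auto)
    also have "\<dots> = l (\<lambda>x. \<Sum>i<d. \<beta> v (e i) * e i x)"
      by (rule linear_on_fun_sum[OF V l, symmetric]) (use e in auto)
    also have "\<dots> = l v" using rep[OF v] by simp
    finally show ?thesis .
  qed
  show ?thesis
  proof (rule ex1I[of _ z])
    show "z \<in> V \<and> (\<forall>v\<in>V. \<beta> z v = l v)" using zV z by auto
    fix y assume y: "y \<in> V \<and> (\<forall>v\<in>V. \<beta> y v = l v)"
    then have "\<beta> y (e i) = \<beta> z (e i)" if "i < d" for i using z e[OF that] by simp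
    then have "(\<lambda>x. \<Sum>i<d. \<beta> y (e i) * e i x) = (\<lambda>x. \<Sum>i<d. \<beta> z (e i) * e i x)" by simp
    then show "y = z" using rep[of y] rep[OF zV] y by simp
  qed
qed

section \<open>The finite element space\<close>

text \<open>Integrands built from \<open>deriv\<close> are known only inside a mesh cell. The two
  end points form a null set, and changing a measurable function at two points keeps it measurable,
  so the left integrand needs no measurability proof of its own.\<close>

lemma set_integral_cong_Ioo:
  fixes f g :: "real \<Rightarrow> real"
  assumes "\<And>x. l < x \<Longrightarrow> x < r \<Longrightarrow> f x = g x" and "set_borel_measurable lborel {l..r} g"
  shows "(LBINT x:{l..r}. f x) = (LBINT x:{l..r}. g x)"
proof -
  have eq: "(\<lambda>x. indicator {l..r} x *\<^sub>R f x) =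
      (\<lambda>x. if x = l then indicator {l..r} l *\<^sub>R f l else
        if x = r then indicator {l..r} r *\<^sub>R f r else indicator {l..r} x *\<^sub>R g x)"
    using assms(1) by (auto simp: fun_eq_iff indicator_def)
  have g: "(\<lambda>x. indicator {l..r} x *\<^sub>R g x) \<in> borel_measurable lborel"
    using assms(2) by (simp add: set_borel_measurable_def)
  have meas: "(\<lambda>x. indicator {l..r} x *\<^sub>R f x) \<in> borel_measurable lborel"
    unfolding eq using g by measurable
  show ?thesis
    unfolding set_lebesgue_integral_def
  proof (rule integral_cong_AE[OF meas g])
    have "AE x in lborel. x \<noteq> l" "AE x in lborel. x \<noteq> r"
      by (rule AE_lborel_singleton)+
    then show "AE x in lborel. indicator {l..r} x *\<^sub>R f x = indicator {l..r} x *\<^sub>R g x"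
      by eventually_elim (use assms(1) in \<open>auto simp: indicator_def\<close>)
  qed
qed

locale fem =
  fixes a b :: real and m :: nat
  assumes ab: "a < b" and m: "0 < m"
begin

abbreviation "V\<^sub>h \<equiv> Vh a b m"
abbreviation "ip \<equiv> L2_inner a b"
abbreviation "node \<equiv> mesh_node a b m"
abbreviation cont :: "(real \<Rightarrow> real) \<Rightarrow> bool" where "cont \<equiv> continuous_on {a..b}"

definition "mesh = (b - a) / real m"

lemma mesh_pos: "0 < mesh"
  using ab m by (simp add: mesh_def)

lemma node_simps: "node 0 = a" "node m = b" "node (Suc i) = node i + mesh"
  using m by (auto simp: mesh_node_def mesh_def field_simps)

lemma node_less: "node i < node (Suc i)"
  using mesh_pos by (simp add: node_simps)

lemma node_cover:
  assumes "x \<in> {a..b}"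
  shows "\<exists>i<m. x \<in> {node i..node (Suc i)}"
proof -
  have "0 < k \<Longrightarrow> x \<le> node k \<Longrightarrow> \<exists>i<k. x \<in> {node i..node (Suc i)}" for k
  proof (induction k)
    case (Suc k)
    show ?case
    proof (cases "k = 0")
      case True
      then show ?thesis using Suc.prems assms node_simps(1) by auto
    next
      case False
      show ?thesis
      proof (cases "x \<le> node k")
        case True
        then show ?thesis using Suc.IH False by (auto intro: less_SucI)
      next
        case False
        then show ?thesis using Suc.prems by (intro exI[of _ k]) auto
      qed
    qed
  qed simp
  from this[of m] show ?thesis using m assms node_simps(2) by auto
qed

lemma Vh_cont: "v \<in> V\<^sub>h \<Longrightarrow> cont v"
  by (simp add: Vh_def)

lemma Vh_affine:
  assumes "v \<in> V\<^sub>h" "i < m"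
  obtains c d where "\<And>x. x \<in> {node i..node (Suc i)} \<Longrightarrow> v x = c * x + d"
  using assms unfolding Vh_def by blast

lemma Vh_subspace: "fun_subspace V\<^sub>h"
  unfolding fun_subspace_def
proof (intro conjI ballI allI)
  show "(\<lambda>_. 0) \<in> V\<^sub>h" by (auto simp: Vh_def intro!: exI[of _ 0])
next
  fix u v assume u: "u \<in> V\<^sub>h" and v: "v \<in> V\<^sub>h"
  have "\<exists>c d. \<forall>x\<in>{node i..node (Suc i)}. u x + v x = c * x + d" if i: "i < m" for i
  proof -
    obtain c d where 1: "\<And>x. x \<in> {node i..node (Suc i)} \<Longrightarrow> u x = c * x + d"
      using Vh_affine[OF u i] by blast
    obtain c' d' where 2: "\<And>x. x \<in> {node i..node (Suc i)} \<Longrightarrow> v x = c' * x + d'"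
      using Vh_affine[OF v i] by blast
    show ?thesis using 1 2
      by (intro exI[of _ "c + c'"] exI[of _ "d + d'"]) (auto simp: algebra_simps)
  qed
  then show "(\<lambda>x. u x + v x) \<in> V\<^sub>h" using u v by (auto simp: Vh_def intro!: continuous_intros)
next
  fix c :: real and u assume u: "u \<in> V\<^sub>h"
  have "\<exists>k d. \<forall>x\<in>{node i..node (Suc i)}. c * u x = k * x + d" if i: "i < m" for i
  proof -
    obtain k d where "\<And>x. x \<in> {node i..node (Suc i)} \<Longrightarrow> u x = k * x + d"
      using Vh_affine[OF u i] by blast
    then show ?thesis
      by (intro exI[of _ "c * k"] exI[of _ "c * d"]) (auto simp: algebra_simps)
  qed
  then show "(\<lambda>x. c * u x) \<in> V\<^sub>h" using u by (auto simp: Vh_def intro!: continuous_intros)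
qed

lemmas Vh_add = fun_subspaceD(2)[OF Vh_subspace]
lemmas Vh_scale = fun_subspaceD(3)[OF Vh_subspace]

text \<open>An affine function with two zeros vanishes, and outside \<open>[a,b]\<close> the
  extension by zero decides. The nodes are thus the finite separating set from which the basis is
  built.\<close>

lemma Vh_separated:
  assumes v: "v \<in> V\<^sub>h" and z: "\<And>x. x \<in> node ` {..m} \<Longrightarrow> v x = 0"
  shows "v = (\<lambda>_. 0)"
proof
  fix x
  show "v x = 0"
  proof (cases "x \<in> {a..b}")
    case True
    then obtain i where i: "i < m" "x \<in> {node i..node (Suc i)}" using node_cover by blast
    obtain c d where cd: "\<And>x. x \<in> {node i..node (Suc i)} \<Longrightarrow> v x = c * x + d"
      using Vh_affine[OF v i(1)] by blast
    have 0: "c * node i + d = 0" "c * node (Suc i) + d = 0"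
      using cd[of "node i"] cd[of "node (Suc i)"] z[of "node i"] z[of "node (Suc i)"] i node_less[of i]
      by auto
    then have "c * (node (Suc i) - node i) = 0" unfolding right_diff_distrib by linarith
    then have "c = 0" using node_less[of i] by simp
    then show ?thesis using cd[OF i(2)] 0 by auto
  next
    case False
    then show ?thesis using v by (auto simp: Vh_def)
  qed
qed

subsection \<open>The inner product\<close>

lemma cont_integrable: "cont f \<Longrightarrow> set_integrable lborel {a..b} f"
  by (rule borel_integrable_atLeastAtMost')

text \<open>The noise profiles are only square integrable, so additivity has to reach beyond
  continuous functions; for these it is specialised further down.\<close>

lemma ip_add_left_integrable:
  assumes "set_integrable lborel {a..b} (\<lambda>x. f x * h x)" "set_integrable lborel {a..b} (\<lambda>x. g x * h x)"
  shows "ip (\<lambda>x. f x + g x) h = ip f h + ip g h"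
  unfolding L2_inner_def using set_integral_add(2)[OF assms] by (simp add: algebra_simps)

lemma ip_scale_left: "ip (\<lambda>x. c * f x) h = c * ip f h"
  unfolding L2_inner_def by (simp add: mult.assoc)

lemma ip_commute: "ip f g = ip g f"
  by (simp add: L2_inner_def mult.commute)

lemma ip_add_left: "cont f \<Longrightarrow> cont g \<Longrightarrow> cont h \<Longrightarrow> ip (\<lambda>x. f x + g x) h = ip f h + ip g h"
  by (intro ip_add_left_integrable cont_integrable continuous_intros)

lemma ip_add_right: "cont f \<Longrightarrow> cont g \<Longrightarrow> cont h \<Longrightarrow> ip h (\<lambda>x. f x + g x) = ip h f + ip h g"
  using ip_add_left[of f g h] by (simp add: ip_commute)

lemma ip_scale_right: "ip h (\<lambda>x. c * f x) = c * ip h f"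
  using ip_scale_left[of c f h] by (simp add: ip_commute)

lemma ip_uminus_left: "ip (\<lambda>x. - f x) h = - ip f h"
  using ip_scale_left[of "-1" f h] by simp

lemma ip_diff_left: "cont f \<Longrightarrow> cont g \<Longrightarrow> cont h \<Longrightarrow> ip (\<lambda>x. f x - g x) h = ip f h - ip g h"
  using ip_add_left[of f "\<lambda>x. - g x" h] by (simp add: ip_uminus_left continuous_intros)

lemma ip_scale_left': "ip (\<lambda>x. f x * c) h = c * ip f h"
  using ip_scale_left[of c f h] by (simp add: mult.commute)

lemma ip_div_left: "ip (\<lambda>x. f x / c) h = ip f h / c"
  using ip_scale_left[of "1 / c" f h] by simp

lemmas ip_left = ip_add_left ip_diff_left ip_scale_left ip_scale_left' ip_div_left

lemma ip_linear_integrable: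
  assumes "\<And>v. v \<in> V\<^sub>h \<Longrightarrow> set_integrable lborel {a..b} (\<lambda>x. w x * v x)"
  shows "linear_on_fun V\<^sub>h (ip w)"
  unfolding linear_on_fun_def
proof (intro conjI ballI allI)
  fix u v assume "u \<in> V\<^sub>h" "v \<in> V\<^sub>h"
  then show "ip w (\<lambda>x. u x + v x) = ip w u + ip w v"
    using ip_add_left_integrable[of u w v] assms by (simp add: ip_commute mult.commute)
qed (rule ip_scale_right)

lemma ip_linear: "cont w \<Longrightarrow> linear_on_fun V\<^sub>h (ip w)"
  using Vh_cont by (intro ip_linear_integrable cont_integrable continuous_on_mult) auto

lemma L2_space_integrable:
  assumes w: "w \<in> L2_space a b" and v: "v \<in> V\<^sub>h"
  shows "set_integrable lborel {a..b} (\<lambda>x. w x * v x)"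
proof -
  have wm: "set_borel_measurable lborel {a..b} w" and w2: "set_integrable lborel {a..b} (\<lambda>x. (w x)\<^sup>2)"
    using w by (auto simp: L2_space_def)
  have v2: "set_integrable lborel {a..b} (\<lambda>x. (v x)\<^sup>2)"
    by (intro cont_integrable continuous_intros Vh_cont v)
  have vm: "set_borel_measurable lborel {a..b} v"
    using cont_integrable[OF Vh_cont[OF v]] by (auto simp: set_integrable_def set_borel_measurable_def)
  have "(\<lambda>x. (indicator {a..b} x *\<^sub>R w x) * (indicator {a..b} x *\<^sub>R v x)) \<in> borel_measurable lborel"
    using wm vm unfolding set_borel_measurable_def by (rule borel_measurable_times)
  also have "(\<lambda>x. (indicator {a..b} x *\<^sub>R w x) * (indicator {a..b} x *\<^sub>R v x)) =
      (\<lambda>x. indicator {a..b} x *\<^sub>R (w x * v x))"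
    by (auto simp: indicator_def fun_eq_iff)
  finally have meas: "(\<lambda>x. indicator {a..b} x *\<^sub>R (w x * v x)) \<in> borel_measurable lborel" .
  have sum: "integrable lborel (\<lambda>x. indicator {a..b} x *\<^sub>R ((w x)\<^sup>2 + (v x)\<^sup>2))"
    using set_integral_add(1)[OF w2 v2] by (simp add: set_integrable_def)
  show ?thesis
    unfolding set_integrable_def
  proof (rule Bochner_Integration.integrable_bound[OF sum meas], rule AE_I2)
    fix x
    have "\<bar>w x * v x\<bar> \<le> (w x)\<^sup>2 + (v x)\<^sup>2"
      using sum_squares_bound[of "\<bar>w x\<bar>" "\<bar>v x\<bar>"] mult_nonneg_nonneg[of "\<bar>w x\<bar>" "\<bar>v x\<bar>"]
      unfolding abs_mult power2_abs by linarith
    then show "norm (indicator {a..b} x *\<^sub>R (w x * v x)) \<le> norm (indicator {a..b} x *\<^sub>R ((w x)\<^sup>2 + (v x)\<^sup>2))"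
      by (auto simp: indicator_def)
  qed
qed

lemma ip_nonneg: "0 \<le> ip v v"
  unfolding L2_inner_def set_lebesgue_integral_def by (rule integral_nonneg_AE) auto

text \<open>A continuous nonnegative integrand with zero integral vanishes on \<open>[a,b]\<close>;
  the convention of extending by zero turns this into equality with the zero function.\<close>

lemma ip_pos:
  assumes v: "v \<in> V\<^sub>h" and "v \<noteq> (\<lambda>_. 0)"
  shows "0 < ip v v"
proof (rule ccontr)
  assume "\<not> 0 < ip v v"
  then have 0: "ip v v = 0" using ip_nonneg[of v] by simp
  have c: "cont (\<lambda>x. v x * v x)" using Vh_cont[OF v] by (intro continuous_intros)
  have "integral {a..b} (\<lambda>x. v x * v x) = 0"
    using 0 set_borel_integral_eq_integral(2)[OF cont_integrable[OF c]] by (simp add: L2_inner_def)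
  then have "\<forall>x\<in>{a..b}. v x * v x = 0"
    using integral_eq_0_iff[OF c ab] by auto
  then have "v x = 0" for x using v by (cases "x \<in> {a..b}") (auto simp: Vh_def)
  then show False using assms by auto
qed

lemma ip_inner: "inner_on_fun V\<^sub>h ip"
  unfolding inner_on_fun_def
  using Vh_subspace ip_linear Vh_cont ip_commute ip_pos by blast

section \<open>Riesz representation on \<open>Vh\<close> and the L2 projection\<close>

lemma riesz_Vh:
  assumes "inner_on_fun V\<^sub>h \<beta>" "linear_on_fun V\<^sub>h l"
  shows "\<exists>!z. z \<in> V\<^sub>h \<and> (\<forall>v\<in>V\<^sub>h. \<beta> z v = l v)"
  by (rule riesz_representation_fun[of "node ` {..m}", OF _ Vh_subspace assms(1) _ assms(2)])
    (blast, rule Vh_separated)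

lemma ip_riesz:
  assumes "linear_on_fun V\<^sub>h l"
  shows "\<exists>!z. z \<in> V\<^sub>h \<and> (\<forall>v\<in>V\<^sub>h. ip z v = l v)"
  by (rule riesz_Vh[OF ip_inner assms])

lemma Ph_integrable:
  assumes "\<And>v. v \<in> V\<^sub>h \<Longrightarrow> set_integrable lborel {a..b} (\<lambda>x. w x * v x)"
  shows "Ph a b m w \<in> V\<^sub>h" "\<And>v. v \<in> V\<^sub>h \<Longrightarrow> ip (Ph a b m w) v = ip w v"
  using theI'[OF ip_riesz[OF ip_linear_integrable[OF assms]]] by (auto simp: Ph_def)

lemma Ph_L2: "w \<in> L2_space a b \<Longrightarrow> Ph a b m w \<in> V\<^sub>h"
  by (intro Ph_integrable L2_space_integrable)

lemma Ph_cont: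
  assumes "cont w"
  shows "Ph a b m w \<in> V\<^sub>h" "v \<in> V\<^sub>h \<Longrightarrow> ip (Ph a b m w) v = ip w v"
proof -
  have "\<And>v. v \<in> V\<^sub>h \<Longrightarrow> set_integrable lborel {a..b} (\<lambda>x. w x * v x)"
    using assms Vh_cont by (intro cont_integrable continuous_on_mult) auto
  then show "Ph a b m w \<in> V\<^sub>h" "v \<in> V\<^sub>h \<Longrightarrow> ip (Ph a b m w) v = ip w v"
    using Ph_integrable[of w] by blast+
qed

subsection \<open>The discrete Laplacian\<close>

definition "slope i v = (v (node (Suc i)) - v (node i)) / mesh"

text \<open>The negative semidefinite form of the discrete Laplacian, written with difference
  quotients instead of \<open>deriv\<close>. In this shape it is bilinear on all functions, without
  any differentiability or integrability condition.\<close>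

definition "stiff u v = - (\<Sum>i<m. slope i u * slope i v * mesh)"

lemma deriv_slope:
  assumes v: "v \<in> V\<^sub>h" and i: "i < m" and x: "node i < x" "x < node (Suc i)"
  shows "deriv v x = slope i v"
proof -
  obtain c d where cd: "\<And>x. x \<in> {node i..node (Suc i)} \<Longrightarrow> v x = c * x + d"
    using Vh_affine[OF v i] by blast
  have "slope i v = c"
    using cd[of "node i"] cd[of "node (Suc i)"] mesh_pos
    by (simp add: slope_def node_simps(3) field_simps)
  moreover have "(v has_field_derivative c) (at x)"
  proof (rule has_field_derivative_transform_within_open)
    show "((\<lambda>x. c * x + d) has_field_derivative c) (at x)" by (auto intro!: derivative_eq_intros)
    show "open {node i<..<node (Suc i)}" "x \<in> {node i<..<node (Suc i)}" using x by auto
    show "\<And>y. y \<in> {node i<..<node (Suc i)} \<Longrightarrow> c * y + d = v y" using cd by auto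
  qed
  ultimately show ?thesis using DERIV_imp_deriv by blast
qed

lemma stiff_integral:
  assumes "u \<in> V\<^sub>h" "v \<in> V\<^sub>h"
  shows "- (\<Sum>i<m. LBINT x:{node i..node (Suc i)}. deriv u x * deriv v x) = stiff u v"
proof -
  have "(LBINT x:{node i..node (Suc i)}. deriv u x * deriv v x) = slope i u * slope i v * mesh"
    if i: "i < m" for i
  proof -
    have "(LBINT x:{node i..node (Suc i)}. deriv u x * deriv v x)
        = (LBINT x:{node i..node (Suc i)}. slope i u * slope i v)"
      by (rule set_integral_cong_Ioo) (use deriv_slope assms i in \<open>auto simp: set_borel_measurable_def\<close>)
    also have "\<dots> = slope i u * slope i v * mesh"
      using mesh_pos by (simp add: set_integral_const node_simps(3))
    finally show ?thesis .
  qed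
  then show ?thesis by (simp add: stiff_def)
qed

lemma slope_add: "slope i (\<lambda>x. u x + v x) = slope i u + slope i v"
  by (simp add: slope_def add_divide_distrib[symmetric])

lemma slope_scale: "slope i (\<lambda>x. c * u x) = c * slope i u"
  by (simp add: slope_def field_simps)

lemma stiff_commute: "stiff u v = stiff v u"
  by (simp add: stiff_def mult.commute)

lemma stiff_add_left: "stiff (\<lambda>x. u x + v x) w = stiff u w + stiff v w"
  by (simp add: stiff_def slope_add algebra_simps sum.distrib)

lemma stiff_scale_left: "stiff (\<lambda>x. c * u x) w = c * stiff u w"
  by (simp add: stiff_def slope_scale sum_distrib_left mult.assoc)

lemma stiff_add_right: "stiff w (\<lambda>x. u x + v x) = stiff w u + stiff w v"
  using stiff_add_left by (simp add: stiff_commute)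

lemma stiff_scale_right: "stiff w (\<lambda>x. c * u x) = c * stiff w u"
  using stiff_scale_left by (simp add: stiff_commute)

lemma stiff_linear: "linear_on_fun V (stiff u)"
  by (simp add: linear_on_fun_def stiff_add_right stiff_scale_right)

lemma stiff_nonpos: "stiff u u \<le> 0"
  using mesh_pos by (auto simp: stiff_def intro!: sum_nonneg)

lemma Ah:
  assumes "u \<in> V\<^sub>h"
  shows "Ah a b m u \<in> V\<^sub>h" "v \<in> V\<^sub>h \<Longrightarrow> ip (Ah a b m u) v = stiff u v"
proof -
  have "Ah a b m u = (THE w. w \<in> V\<^sub>h \<and> (\<forall>v\<in>V\<^sub>h. ip w v = stiff u v))"
    unfolding Ah_def by (rule arg_cong[where f = The], rule ext) (use stiff_integral[OF assms] in auto)
  then show "Ah a b m u \<in> V\<^sub>h" "v \<in> V\<^sub>h \<Longrightarrow> ip (Ah a b m u) v = stiff u v"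
    using theI'[OF ip_riesz[OF stiff_linear]] by auto
qed

text \<open>The operator of the implicit step for \<open>U\<close>, once \<open>V\<close> has been eliminated.\<close>

definition "wave_form s u v = (1 + s\<^sup>2 / 4) * ip u v - s\<^sup>2 / 4 * stiff u v"

lemma wave_form_inner: "inner_on_fun V\<^sub>h (wave_form s)"
  unfolding inner_on_fun_def
proof (intro conjI ballI impI)
  fix u v assume u: "u \<in> V\<^sub>h"
  show "linear_on_fun V\<^sub>h (wave_form s u)"
    using linear_on_funD[OF ip_linear[OF Vh_cont[OF u]]]
    by (auto simp: linear_on_fun_def wave_form_def stiff_add_right stiff_scale_right algebra_simps)
  show "wave_form s u v = wave_form s v u"
    by (simp add: wave_form_def ip_commute[of u] stiff_commute[of u])
  assume "u \<noteq> (\<lambda>_. 0)"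
  then have "0 < (1 + s\<^sup>2 / 4) * ip u u" using ip_pos[OF u] by (simp add: add_pos_nonneg)
  moreover have "s\<^sup>2 / 4 * stiff u u \<le> 0"
    by (rule mult_nonneg_nonpos[OF _ stiff_nonpos]) simp
  ultimately show "0 < wave_form s u u" unfolding wave_form_def by linarith
qed (rule Vh_subspace)

text \<open>A duality device: the representer stands in the second argument, as a test function.
  Testing the equation for \<open>U\<close> with this \<open>z\<close> produces \<open>l U\<close>
  on the left and known quantities on the right, so no solution operator has to be written
  down.\<close>

lemma wave_form_riesz:
  assumes "linear_on_fun V\<^sub>h l"
  obtains z where "z \<in> V\<^sub>h" "\<And>v. v \<in> V\<^sub>h \<Longrightarrow> wave_form s v z = l v"
proof -
  have "\<exists>!z. z \<in> V\<^sub>h \<and> (\<forall>v\<in>V\<^sub>h. wave_form s z v = l v)"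
    by (rule riesz_Vh[OF wave_form_inner assms])
  then obtain z where z: "z \<in> V\<^sub>h" "\<And>v. v \<in> V\<^sub>h \<Longrightarrow> wave_form s z v = l v" by auto
  show ?thesis
    by (rule that[OF z(1)]) (use z inner_on_funD(2)[OF wave_form_inner] in auto)
qed

text \<open>The coupling form, the integral of \<open>u * v * w\<close> over \<open>[a,b]\<close>,
  symmetric in all three arguments. It is the weak form both of multiplication by the potential
  \<open>U\<close> and of the quadratic source in the equation for \<open>V\<close>.\<close>

definition "tri u v w = ip (\<lambda>x. u x * v x) w"

lemma tri_commute12: "tri u v w = tri v u w"
  by (simp add: tri_def mult.commute)

lemma tri_commute23: "tri u v w = tri u w v"
  by (simp add: tri_def L2_inner_def mult_ac)

lemma tri_add_left:
  "cont u \<Longrightarrow> cont u' \<Longrightarrow> cont v \<Longrightarrow> cont w \<Longrightarrow> tri (\<lambda>x. u x + u' x) v w = tri u v w + tri u' v w"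
  unfolding tri_def using ip_add_left[of "\<lambda>x. u x * v x" "\<lambda>x. u' x * v x" w]
  by (simp add: algebra_simps continuous_intros)

lemma tri_scale_left: "tri (\<lambda>x. c * u x) v w = c * tri u v w"
  unfolding tri_def using ip_scale_left[of c "\<lambda>x. u x * v x" w] by (simp add: mult.assoc)

lemma tri_add_mid:
  "cont u \<Longrightarrow> cont u' \<Longrightarrow> cont v \<Longrightarrow> cont w \<Longrightarrow> tri v (\<lambda>x. u x + u' x) w = tri v u w + tri v u' w"
  using tri_add_left[of u u' v w] by (simp add: tri_commute12)

lemma tri_scale_mid: "tri v (\<lambda>x. c * u x) w = c * tri v u w"
  using tri_scale_left[of c u v w] by (simp add: tri_commute12)

lemma tri_add_right:
  "cont u \<Longrightarrow> cont u' \<Longrightarrow> cont v \<Longrightarrow> cont w \<Longrightarrow> tri v w (\<lambda>x. u x + u' x) = tri v w u + tri v w u'"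
  using tri_add_mid[of u u' v w] by (simp add: tri_commute23)

lemma tri_scale_right: "tri v w (\<lambda>x. c * u x) = c * tri v w u"
  using tri_scale_mid[of v c u w] by (simp add: tri_commute23)

lemmas form_expand = ip_add_left ip_add_right ip_scale_left ip_scale_right
  stiff_add_left stiff_add_right stiff_scale_left stiff_scale_right
  tri_add_left tri_add_mid tri_add_right tri_scale_left tri_scale_mid tri_scale_right

end

section \<open>One time step\<close>

context fem
begin

text \<open>The projections in \<open>energy\<close> disappear because they are paired with
  \<open>U\<close>, which lies in \<open>Vh\<close>; what is left are forms that can be expanded by
  linearity.\<close>

lemma energy_forms:
  assumes "P \<in> V\<^sub>h" "Q \<in> V\<^sub>h" "U \<in> V\<^sub>h" "V \<in> V\<^sub>h"
  shows "energy a b m P Q U V = 2 * tri U P P + 2 * tri U Q Q - ip U U - 4 * ip V V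
    + stiff U U + 2 * stiff P P + 2 * stiff Q Q"
proof -
  have sq: "ip (Ph a b m (\<lambda>y. (v y)\<^sup>2)) U = tri U v v" "Ph a b m (\<lambda>y. (v y)\<^sup>2) \<in> V\<^sub>h"
    if v: "v \<in> V\<^sub>h" for v
  proof -
    have c: "cont (\<lambda>y. (v y)\<^sup>2)" using Vh_cont[OF v] by (intro continuous_intros)
    show "Ph a b m (\<lambda>y. (v y)\<^sup>2) \<in> V\<^sub>h" by (rule Ph_cont[OF c])
    have "ip (Ph a b m (\<lambda>y. (v y)\<^sup>2)) U = tri v v U"
      using Ph_cont(2)[OF c assms(3)] by (simp add: tri_def power2_eq_square)
    then show "ip (Ph a b m (\<lambda>y. (v y)\<^sup>2)) U = tri U v v"
      using tri_commute12 tri_commute23 by metis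
  qed
  have "ip U (\<lambda>x. Ph a b m (\<lambda>y. (P y)\<^sup>2) x + Ph a b m (\<lambda>y. (Q y)\<^sup>2) x) = tri U P P + tri U Q Q"
    unfolding ip_add_right[OF Vh_cont Vh_cont Vh_cont, OF sq(2)[OF assms(1)] sq(2)[OF assms(2)] assms(3)]
    using sq(1)[OF assms(1)] sq(1)[OF assms(2)] by (simp add: ip_commute[of U])
  then show ?thesis
    using assms Ah(2) ip_commute unfolding energy_def by (metis (no_types, lifting) distrib_left)
qed

end

text \<open>A single realisation: the increments are three real numbers, so everything proved here
  is deterministic and is later applied at almost every \<omega>.\<close>

locale fem_step = fem +
  fixes C1 C2 dt d0 d1 d2 :: real and \<eta>1 \<eta>2 P0 Q0 U0 V0 P Q U V :: "real \<Rightarrow> real"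
  assumes dt: "0 < dt"
    and \<eta>1: "\<eta>1 \<in> L2_space a b" and \<eta>2: "\<eta>2 \<in> L2_space a b"
    and V0_Vh: "P0 \<in> V\<^sub>h" "Q0 \<in> V\<^sub>h" "U0 \<in> V\<^sub>h" "V0 \<in> V\<^sub>h"
    and V_Vh: "P \<in> V\<^sub>h" "Q \<in> V\<^sub>h" "U \<in> V\<^sub>h" "V \<in> V\<^sub>h"
    and step: "fe_step a b m C1 C2 \<eta>1 \<eta>2 dt d0 d1 d2 P0 Q0 U0 V0 P Q U V"
begin

abbreviation "p1 \<equiv> Ph a b m \<eta>1"
abbreviation "p2 \<equiv> Ph a b m \<eta>2"

text \<open>Named coefficients stay atomic while forms are expanded by linearity, and are unfolded
  only for the closing algebra. The sign of \<open>cQ\<close> is that of the noise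
  \<open>- C1 * p1 * d0\<close> in the equation for \<open>Q\<close>.\<close>

definition "cP = C1 * d1"
definition "cQ = - (C1 * d0)"
definition "cV = C2 * d2 / 2"
definition "Pt = (\<lambda>x. P0 x + cP * p1 x)"
definition "Qt = (\<lambda>x. Q0 x + cQ * p1 x)"
definition "Vt = (\<lambda>x. V0 x + cV * p2 x)"

lemma p_Vh: "p1 \<in> V\<^sub>h" "p2 \<in> V\<^sub>h"
  using Ph_L2 \<eta>1 \<eta>2 by auto

lemma t_Vh: "Pt \<in> V\<^sub>h" "Qt \<in> V\<^sub>h" "Vt \<in> V\<^sub>h"
  unfolding Pt_def Qt_def Vt_def by (intro Vh_add Vh_scale V0_Vh p_Vh)+

lemmas in_Vh = V0_Vh V_Vh p_Vh t_Vh
lemmas in_cont = in_Vh[THEN Vh_cont]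

lemma ip_tilde:
  assumes "z \<in> V\<^sub>h"
  shows "ip Pt z = ip P0 z + C1 * d1 * ip p1 z" "ip Qt z = ip Q0 z - C1 * d0 * ip p1 z"
    "ip Vt z = ip V0 z + C2 * d2 / 2 * ip p2 z"
  unfolding Pt_def Qt_def Vt_def using in_cont Vh_cont[OF assms]
  by (simp_all add: form_expand continuous_intros) (simp_all add: cP_def cQ_def cV_def)

lemma ip_Ah_mean:
  assumes "u \<in> V\<^sub>h" "v \<in> V\<^sub>h"
  shows "Ah a b m (\<lambda>y. (u y + v y) / 2) \<in> V\<^sub>h"
    "w \<in> V\<^sub>h \<Longrightarrow> ip (Ah a b m (\<lambda>y. (u y + v y) / 2)) w = (stiff u w + stiff v w) / 2"
proof -
  have eq: "(\<lambda>y. (u y + v y) / 2) = (\<lambda>y. (1/2) * (u y + v y))" by auto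
  have 1: "(\<lambda>y. (1/2) * (u y + v y)) \<in> V\<^sub>h" by (intro Vh_scale Vh_add assms)
  show "Ah a b m (\<lambda>y. (u y + v y) / 2) \<in> V\<^sub>h"
    unfolding eq by (rule Ah(1)[OF 1])
  show "w \<in> V\<^sub>h \<Longrightarrow> ip (Ah a b m (\<lambda>y. (u y + v y) / 2)) w = (stiff u w + stiff v w) / 2"
    unfolding eq Ah(2)[OF 1] stiff_scale_left stiff_add_left by simp
qed

lemma ip_Ph_mult:
  assumes "u \<in> V\<^sub>h" "v \<in> V\<^sub>h"
  shows "Ph a b m (\<lambda>y. u y * v y) \<in> V\<^sub>h"
    "w \<in> V\<^sub>h \<Longrightarrow> ip (Ph a b m (\<lambda>y. u y * v y)) w = tri u v w"
proof -
  have c: "cont (\<lambda>y. u y * v y)" using assms Vh_cont by (intro continuous_on_mult) auto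
  show "Ph a b m (\<lambda>y. u y * v y) \<in> V\<^sub>h"
    "w \<in> V\<^sub>h \<Longrightarrow> ip (Ph a b m (\<lambda>y. u y * v y)) w = tri u v w"
    using Ph_cont[OF c] by (auto simp: tri_def)
qed

lemma ip_Ph_mult_add:
  assumes "u \<in> V\<^sub>h" "v \<in> V\<^sub>h" "v' \<in> V\<^sub>h"
  shows "Ph a b m (\<lambda>y. u y * (v y + v' y)) \<in> V\<^sub>h"
    "w \<in> V\<^sub>h \<Longrightarrow> ip (Ph a b m (\<lambda>y. u y * (v y + v' y))) w = tri u v w + tri u v' w"
  using ip_Ph_mult[OF assms(1) Vh_add[OF assms(2,3)]] assms
  by (auto simp: tri_add_mid Vh_cont)

text \<open>The correction \<open>1/2 * dt * C1 * (A p1 + U p1) * d0\<close> of the scheme is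
  exactly the difference between averaging \<open>Q\<close> with \<open>Q0\<close> and averaging it
  with \<open>Qt = Q0 - C1 * d0 * p1\<close>. The equation for \<open>Q\<close> absorbs its
  correction in the same way, with \<open>d1\<close> and \<open>Pt\<close>.\<close>

lemma P_eq:
  assumes z: "z \<in> V\<^sub>h"
  shows "ip P z = ip Pt z - dt / 2 * (stiff Q z + stiff Qt z + tri U Q z + tri U Qt z)"
proof -
  define \<alpha> where "\<alpha> = Ah a b m (\<lambda>y. (Q y + Q0 y) / 2)"
  define \<beta> where "\<beta> = Ph a b m (\<lambda>y. U y * (Q y + Q0 y))"
  define \<gamma> where "\<gamma> = Ah a b m p1"
  define \<delta> where "\<delta> = Ph a b m (\<lambda>y. U y * p1 y)"
  have V: "\<alpha> \<in> V\<^sub>h" "\<beta> \<in> V\<^sub>h" "\<gamma> \<in> V\<^sub>h" "\<delta> \<in> V\<^sub>h"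
    unfolding \<alpha>_def \<beta>_def \<gamma>_def \<delta>_def
    by (rule ip_Ah_mean(1) ip_Ph_mult_add(1) Ah(1) ip_Ph_mult(1); rule in_Vh)+
  have e: "ip \<alpha> z = (stiff Q z + stiff Q0 z) / 2" "ip \<beta> z = tri U Q z + tri U Q0 z"
    "ip \<gamma> z = stiff p1 z" "ip \<delta> z = tri U p1 z"
    unfolding \<alpha>_def \<beta>_def \<gamma>_def \<delta>_def
    by (rule ip_Ah_mean(2) ip_Ph_mult_add(2) Ah(2) ip_Ph_mult(2); rule in_Vh z)+
  have "P = (\<lambda>x. P0 x - dt * (\<alpha> x + 1/2 * \<beta> x) + C1 * p1 x * d1 + 1/2 * dt * C1 * (\<gamma> x + \<delta> x) * d0)"
    using step unfolding fe_step_def Let_def \<alpha>_def \<beta>_def \<gamma>_def \<delta>_def by blast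
  then have "ip P z = ip P0 z - dt * (ip \<alpha> z + 1/2 * ip \<beta> z) + C1 * ip p1 z * d1
      + 1/2 * dt * C1 * (ip \<gamma> z + ip \<delta> z) * d0"
    using V[THEN Vh_cont] in_cont Vh_cont[OF z]
    by (simp add: ip_left continuous_intros)
  then show ?thesis
    unfolding e Qt_def Pt_def using Vh_cont[OF z] in_cont
    by (simp add: form_expand continuous_intros) (simp add: field_simps cQ_def cP_def)
qed

lemma Q_eq:
  assumes z: "z \<in> V\<^sub>h"
  shows "ip Q z = ip Qt z + dt / 2 * (stiff P z + stiff Pt z + tri U P z + tri U Pt z)"
proof -
  define \<alpha> where "\<alpha> = Ah a b m (\<lambda>y. (P y + P0 y) / 2)"
  define \<beta> where "\<beta> = Ph a b m (\<lambda>y. U y * (P y + P0 y))"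
  define \<gamma> where "\<gamma> = Ah a b m p1"
  define \<delta> where "\<delta> = Ph a b m (\<lambda>y. U y * p1 y)"
  have V: "\<alpha> \<in> V\<^sub>h" "\<beta> \<in> V\<^sub>h" "\<gamma> \<in> V\<^sub>h" "\<delta> \<in> V\<^sub>h"
    unfolding \<alpha>_def \<beta>_def \<gamma>_def \<delta>_def
    by (rule ip_Ah_mean(1) ip_Ph_mult_add(1) Ah(1) ip_Ph_mult(1); rule in_Vh)+
  have e: "ip \<alpha> z = (stiff P z + stiff P0 z) / 2" "ip \<beta> z = tri U P z + tri U P0 z"
    "ip \<gamma> z = stiff p1 z" "ip \<delta> z = tri U p1 z"
    unfolding \<alpha>_def \<beta>_def \<gamma>_def \<delta>_def
    by (rule ip_Ah_mean(2) ip_Ph_mult_add(2) Ah(2) ip_Ph_mult(2); rule in_Vh z)+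
  have "Q = (\<lambda>x. Q0 x + dt * (\<alpha> x + 1/2 * \<beta> x) - C1 * p1 x * d0 + 1/2 * dt * C1 * (\<gamma> x + \<delta> x) * d1)"
    using step unfolding fe_step_def Let_def \<alpha>_def \<beta>_def \<gamma>_def \<delta>_def by blast
  then have "ip Q z = ip Q0 z + dt * (ip \<alpha> z + 1/2 * ip \<beta> z) - C1 * ip p1 z * d0
      + 1/2 * dt * C1 * (ip \<gamma> z + ip \<delta> z) * d1"
    using V[THEN Vh_cont] in_cont Vh_cont[OF z]
    by (simp add: ip_left continuous_intros)
  then show ?thesis
    unfolding e Qt_def Pt_def using Vh_cont[OF z] in_cont
    by (simp add: form_expand continuous_intros) (simp add: field_simps cQ_def cP_def)
qed

text \<open>The scheme has \<open>C1\<^sup>2 * dt\<close> where \<open>(Pt\<^sup>2 + Qt\<^sup>2) / 2\<close> has \<open>C1\<^sup>2 * (d0\<^sup>2 + d1\<^sup>2) / 2\<close>; these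
  agree only in mean.\<close>

definition "source z = (tri P0 P0 z + tri Q0 Q0 z) / 2 + C1 * d1 * tri P0 p1 z - C1 * d0 * tri Q0 p1 z
  + C1\<^sup>2 * dt * tri p1 p1 z"

lemma V_eq:
  assumes z: "z \<in> V\<^sub>h"
  shows "ip V z = ip Vt z + dt * ((stiff U z + stiff U0 z - ip U z - ip U0 z) / 4 + source z)"
proof -
  define \<alpha> where "\<alpha> = Ah a b m (\<lambda>y. (U y + U0 y) / 2)"
  define \<beta> where "\<beta> = Ph a b m (\<lambda>y. (P0 y)\<^sup>2 + (Q0 y)\<^sup>2)"
  define \<gamma> where "\<gamma> = Ph a b m (\<lambda>y. P0 y * p1 y * d1 - Q0 y * p1 y * d0 + C1 * dt * (p1 y)\<^sup>2)"
  have c: "cont (\<lambda>y. (P0 y)\<^sup>2 + (Q0 y)\<^sup>2)"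
    "cont (\<lambda>y. P0 y * p1 y * d1 - Q0 y * p1 y * d0 + C1 * dt * (p1 y)\<^sup>2)"
    using in_cont by (auto intro!: continuous_intros)
  have V: "\<alpha> \<in> V\<^sub>h" "\<beta> \<in> V\<^sub>h" "\<gamma> \<in> V\<^sub>h"
    unfolding \<alpha>_def \<beta>_def \<gamma>_def
    by (rule ip_Ah_mean(1)[OF V_Vh(3) V0_Vh(3)] Ph_cont(1)[OF c(1)] Ph_cont(1)[OF c(2)])+
  have e: "ip \<alpha> z = (stiff U z + stiff U0 z) / 2"
    "ip \<beta> z = tri P0 P0 z + tri Q0 Q0 z"
    "ip \<gamma> z = tri P0 p1 z * d1 - tri Q0 p1 z * d0 + C1 * dt * tri p1 p1 z"
    unfolding \<alpha>_def \<beta>_def \<gamma>_def Ph_cont(2)[OF c(1) z] Ph_cont(2)[OF c(2) z] tri_def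
    using ip_Ah_mean(2)[OF V_Vh(3) V0_Vh(3) z] in_cont Vh_cont[OF z]
    by (simp_all add: ip_left power2_eq_square continuous_intros)
  have "V = (\<lambda>x. V0 x + dt * (1/2 * \<alpha> x - 1/2 * ((U x + U0 x) / 2) + 1/2 * \<beta> x)
      + 1/2 * C2 * p2 x * d2 + dt * C1 * \<gamma> x)"
    using step unfolding fe_step_def Let_def \<alpha>_def \<beta>_def \<gamma>_def by blast
  then have "ip V z = ip V0 z + dt * (1/2 * ip \<alpha> z - 1/2 * ((ip U z + ip U0 z) / 2) + 1/2 * ip \<beta> z)
      + 1/2 * C2 * ip p2 z * d2 + dt * C1 * ip \<gamma> z"
    using V[THEN Vh_cont] in_cont Vh_cont[OF z]
    by (simp add: ip_left continuous_intros)
  then show ?thesis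
    unfolding e Vt_def source_def using Vh_cont[OF z] in_cont
    by (simp add: form_expand continuous_intros) (simp add: field_simps power2_eq_square cV_def)
qed

text \<open>The noise in the equation for \<open>U\<close> is just what replaces \<open>V0\<close>
  by \<open>Vt\<close>. So \<open>V + Vt\<close> is a difference quotient of \<open>U\<close>, and
  the energy identity for the wave part can be tested with it.\<close>

lemma U_eq: "U = (\<lambda>x. U0 x + dt * (V x + Vt x))"
proof
  fix x
  have "U x = U0 x + dt * (V x + V0 x) + 1/2 * dt * C2 * p2 x * d2"
    using step unfolding fe_step_def Let_def by blast
  then show "U x = U0 x + dt * (V x + Vt x)" by (simp add: Vt_def cV_def field_simps)
qed

lemma ip_U_eq: "z \<in> V\<^sub>h \<Longrightarrow> ip U z = ip U0 z + dt * (ip V z + ip Vt z)"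
  by (subst U_eq) (use in_cont Vh_cont in \<open>simp add: ip_left continuous_intros\<close>)

section \<open>Pathwise conservation laws and the resulting increments\<close>

text \<open>The equation for \<open>P\<close> is tested with \<open>P + Pt\<close> and that for
  \<open>Q\<close> with \<open>Q + Qt\<close>; by symmetry of \<open>stiff\<close> and
  \<open>tri U\<close> the right-hand sides cancel in the sum.\<close>

lemma charge_step: "charge a b P Q = charge a b Pt Qt"
proof -
  have "ip P P + ip P Pt + ip Q Q + ip Q Qt = ip Pt P + ip Pt Pt + ip Qt Q + ip Qt Qt"
    unfolding P_eq[OF V_Vh(1)] P_eq[OF t_Vh(1)] Q_eq[OF V_Vh(2)] Q_eq[OF t_Vh(2)]
      stiff_commute[of Q] stiff_commute[of Qt] tri_commute23[of U Q] tri_commute23[of U Qt]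
    by (simp add: algebra_simps)
  then show ?thesis unfolding charge_def ip_commute[of P Pt] ip_commute[of Q Qt] by linarith
qed

text \<open>Here the tests are crossed: \<open>Q - Qt\<close> in the equation for \<open>P\<close>
  and \<open>P - Pt\<close> in that for \<open>Q\<close>. Both left-hand sides equal the inner
  product of \<open>P - Pt\<close> and \<open>Q - Qt\<close>, so the right-hand sides, which carry
  opposite signs, coincide.\<close>

lemma schroedinger_energy_step:
  "stiff P P + stiff Q Q + tri U P P + tri U Q Q = stiff Pt Pt + stiff Qt Qt + tri U Pt Pt + tri U Qt Qt"
proof -
  have 1: "ip P Q - ip P Qt - ip Pt Q + ip Pt Qt
      = - dt / 2 * (stiff Q Q - stiff Qt Qt + tri U Q Q - tri U Qt Qt)"
    unfolding P_eq[OF V_Vh(2)] P_eq[OF t_Vh(2)] stiff_commute[of Qt Q] tri_commute23[of U Qt Q]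
    by (simp add: algebra_simps)
  have 2: "ip Q P - ip Q Pt - ip Qt P + ip Qt Pt
      = dt / 2 * (stiff P P - stiff Pt Pt + tri U P P - tri U Pt Pt)"
    unfolding Q_eq[OF V_Vh(1)] Q_eq[OF t_Vh(1)] stiff_commute[of Pt P] tri_commute23[of U Pt P]
    by (simp add: algebra_simps)
  have "ip P Q - ip P Qt - ip Pt Q + ip Pt Qt = ip Q P - ip Q Pt - ip Qt P + ip Qt Pt"
    using ip_commute[of Q] ip_commute[of Qt] by simp
  then have "dt / 2 * (stiff Q Q - stiff Qt Qt + tri U Q Q - tri U Qt Qt
      + (stiff P P - stiff Pt Pt + tri U P P - tri U Pt Pt)) = 0"
    using 1 2 by (simp add: distrib_left)
  then show ?thesis using dt by simp
qed

lemma wave_energy_step: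
  "4 * ip V V - 4 * ip Vt Vt
    = stiff U U - stiff U0 U0 - ip U U + ip U0 U0 + 4 * (source U - source U0)"
proof -
  \<comment> \<open>\<open>s\<close> is the functional on the right of the equation for
    \<open>V\<close>. By linearity and \<open>U_eq\<close>, \<open>dt * (s V + s Vt)\<close> is the
    difference \<open>s U - s U0\<close>, in which the mixed terms in \<open>U\<close> and
    \<open>U0\<close> cancel by symmetry.\<close>
  define s where "s = (\<lambda>z. (stiff U z + stiff U0 z - ip U z - ip U0 z) / 4 + source z)"
  have V: "ip V z = ip Vt z + dt * s z" if "z \<in> V\<^sub>h" for z using V_eq[OF that] by (simp add: s_def)
  have "s U = s U0 + dt * (s V + s Vt)"
  proof -
    have "s (\<lambda>x. U0 x + dt * (V x + Vt x)) = s U0 + dt * (s V + s Vt)"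
      unfolding s_def source_def using in_cont
      by (simp add: form_expand continuous_intros) (simp add: field_simps)
    then show ?thesis using U_eq by simp
  qed
  then have "4 * (s U - s U0) = 4 * dt * (s V + s Vt)" by simp
  also have "\<dots> = 4 * ip V V - 4 * ip Vt Vt"
    using V[OF V_Vh(4)] V[OF t_Vh(3)] ip_commute[of V Vt] by (simp add: algebra_simps)
  finally show ?thesis
    unfolding s_def stiff_commute[of U U0] ip_commute[of U U0] by argo
qed

lemma charge_increment:
  "charge a b P Q = charge a b P0 Q0 + 2 * C1 * (ip P0 p1 * d1) - 2 * C1 * (ip Q0 p1 * d0)
    + C1\<^sup>2 * ip p1 p1 * (d0\<^sup>2 + d1\<^sup>2)"
  unfolding charge_step unfolding charge_def Pt_def Qt_def
  using in_cont ip_commute[of p1 P0] ip_commute[of p1 Q0]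
  by (simp add: form_expand continuous_intros) (simp add: algebra_simps power2_eq_square cP_def cQ_def cV_def)

lemma energy_increment:
  "energy a b m P Q U V = energy a b m P0 Q0 U0 V0
    + 4 * C1 * ((stiff P0 p1 + tri U0 P0 p1) * d1) - 4 * C1 * ((stiff Q0 p1 + tri U0 Q0 p1) * d0)
    + 2 * C1\<^sup>2 * stiff p1 p1 * (d0\<^sup>2 + d1\<^sup>2)
    - 4 * C2 * (ip V0 p2 * d2) - C2\<^sup>2 * ip p2 p2 * d2\<^sup>2
    + 4 * C1\<^sup>2 * dt * tri U0 p1 p1
    + 2 * C1\<^sup>2 * ((d0\<^sup>2 + d1\<^sup>2 - 2 * dt) * tri U p1 p1)"
proof -
  \<comment> \<open>With the new \<open>U\<close>, twice the source reproduces the coupling of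
    \<open>Pt, Qt\<close> except for the quadratic noise, where the scheme has \<open>2 * dt\<close>
    in place of \<open>d0\<^sup>2 + d1\<^sup>2\<close>.\<close>
  have S: "tri U Pt Pt + tri U Qt Qt - 2 * source U = C1\<^sup>2 * ((d0\<^sup>2 + d1\<^sup>2 - 2 * dt) * tri U p1 p1)"
  proof -
    have c: "tri v w U = tri U v w" for v w using tri_commute12 tri_commute23 by metis
    show ?thesis
      unfolding Pt_def Qt_def source_def c
      using in_cont tri_commute23[of U p1 P0] tri_commute23[of U p1 Q0]
      by (simp add: form_expand continuous_intros) (simp add: algebra_simps power2_eq_square cP_def cQ_def cV_def)
  qed
  \<comment> \<open>The source at the old \<open>U\<close> returns the old coupling energy; its
    deterministic noise part is the origin of the term in \<open>tri U0 p1 p1\<close> that the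
    energy law sums over the steps.\<close>
  have S0: "4 * source U0 = 2 * (tri U0 P0 P0 + tri U0 Q0 Q0) + 4 * (C1 * (tri U0 P0 p1 * d1))
      - 4 * (C1 * (tri U0 Q0 p1 * d0)) + 4 * (C1\<^sup>2 * dt * tri U0 p1 p1)"
  proof -
    have c: "tri v w U0 = tri U0 v w" for v w using tri_commute12 tri_commute23 by metis
    show ?thesis
      unfolding source_def c by (simp add: algebra_simps)
  qed
  have A: "stiff Pt Pt + stiff Qt Qt = stiff P0 P0 + stiff Q0 Q0 + 2 * C1 * (stiff P0 p1 * d1)
      - 2 * C1 * (stiff Q0 p1 * d0) + C1\<^sup>2 * stiff p1 p1 * (d0\<^sup>2 + d1\<^sup>2)"
    unfolding Pt_def Qt_def
    using stiff_commute[of p1 P0] stiff_commute[of p1 Q0]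
    by (simp add: form_expand) (simp add: algebra_simps power2_eq_square cP_def cQ_def cV_def)
  have W: "4 * ip Vt Vt = 4 * ip V0 V0 + 4 * C2 * (ip V0 p2 * d2) + C2\<^sup>2 * ip p2 p2 * d2\<^sup>2"
    unfolding Vt_def using in_cont ip_commute[of p2 V0]
    by (simp add: form_expand continuous_intros) (simp add: algebra_simps power2_eq_square cP_def cQ_def cV_def)
  \<comment> \<open>With the nonlinear monomials named, the identity becomes linear in its atoms and
    follows from the collected equations by linear arithmetic.\<close>
  define r1 r2 r3 r4 where "r1 = C1 * (tri U0 P0 p1 * d1)" "r2 = C1 * (tri U0 Q0 p1 * d0)"
    "r3 = C1\<^sup>2 * dt * tri U0 p1 p1" "r4 = C1\<^sup>2 * ((d0\<^sup>2 + d1\<^sup>2 - 2 * dt) * tri U p1 p1)"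
  define r5 r6 r7 where "r5 = C1 * (stiff P0 p1 * d1)" "r6 = C1 * (stiff Q0 p1 * d0)"
    "r7 = C1\<^sup>2 * stiff p1 p1 * (d0\<^sup>2 + d1\<^sup>2)"
  define r8 r9 where "r8 = C2 * (ip V0 p2 * d2)" "r9 = C2\<^sup>2 * ip p2 p2 * d2\<^sup>2"
  note r = r1_r2_r3_r4_def r5_r6_r7_def r8_r9_def
  have "2 * tri U P P + 2 * tri U Q Q - ip U U - 4 * ip V V + stiff U U + 2 * stiff P P + 2 * stiff Q Q
    = 2 * tri U0 P0 P0 + 2 * tri U0 Q0 Q0 - ip U0 U0 - 4 * ip V0 V0 + stiff U0 U0 + 2 * stiff P0 P0
      + 2 * stiff Q0 Q0 + 4 * (r5 + r1) - 4 * (r6 + r2) + 2 * r7 - 4 * r8 - r9 + 4 * r3 + 2 * r4"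
  proof -
    have S: "tri U Pt Pt + tri U Qt Qt - 2 * source U = r4"
      using S by (simp add: r)
    have S0: "4 * source U0 = 2 * (tri U0 P0 P0 + tri U0 Q0 Q0) + 4 * r1 - 4 * r2 + 4 * r3"
      using S0 by (simp add: r)
    have A: "stiff Pt Pt + stiff Qt Qt = stiff P0 P0 + stiff Q0 Q0 + 2 * r5 - 2 * r6 + r7"
      using A by (simp add: r)
    have W: "4 * ip Vt Vt = 4 * ip V0 V0 + 4 * r8 + r9"
      using W by (simp add: r)
    show ?thesis
      using schroedinger_energy_step wave_energy_step S S0 A W by argo
  qed
  then show ?thesis
    unfolding energy_forms[OF V_Vh] energy_forms[OF V0_Vh] r by (simp add: algebra_simps)
qed

text \<open>Inserting the equation for \<open>V\<close> into that for \<open>U\<close> and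
  collecting the new \<open>U\<close> on the left gives the operator
  \<open>(1 + dt^2/4) - dt^2/4 * A\<close>. No random potential enters it, and the right-hand side
  is affine in the increments because \<open>source\<close> is.\<close>

lemma wave_form_U:
  assumes z: "z \<in> V\<^sub>h"
  shows "wave_form dt U z = wave_form dt U0 z + dt\<^sup>2 / 2 * (stiff U0 z - ip U0 z)
    + 2 * dt * ip V0 z + dt * C2 * d2 * ip p2 z + dt\<^sup>2 * source z"
proof -
  have "ip U z = ip U0 z + dt * (2 * ip Vt z + dt * ((stiff U z + stiff U0 z - ip U z - ip U0 z) / 4 + source z))"
    using ip_U_eq[OF z] V_eq[OF z] by simp
  then show ?thesis
    unfolding wave_form_def ip_tilde[OF z] by (simp add: field_simps power2_eq_square)
qed

end

section \<open>The filtration of the noise\<close>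

text \<open>Countable unions are admissible because countably many exceptional null sets unite to
  one. The restriction to events keeps the closure inside the given measurable sets even if the
  space is not complete.\<close>

lemma (in prob_space) AE_closure_sigma_algebra:
  assumes S: "sigma_algebra (space M) S" "S \<subseteq> events"
  shows "sigma_algebra (space M)
    {A \<in> events. \<exists>A'\<in>S. AE \<omega> in M. \<omega> \<in> A \<longleftrightarrow> \<omega> \<in> A'}" (is "sigma_algebra _ ?G")
proof -
  interpret S: sigma_algebra "space M" S by (rule S(1))
  show ?thesis
    unfolding sigma_algebra_iff2
  proof (intro conjI ballI allI impI)
    show "?G \<subseteq> Pow (space M)" using sets.sets_into_space by auto
    show "{} \<in> ?G" by auto
  next
    fix A assume "A \<in> ?G"
    then obtain A' where A: "A \<in> events" "A' \<in> S" "AE \<omega> in M. \<omega> \<in> A \<longleftrightarrow> \<omega> \<in> A'" by auto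
    have "AE \<omega> in M. \<omega> \<in> space M - A \<longleftrightarrow> \<omega> \<in> space M - A'" using A(3) by eventually_elim auto
    then show "space M - A \<in> ?G" using A(1,2) by blast
  next
    fix A :: "nat \<Rightarrow> 'a set" assume "range A \<subseteq> ?G"
    then have "\<forall>i. A i \<in> events \<and> (\<exists>A'\<in>S. AE \<omega> in M. \<omega> \<in> A i \<longleftrightarrow> \<omega> \<in> A')" by auto
    then obtain A' where A: "\<And>i. A i \<in> events" "\<And>i. A' i \<in> S"
      "\<And>i. AE \<omega> in M. \<omega> \<in> A i \<longleftrightarrow> \<omega> \<in> A' i" by metis
    have "AE \<omega> in M. \<forall>i. \<omega> \<in> A i \<longleftrightarrow> \<omega> \<in> A' i" using A(3) by (simp add: AE_all_countable)
    then have "AE \<omega> in M. \<omega> \<in> (\<Union>i. A i) \<longleftrightarrow> \<omega> \<in> (\<Union>i. A' i)" by eventually_elim auto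
    moreover have "(\<Union>i. A' i) \<in> S" using A(2) by auto
    ultimately show "(\<Union>i. A i) \<in> ?G" using A(1) by blast
  qed
qed

text \<open>\<open>D k n\<close> is the increment of the \<open>k\<close>-th Wiener process in step \<open>n\<close>. The \<open>\<sigma>\<close>-algebras are
  closed under almost sure modification, because the scheme holds only almost surely.\<close>

locale noise = prob_space M for M :: "'w measure" +
  fixes D :: "nat \<Rightarrow> nat \<Rightarrow> 'w \<Rightarrow> real" and G :: "nat \<Rightarrow> 'w measure" and dt :: real
  assumes dt_pos: "0 < dt"
    and G_sub: "subalgebra M (G n)"
    and G_mono: "subalgebra (G (Suc n)) (G n)"
    and AE_closed: "\<lbrakk>f \<in> borel_measurable M; g \<in> borel_measurable (G n); AE \<omega> in M. f \<omega> = g \<omega>\<rbrakk>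
      \<Longrightarrow> (f :: 'w \<Rightarrow> real) \<in> borel_measurable (G n)"
    and D_measurable: "k < 3 \<Longrightarrow> D k n \<in> borel_measurable (G (Suc n))"
    and D_normal: "k < 3 \<Longrightarrow> distributed M lborel (D k n) (normal_density 0 (sqrt dt))"
    and D_indep: "X \<in> borel_measurable (G n) \<Longrightarrow>
      indep_vars (\<lambda>_. borel) (\<lambda>i. case i of 0 \<Rightarrow> X | Suc k \<Rightarrow> D k n) {..<4}"

section \<open>Independence of the past and the Wiener increments\<close>

context prob_space
begin

lemma measurable_preimages:
  assumes "X \<in> borel_measurable M"
  shows "sigma_sets (space M) {X -` S \<inter> space M |S. S \<in> sets borel} \<subseteq> events"
  using assms by (intro sets.sigma_sets_subset) (auto intro: measurable_sets)

lemma Wiener_increment_gen_sigma: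
  assumes st: "s \<in> {0..}" "t \<in> {0..}"
  shows "sigma_sets (space M) {(\<lambda>\<omega>. W t \<omega> - W s \<omega>) -` S \<inter> space M |S. S \<in> sets borel}
    \<subseteq> gen_sigma M {0..} W"
proof -
  let ?E = "{W i -` S \<inter> space M | i S. i \<in> {0..} \<and> S \<in> sets borel}"
  let ?N = "sigma (space M) ?E"
  have E: "?E \<subseteq> Pow (space M)" by auto
  have N: "sets ?N = gen_sigma M {0..} W" "space ?N = space M"
    using E by (auto simp: gen_sigma_def)
  have "W i \<in> borel_measurable ?N" if "i \<in> {0..}" for i
  proof (rule measurableI)
    fix A :: "real set" assume "A \<in> sets borel"
    then have "W i -` A \<inter> space M \<in> ?E" using that by blast
    then show "W i -` A \<inter> space ?N \<in> sets ?N" using E by (simp add: sigma_sets.Basic)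
  qed simp
  then have "(\<lambda>\<omega>. W t \<omega> - W s \<omega>) \<in> borel_measurable ?N" using st by simp
  then have "{(\<lambda>\<omega>. W t \<omega> - W s \<omega>) -` S \<inter> space ?N |S. S \<in> sets borel} \<subseteq> sets ?N"
    using measurable_sets by blast
  then have "sigma_sets (space ?N) {(\<lambda>\<omega>. W t \<omega> - W s \<omega>) -` S \<inter> space ?N |S. S \<in> sets borel} \<subseteq> sets ?N"
    by (rule sets.sigma_sets_subset)
  then show ?thesis unfolding N .
qed

lemma Wiener_increment_measurable:
  assumes "wiener_process M W" "0 \<le> s" "0 \<le> t"
  shows "(\<lambda>\<omega>. W t \<omega> - W s \<omega>) \<in> borel_measurable M"
proof -
  have "W s \<in> borel_measurable M" "W t \<in> borel_measurable M"
    using assms by (auto simp: wiener_process_def)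
  then show ?thesis by simp
qed

text \<open>Three layers of independence are merged into one product formula: across time by
  independent increments, across the processes by \<open>wiener_indep\<close>, and from the initial
  data by \<open>initial_indep\<close>. The index \<open>(3, 0)\<close> stands for the initial
  \<sigma>-algebra.\<close>

lemma noise_families_indep:
  fixes B :: "nat \<Rightarrow> real \<Rightarrow> 'a \<Rightarrow> real"
  assumes dt: "0 < dt" and N: "0 < (N :: nat)"
    and wiener: "\<And>k. k \<in> {0, 1, 2} \<Longrightarrow> wiener_process M (B k)"
    and wiener_indep: "indep_sets (\<lambda>k. gen_sigma M {0..} (B k)) {0, 1, 2}"
    and F0: "subalgebra M F0"
    and initial_indep: "indep_set (sets F0) (gen_sigma M ({0, 1, 2} \<times> {0..}) (\<lambda>(k, t). B k t))"
  defines "D \<equiv> \<lambda>k j \<omega>. B k (real (Suc j) * dt) \<omega> - B k (real j * dt) \<omega>"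
  defines "F \<equiv> \<lambda>(k, j). if k < (3::nat)
      then sigma_sets (space M) {D k j -` S \<inter> space M |S. S \<in> sets borel} else sets F0"
  shows "indep_sets F (insert (3, 0) ({..<3} \<times> {..<N}))" (is "indep_sets F ?I")
proof -
  have D_meas: "D k j \<in> borel_measurable M" if "k < 3" for k j
    unfolding D_def
    by (rule Wiener_increment_measurable[OF wiener]) (use that dt in auto)
  have Fev: "F i \<subseteq> events" for i
    using measurable_preimages[OF D_meas] F0 by (cases i) (auto simp: F_def subalgebra_def)
  have Fsp: "space M \<in> F i" for i
    using F0 sets.top[of F0] by (cases i) (auto simp: F_def subalgebra_def sigma_sets_top)
  show ?thesis
  proof (subst indep_sets_finite)
    show "?I \<noteq> {}" "finite ?I" by auto
    show "\<And>i. F i \<subseteq> events" "\<And>i. space M \<in> F i" by (fact Fev, fact Fsp)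
    show "\<forall>A\<in>Pi ?I F. prob (\<Inter>j\<in>?I. A j) = (\<Prod>j\<in>?I. prob (A j))"
    proof
      fix A assume A: "A \<in> Pi ?I F"
      \<comment> \<open>\<open>R k\<close> gathers all events of the process \<open>k\<close>. It
        lies in the \<sigma>-algebra of the whole process, where independence between processes
        applies, and its probability factorises over time.\<close>
      define R where "R k = (\<Inter>j<N. A (k, j))" for k
      have A0: "A (3, 0) \<in> sets F0" using A by (auto simp: F_def)
      have AD: "A (k, j) \<in> sigma_sets (space M) {D k j -` S \<inter> space M |S. S \<in> sets borel}"
        if "k < 3" "j < N" for k j using A that by (auto simp: F_def Pi_iff)
      have R_sigma: "R k \<in> gen_sigma M {0..} (B k)" if k: "k < 3" for k
      proof -
        interpret gs: sigma_algebra "space M" "gen_sigma M {0..} (B k)"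
          unfolding gen_sigma_def by (rule sigma_algebra_sigma_sets) auto
        have "A (k, j) \<in> gen_sigma M {0..} (B k)" if j: "j < N" for j
          by (rule subsetD[OF Wiener_increment_gen_sigma[of "real j * dt" "real (Suc j) * dt" "B k"]
                AD[OF k j, unfolded D_def]]) (use dt in auto)
        then show ?thesis unfolding R_def using N by (intro gs.finite_INT) auto
      qed
      have R_prob: "prob (R k) = (\<Prod>j<N. prob (A (k, j)))" if k: "k < 3" for k
      proof -
        have "k \<in> {0, 1, 2}" using k by auto
        from wiener[OF this] have W: "\<And>(s :: nat \<Rightarrow> real) n. 0 \<le> s 0 \<and> (\<forall>i<n. s i < s (Suc i)) \<Longrightarrow>
            indep_vars (\<lambda>_. borel) (\<lambda>i \<omega>. B k (s (Suc i)) \<omega> - B k (s i) \<omega>) {..<n}"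
          by (simp add: wiener_process_def)
        have "indep_vars (\<lambda>_. borel) (\<lambda>j. D k j) {..<N}"
          unfolding D_def by (rule W) (use dt in auto)
        then have "indep_sets (\<lambda>j. sigma_sets (space M) {D k j -` S \<inter> space M |S. S \<in> sets borel}) {..<N}"
          by (simp add: indep_vars_def)
        from indep_setsD[OF this, of "{..<N}" "\<lambda>j. A (k, j)"] show ?thesis
          unfolding R_def using N AD[OF k] by auto
      qed
      have RR: "prob (\<Inter>k\<in>{0,1,2}. R k) = (\<Prod>k\<in>{0,1,2}. prob (R k))"
        by (rule indep_setsD[OF wiener_indep]) (use R_sigma in auto)
      have R_all: "(\<Inter>k\<in>{0,1,2}. R k) \<in> gen_sigma M ({0, 1, 2} \<times> {0..}) (\<lambda>(k, t). B k t)"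
      proof -
        interpret gs: sigma_algebra "space M" "gen_sigma M ({0, 1, 2} \<times> {0..}) (\<lambda>(k, t). B k t)"
          unfolding gen_sigma_def by (rule sigma_algebra_sigma_sets) auto
        have sub: "gen_sigma M {0..} (B k) \<subseteq> gen_sigma M ({0, 1, 2} \<times> {0..}) (\<lambda>(k, t). B k t)"
          if "k \<in> {0, 1, 2}" for k
          unfolding gen_sigma_def
        proof (rule sigma_sets_mono', safe)
          fix i :: real and S :: "real set" assume "0 \<le> i" "S \<in> sets borel"
          then show "\<exists>i' S'. B k i -` S \<inter> space M = (case i' of (k, t) \<Rightarrow> B k t) -` S' \<inter> space M \<and>
              i' \<in> {0, 1, 2} \<times> {0..} \<and> S' \<in> sets borel"
            using that by (intro exI[of _ "(k, i)"] exI[of _ S]) auto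
        qed
        have "R k \<in> gen_sigma M ({0, 1, 2} \<times> {0..}) (\<lambda>(k, t). B k t)" if "k \<in> {0, 1, 2}" for k
          by (rule subsetD[OF sub[OF that] R_sigma]) (use that in auto)
        then show ?thesis by (intro gs.finite_INT) auto
      qed
      have three: "{..<3} = {0, 1, 2::nat}" by auto
      have "(\<Inter>j\<in>?I. A j) = A (3, 0) \<inter> (\<Inter>k\<in>{0,1,2}. R k)"
        unfolding R_def three[symmetric] by auto
      then have "prob (\<Inter>j\<in>?I. A j) = prob (A (3, 0)) * (\<Prod>k\<in>{..<3}. \<Prod>j<N. prob (A (k, j)))"
        using indep_setD[OF initial_indep A0 R_all] RR R_prob by (simp add: three)
      also have "\<dots> = prob (A (3, 0)) * (\<Prod>i\<in>{..<3} \<times> {..<N}. prob (A i))"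
        by (simp add: prod.cartesian_product)
      also have "\<dots> = (\<Prod>j\<in>?I. prob (A j))" by simp
      finally show "prob (\<Inter>j\<in>?I. A j) = (\<Prod>j\<in>?I. prob (A j))" .
    qed
  qed
qed

lemma noise_exists:
  fixes B :: "nat \<Rightarrow> real \<Rightarrow> 'a \<Rightarrow> real"
  assumes dt: "0 < dt"
    and wiener: "\<And>k. k \<in> {0, 1, 2} \<Longrightarrow> wiener_process M (B k)"
    and wiener_indep: "indep_sets (\<lambda>k. gen_sigma M {0..} (B k)) {0, 1, 2}"
    and F0: "subalgebra M F0"
    and initial_indep: "indep_set (sets F0) (gen_sigma M ({0, 1, 2} \<times> {0..}) (\<lambda>(k, t). B k t))"
  shows "\<exists>G. noise M (\<lambda>k j \<omega>. B k (real (Suc j) * dt) \<omega> - B k (real j * dt) \<omega>) G dt \<and>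
    subalgebra (G 0) F0"
proof -
  define D where "D = (\<lambda>k j \<omega>. B k (real (Suc j) * dt) \<omega> - B k (real j * dt) \<omega>)"
  define F where "F = (\<lambda>(k, j). if k < (3::nat)
      then sigma_sets (space M) {D k j -` S \<inter> space M |S. S \<in> sets borel} else sets F0)"
  \<comment> \<open>\<open>J n\<close> indexes the initial data and the increments of the steps
    before \<open>n\<close>; the increment \<open>D k n\<close> itself enters only at level
    \<open>Suc n\<close>.\<close>
  define J :: "nat \<Rightarrow> (nat \<times> nat) set" where "J n = insert (3, 0) ({..<3} \<times> {..<n})" for n
  have ind: "indep_sets F (J n)" if "0 < n" for n
    unfolding F_def D_def J_def
    by (rule noise_families_indep[OF dt that wiener wiener_indep F0 initial_indep])
  have D_meas: "D k j \<in> borel_measurable M" if "k < 3" for k j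
    unfolding D_def
    by (rule Wiener_increment_measurable[OF wiener]) (use that dt in auto)
  have Fev: "F i \<subseteq> events" for i
    using measurable_preimages[OF D_meas] F0 by (cases i) (auto simp: F_def subalgebra_def)
  define S where "S n = sigma_sets (space M) (\<Union>i\<in>J n. F i)" for n
  have S_alg: "sigma_algebra (space M) (S n)" for n
    unfolding S_def using Fev sets.sets_into_space by (intro sigma_algebra_sigma_sets) blast
  have S_ev: "S n \<subseteq> events" for n
    unfolding S_def using Fev by (intro sets.sigma_sets_subset) auto
  have S_mono: "S n \<subseteq> S (Suc n)" for n
    unfolding S_def by (rule sigma_sets_mono') (auto simp: J_def)
  have FS: "F i \<subseteq> S n" if "i \<in> J n" for i n
    using that unfolding S_def by (auto intro: sigma_sets.Basic)
  define GG where "GG n = {A \<in> events. \<exists>A'\<in>S n. AE \<omega> in M. \<omega> \<in> A \<longleftrightarrow> \<omega> \<in> A'}" for n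
  have GG_alg: "sigma_algebra (space M) (GG n)" for n
    unfolding GG_def by (rule AE_closure_sigma_algebra[OF S_alg S_ev])
  define G where "G n = sigma (space M) (GG n)" for n
  have GGp: "GG n \<subseteq> Pow (space M)" for n using sets.sets_into_space by (auto simp: GG_def)
  have Gs: "sets (G n) = GG n" "space (G n) = space M" for n
    unfolding G_def using GGp sigma_algebra.sigma_sets_eq[OF GG_alg] by auto
  have SG: "S n \<subseteq> GG n" for n using S_ev unfolding GG_def by auto
  have "noise M D G dt"
  proof (unfold_locales)
    show "0 < dt" by fact
    show "subalgebra M (G n)" for n unfolding subalgebra_def Gs by (auto simp: GG_def)
    show "subalgebra (G (Suc n)) (G n)" for n
      unfolding subalgebra_def Gs using S_mono by (auto simp: GG_def)
    show "f \<in> borel_measurable (G n)"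
      if f: "f \<in> borel_measurable M" and g: "g \<in> borel_measurable (G n)" and eq: "AE \<omega> in M. f \<omega> = g \<omega>"
      for f g :: "'a \<Rightarrow> real" and n
    proof (rule measurableI)
      fix A :: "real set" assume A: "A \<in> sets borel"
      have "g -` A \<inter> space M \<in> GG n" using measurable_sets[OF g A] by (simp add: Gs)
      then obtain A' where A': "A' \<in> S n" "AE \<omega> in M. \<omega> \<in> g -` A \<inter> space M \<longleftrightarrow> \<omega> \<in> A'"
        by (auto simp: GG_def)
      have "AE \<omega> in M. \<omega> \<in> f -` A \<inter> space M \<longleftrightarrow> \<omega> \<in> A'"
        using eq A'(2) by eventually_elim auto
      then show "f -` A \<inter> space (G n) \<in> sets (G n)"
        unfolding Gs GG_def using A'(1) measurable_sets[OF f A] by blast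
    qed simp
    show DG: "D k n \<in> borel_measurable (G (Suc n))" if k: "k < 3" for k n
    proof (rule measurableI)
      fix A :: "real set" assume "A \<in> sets borel"
      then have "D k n -` A \<inter> space M \<in> F (k, n)" using k by (auto simp: F_def)
      moreover have "F (k, n) \<subseteq> S (Suc n)" by (rule FS) (use k in \<open>auto simp: J_def\<close>)
      ultimately show "D k n -` A \<inter> space (G (Suc n)) \<in> sets (G (Suc n))"
        unfolding Gs using SG by blast
    qed simp
    show "distributed M lborel (D k n) (normal_density 0 (sqrt dt))" if k: "k < 3" for k n
    proof -
      have "k \<in> {0, 1, 2}" using k by auto
      from wiener[OF this] have "\<And>s t. 0 \<le> s \<Longrightarrow> s < t \<Longrightarrow>
          distributed M lborel (\<lambda>\<omega>. B k t \<omega> - B k s \<omega>) (normal_density 0 (sqrt (t - s)))"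
        by (simp add: wiener_process_def)
      from this[of "real n * dt" "real (Suc n) * dt"] show ?thesis
        using dt by (simp add: D_def algebra_simps)
    qed
    show "indep_vars (\<lambda>_. borel) (\<lambda>i. case i of 0 \<Rightarrow> X | Suc k \<Rightarrow> D k n) {..<4}"
      if X: "X \<in> borel_measurable (G n)" for X n
    proof -
      let ?Y = "\<lambda>i. case i of 0 \<Rightarrow> X | Suc k \<Rightarrow> D k n"
      have subM: "subalgebra M (G n)" unfolding subalgebra_def Gs by (auto simp: GG_def)
      have meas: "?Y i \<in> borel_measurable M" if "i < 4" for i
        using that measurable_from_subalg[OF subM X] D_meas by (auto split: nat.split)
      \<comment> \<open>Block \<open>0\<close> is the whole past, block \<open>Suc k\<close> the
        single increment \<open>D k n\<close>. The blocks are disjoint inside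
        \<open>J (Suc n)\<close>, so grouping the independent families by blocks preserves
        independence.\<close>
      define K where "K i = (case i of 0 \<Rightarrow> J n | Suc k \<Rightarrow> {(k, n)})" for i :: nat
      have four: "i < 4 \<longleftrightarrow> i = 0 \<or> (\<exists>k<3. i = Suc k)" for i :: nat by (cases i) auto
      have KJ: "(\<Union>i\<in>{..<4}. K i) \<subseteq> J (Suc n)"
        by (auto simp: K_def J_def four split: nat.splits)
      have "indep_sets (\<lambda>i. sigma_sets (space M) (\<Union>j\<in>K i. F j)) {..<4}"
      proof (rule indep_sets_collect_sigma)
        show "indep_sets F (\<Union>i\<in>{..<4}. K i)" by (rule indep_sets_mono_index[OF KJ ind]) simp
        show "disjoint_family_on K {..<4}"
          by (auto simp: disjoint_family_on_def K_def J_def four split: nat.splits)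
        fix i j
        show "Int_stable (F j)"
        proof -
          obtain k l where j: "j = (k, l)" by (cases j)
          have "sigma_algebra (space M) (sigma_sets (space M) {D k l -` S \<inter> space M |S. S \<in> sets borel})"
            by (rule sigma_algebra_sigma_sets) auto
          then have "Int_stable (sigma_sets (space M) {D k l -` S \<inter> space M |S. S \<in> sets borel})"
            by (intro algebra.Int_stable sigma_algebra.axioms(1))
          moreover have "Int_stable (sets F0)" by (rule sets.Int_stable)
          ultimately show ?thesis unfolding j F_def by simp
        qed
      qed
      then have ind4: "indep_sets (\<lambda>i. case i of 0 \<Rightarrow> S n | Suc k \<Rightarrow> F (k, n)) {..<4}"
      proof (rule indep_sets_mono_sets)
        fix i :: nat assume "i \<in> {..<4}"
        then show "(case i of 0 \<Rightarrow> S n | Suc k \<Rightarrow> F (k, n)) \<subseteq> sigma_sets (space M) (\<Union>j\<in>K i. F j)"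
          by (auto simp: K_def S_def split: nat.split)
      qed
      have X_GG: "sigma_sets (space M) {X -` A \<inter> space M |A. A \<in> sets borel} \<subseteq> GG n"
      proof -
        have "{X -` A \<inter> space M |A. A \<in> sets borel} \<subseteq> sets (G n)"
          using measurable_sets[OF X] by (auto simp: Gs)
        then have "sigma_sets (space (G n)) {X -` A \<inter> space M |A. A \<in> sets borel} \<subseteq> sets (G n)"
          by (rule sets.sigma_sets_subset)
        then show ?thesis by (simp add: Gs)
      qed
      have "indep_sets (\<lambda>i. sigma_sets (space M) {?Y i -` A \<inter> space M |A. A \<in> sets borel}) {..<4}"
      proof (subst indep_sets_finite)
        show "{..<4::nat} \<noteq> {}" "finite {..<4::nat}" by (auto simp: lessThan_empty_iff)
        show "\<And>i. space M \<in> sigma_sets (space M) {?Y i -` A \<inter> space M |A. A \<in> sets borel}"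
          by (rule sigma_sets_top)
        show "\<And>i. i \<in> {..<4} \<Longrightarrow> sigma_sets (space M) {?Y i -` A \<inter> space M |A. A \<in> sets borel} \<subseteq> events"
          using meas by (intro measurable_preimages) simp
        show "\<forall>A\<in>Pi {..<4} (\<lambda>i. sigma_sets (space M) {?Y i -` A \<inter> space M |A. A \<in> sets borel}).
            prob (\<Inter>j\<in>{..<4}. A j) = (\<Prod>j\<in>{..<4}. prob (A j))"
        proof
          fix A assume A: "A \<in> Pi {..<4} (\<lambda>i. sigma_sets (space M) {?Y i -` A \<inter> space M |A. A \<in> sets borel})"
          have "A 0 \<in> sigma_sets (space M) {X -` A \<inter> space M |A. A \<in> sets borel}"
            using PiE[OF A, of 0] by auto
          then have "A 0 \<in> GG n" using X_GG by blast
          then obtain A' where A': "A 0 \<in> events" "A' \<in> S n" "AE \<omega> in M. \<omega> \<in> A 0 \<longleftrightarrow> \<omega> \<in> A'"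
            by (auto simp: GG_def)
          have Ak: "A (Suc k) \<in> F (k, n)" if "k < 3" for k
            using PiE[OF A, of "Suc k"] that by (auto simp: F_def)
          \<comment> \<open>The event of the past is exchanged for an almost surely equal one in
            \<open>S n\<close>, where independence is available; neither the probability of the
            intersection nor that of the factor changes.\<close>
          define A2 where "A2 = A(0 := A')"
          have A2: "\<forall>i\<in>{..<4}. A2 i \<in> (case i of 0 \<Rightarrow> S n | Suc k \<Rightarrow> F (k, n))"
            using A'(2) Ak by (auto simp: A2_def split: nat.split)
          have ev: "A i \<in> events" "A2 i \<in> events" if "i < 4" for i
          proof -
            have "(case i of 0 \<Rightarrow> S n | Suc k \<Rightarrow> F (k, n)) \<subseteq> events"
              using Fev S_ev by (cases i) auto
            then show "A2 i \<in> events" using A2 that by blast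
            then show "A i \<in> events" using A'(1) by (cases i) (auto simp: A2_def)
          qed
          have "prob (\<Inter>j\<in>{..<4}. A j) = prob (\<Inter>j\<in>{..<4}. A2 j)"
          proof (rule finite_measure_eq_AE)
            show "AE \<omega> in M. \<omega> \<in> (\<Inter>j\<in>{..<4}. A j) \<longleftrightarrow> \<omega> \<in> (\<Inter>j\<in>{..<4}. A2 j)"
              using A'(3)
            proof eventually_elim
              fix \<omega> assume "\<omega> \<in> A 0 \<longleftrightarrow> \<omega> \<in> A'"
              then have "\<omega> \<in> A j \<longleftrightarrow> \<omega> \<in> A2 j" for j by (auto simp: A2_def)
              then show "\<omega> \<in> (\<Inter>j\<in>{..<4}. A j) \<longleftrightarrow> \<omega> \<in> (\<Inter>j\<in>{..<4}. A2 j)" by blast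
            qed
          qed (use ev in \<open>auto intro!: sets.finite_INT simp: lessThan_empty_iff\<close>)
          also have "\<dots> = (\<Prod>j\<in>{..<4}. prob (A2 j))"
            by (rule indep_setsD[OF ind4]) (use A2 in \<open>auto simp: lessThan_empty_iff\<close>)
          also have "\<dots> = (\<Prod>j\<in>{..<4}. prob (A j))"
          proof (rule prod.cong)
            fix j :: nat assume "j \<in> {..<4}"
            have "prob (A 0) = prob A'"
              using A'(1) A'(2) S_ev A'(3) by (intro finite_measure_eq_AE) auto
            then show "prob (A2 j) = prob (A j)" by (simp add: A2_def)
          qed simp
          finally show "prob (\<Inter>j\<in>{..<4}. A j) = (\<Prod>j\<in>{..<4}. prob (A j))" .
        qed
      qed
      then show ?thesis unfolding indep_vars_def using meas by auto
    qed
  qed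
  moreover have "subalgebra (G 0) F0"
  proof -
    have "sets F0 = F (3, 0)" by (simp add: F_def)
    also have "\<dots> \<subseteq> S 0" by (rule FS) (simp add: J_def)
    finally show ?thesis using F0 SG[of 0] by (auto simp: subalgebra_def Gs)
  qed
  ultimately show ?thesis unfolding D_def by blast
qed

end

section \<open>Moments\<close>

context prob_space
begin

text \<open>Measurability refers to the \<sigma>-algebra \<open>F\<close>, the integral to
  \<open>M\<close>: adaptedness and moments travel together through all estimates. The elements are
  functions, not classes.\<close>

definition Lp :: "'a measure \<Rightarrow> nat \<Rightarrow> ('a \<Rightarrow> real) set" where
  "Lp F p = {f \<in> borel_measurable F. integrable M (\<lambda>\<omega>. \<bar>f \<omega>\<bar> ^ p)}"

lemma Lp_measurable: "f \<in> Lp F p \<Longrightarrow> f \<in> borel_measurable F"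
  by (simp add: Lp_def)

lemma Lp_integrable_power: "f \<in> Lp F p \<Longrightarrow> integrable M (\<lambda>\<omega>. \<bar>f \<omega>\<bar> ^ p)"
  by (simp add: Lp_def)

lemma Lp_dominated:
  assumes "subalgebra M F" "f \<in> borel_measurable F" "integrable M g"
    and "AE \<omega> in M. \<bar>f \<omega>\<bar> ^ p \<le> g \<omega>"
  shows "f \<in> Lp F p"
proof -
  have "f \<in> borel_measurable M" by (rule measurable_from_subalg[OF assms(1,2)])
  then have "(\<lambda>\<omega>. \<bar>f \<omega>\<bar> ^ p) \<in> borel_measurable M" by measurable
  moreover have "AE \<omega> in M. norm (\<bar>f \<omega>\<bar> ^ p) \<le> norm (g \<omega>)"
    using assms(4) by eventually_elim simp
  ultimately have "integrable M (\<lambda>\<omega>. \<bar>f \<omega>\<bar> ^ p)"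
    using Bochner_Integration.integrable_bound[OF assms(3)] by blast
  then show ?thesis using assms(2) by (simp add: Lp_def)
qed

lemma Lp_integrable:
  assumes "subalgebra M F" "f \<in> Lp F 1"
  shows "integrable M f"
proof -
  have "f \<in> borel_measurable M" using measurable_from_subalg[OF assms(1) Lp_measurable[OF assms(2)]] .
  then show ?thesis using Lp_integrable_power[OF assms(2)] by (simp add: integrable_iff_bounded)
qed

lemma Lp_cong_space:
  assumes "subalgebra M F" "\<And>\<omega>. \<omega> \<in> space M \<Longrightarrow> f \<omega> = g \<omega>" "g \<in> Lp F p"
  shows "f \<in> Lp F p"
proof -
  have "space F = space M" using assms(1) by (simp add: subalgebra_def)
  then have "f \<in> borel_measurable F"
    using Lp_measurable[OF assms(3)] assms(2) measurable_cong[of F f g] by simp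
  then show ?thesis
    using Lp_dominated[OF assms(1) _ Lp_integrable_power[OF assms(3)]] assms(2) by auto
qed

lemma Lp_mono_subalgebra: "subalgebra F' F \<Longrightarrow> f \<in> Lp F p \<Longrightarrow> f \<in> Lp F' p"
  using measurable_from_subalg by (auto simp: Lp_def)

context
  fixes F
  assumes F: "subalgebra M F"
begin

lemma Lp_const: "(\<lambda>_. c) \<in> Lp F p"
  by (simp add: Lp_def)

lemma Lp_scale:
  assumes "f \<in> Lp F p"
  shows "(\<lambda>\<omega>. c * f \<omega>) \<in> Lp F p"
  using assms by (auto simp: Lp_def abs_mult power_mult_distrib)

lemma Lp_add:
  assumes f: "f \<in> Lp F p" and g: "g \<in> Lp F p"
  shows "(\<lambda>\<omega>. f \<omega> + g \<omega>) \<in> Lp F p"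
proof (rule Lp_dominated[OF F])
  show "(\<lambda>\<omega>. f \<omega> + g \<omega>) \<in> borel_measurable F"
    using Lp_measurable[OF f] Lp_measurable[OF g] by simp
  show "integrable M (\<lambda>\<omega>. 2 ^ p * (\<bar>f \<omega>\<bar> ^ p + \<bar>g \<omega>\<bar> ^ p))"
    using Lp_integrable_power[OF f] Lp_integrable_power[OF g] by simp
  have "\<bar>x + y\<bar> ^ p \<le> 2 ^ p * (\<bar>x\<bar> ^ p + \<bar>y\<bar> ^ p)" for x y :: real
  proof -
    have "\<bar>x + y\<bar> ^ p \<le> (2 * max \<bar>x\<bar> \<bar>y\<bar>) ^ p" by (rule power_mono) auto
    also have "\<dots> = 2 ^ p * (max \<bar>x\<bar> \<bar>y\<bar>) ^ p" by (rule power_mult_distrib)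
    also have "\<dots> \<le> 2 ^ p * (\<bar>x\<bar> ^ p + \<bar>y\<bar> ^ p)" by (auto simp: max_def)
    finally show ?thesis .
  qed
  then show "AE \<omega> in M. \<bar>f \<omega> + g \<omega>\<bar> ^ p \<le> 2 ^ p * (\<bar>f \<omega>\<bar> ^ p + \<bar>g \<omega>\<bar> ^ p)" by simp
qed

lemma Lp_diff: "f \<in> Lp F p \<Longrightarrow> g \<in> Lp F p \<Longrightarrow> (\<lambda>\<omega>. f \<omega> - g \<omega>) \<in> Lp F p"
  using Lp_add[OF _ Lp_scale[of g p "-1"]] by simp

lemma Lp_sum:
  assumes "finite I" "\<And>i. i \<in> I \<Longrightarrow> f i \<in> Lp F p"
  shows "(\<lambda>\<omega>. \<Sum>i\<in>I. f i \<omega>) \<in> Lp F p"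
  using assms by (induction I rule: finite_induct) (auto intro: Lp_const Lp_add)

text \<open>The elementary bound \<open>|x * y|^p <= |x|^(2*p) + |y|^(2*p)\<close> takes the place
  of Hoelder's inequality. A product halves the exponent, so quadratic expressions in
  \<open>P\<close> and \<open>Q\<close> keep two of their four moments.\<close>

lemma Lp_mult:
  assumes f: "f \<in> Lp F (2 * p)" and g: "g \<in> Lp F (2 * p)"
  shows "(\<lambda>\<omega>. f \<omega> * g \<omega>) \<in> Lp F p"
proof (rule Lp_dominated[OF F])
  show "(\<lambda>\<omega>. f \<omega> * g \<omega>) \<in> borel_measurable F"
    using Lp_measurable[OF f] Lp_measurable[OF g] by simp
  show "integrable M (\<lambda>\<omega>. \<bar>f \<omega>\<bar> ^ (2 * p) + \<bar>g \<omega>\<bar> ^ (2 * p))"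
    using Lp_integrable_power[OF f] Lp_integrable_power[OF g] by simp
  have "\<bar>x * y\<bar> ^ p \<le> \<bar>x\<bar> ^ (2 * p) + \<bar>y\<bar> ^ (2 * p)" for x y :: real
  proof -
    have "0 \<le> \<bar>x\<bar> ^ p * \<bar>y\<bar> ^ p" by simp
    moreover have "2 * (\<bar>x\<bar> ^ p) * (\<bar>y\<bar> ^ p) \<le> (\<bar>x\<bar> ^ p)\<^sup>2 + (\<bar>y\<bar> ^ p)\<^sup>2"
      by (rule sum_squares_bound)
    ultimately have "\<bar>x\<bar> ^ p * \<bar>y\<bar> ^ p \<le> (\<bar>x\<bar> ^ p)\<^sup>2 + (\<bar>y\<bar> ^ p)\<^sup>2" by linarith
    then show ?thesis by (simp add: abs_mult power_mult_distrib power_mult[symmetric] mult.commute)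
  qed
  then show "AE \<omega> in M. \<bar>f \<omega> * g \<omega>\<bar> ^ p \<le> \<bar>f \<omega>\<bar> ^ (2 * p) + \<bar>g \<omega>\<bar> ^ (2 * p)" by simp
qed

lemma Lp_mono_exponent:
  assumes f: "f \<in> Lp F q" and "p \<le> q"
  shows "f \<in> Lp F p"
proof (rule Lp_dominated[OF F])
  show "f \<in> borel_measurable F" by (rule Lp_measurable[OF f])
  show "integrable M (\<lambda>\<omega>. 1 + \<bar>f \<omega>\<bar> ^ q)"
    using Lp_integrable_power[OF f] by simp
  have "\<bar>x\<bar> ^ p \<le> 1 + \<bar>x\<bar> ^ q" for x :: real
  proof (cases "\<bar>x\<bar> \<le> 1")
    case True
    then have "\<bar>x\<bar> ^ p \<le> 1" by (intro power_le_one) auto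
    then show ?thesis using zero_le_power[of "\<bar>x\<bar>" q] by linarith
  next
    case False
    then have "\<bar>x\<bar> ^ p \<le> \<bar>x\<bar> ^ q" using assms(2) by (intro power_increasing) auto
    then show ?thesis by linarith
  qed
  then show "AE \<omega> in M. \<bar>f \<omega>\<bar> ^ p \<le> 1 + \<bar>f \<omega>\<bar> ^ q" by simp
qed

end

end

section \<open>Gaussian moments of the increments and factorisation by independence\<close>

context noise
begin

definition "mom r = (\<integral>x. normal_density 0 (sqrt dt) x * x ^ r \<partial>lborel)"

lemma normal_power_integrable: "integrable lborel (\<lambda>x. normal_density 0 (sqrt dt) x * x ^ r)"
proof (cases "even r")
  case True
  then show ?thesis
    using normal_moment_even[of "sqrt dt" 0 "r div 2"] dt_pos
    by (auto simp: has_bochner_integral_iff)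
next
  case False
  then have "r = 2 * (r div 2) + 1" by presburger
  then show ?thesis
    using normal_moment_odd[of "sqrt dt" 0 "r div 2"] dt_pos
    by (simp add: has_bochner_integral_iff)
qed

text \<open>Order three is the highest that occurs, from a squared increment multiplied by the
  affine expression for the new \<open>U\<close>.\<close>

lemma mom_values: "mom 0 = 1" "mom (Suc 0) = 0" "mom 2 = dt" "mom 3 = 0"
proof -
  have even: "mom (2 * k) = fact (2 * k) / ((2 / dt) ^ k * fact k)" for k
    using has_bochner_integral_integral_eq[OF normal_moment_even[of "sqrt dt" 0 k]] dt_pos
    by (simp add: mom_def)
  have odd: "mom (2 * k + 1) = 0" for k
    using has_bochner_integral_integral_eq[OF normal_moment_odd[of "sqrt dt" 0 k]] dt_pos
    by (simp add: mom_def)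
  show "mom 0 = 1" using even[of 0] by simp
  show "mom (Suc 0) = 0" using odd[of 0] by simp
  show "mom 2 = dt" using even[of 1] by (simp add: fact_numeral)
  show "mom 3 = 0" using odd[of 1] by (simp add: numeral_3_eq_3)
qed

lemma D_power:
  assumes "k < 3"
  shows "integrable M (\<lambda>\<omega>. D k n \<omega> ^ r)" "expectation (\<lambda>\<omega>. D k n \<omega> ^ r) = mom r"
  using distributed_integrable[OF D_normal[OF assms], of "\<lambda>x. x ^ r" n]
    distributed_integral[OF D_normal[OF assms], of "\<lambda>x. x ^ r" n]
    normal_power_integrable[of r]
  by (auto simp: mom_def normal_density_nonneg)

text \<open>All expectations below reduce to this factorisation of a variable from the past and
  three independent increments. \<open>has_bochner_integral\<close> delivers integrability together
  with the value.\<close>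

lemma D_monomial:
  assumes X: "X \<in> borel_measurable (G n)" "integrable M X"
  shows "has_bochner_integral M (\<lambda>\<omega>. X \<omega> * (D 0 n \<omega> ^ i * D 1 n \<omega> ^ j * D 2 n \<omega> ^ k))
    (expectation X * (mom i * mom j * mom k))"
proof -
  define f :: "nat \<Rightarrow> real \<Rightarrow> real" where
    "f l = (if l = 0 then (\<lambda>x. x) else if l = 1 then (\<lambda>x. x ^ i) else if l = 2 then (\<lambda>x. x ^ j) else (\<lambda>x. x ^ k))" for l
  define Y where "Y l = (\<lambda>\<omega>. f l ((case l of 0 \<Rightarrow> X | Suc k \<Rightarrow> D k n) \<omega>))" for l
  have Y: "Y 0 = X" "Y 1 = (\<lambda>\<omega>. D 0 n \<omega> ^ i)" "Y 2 = (\<lambda>\<omega>. D 1 n \<omega> ^ j)" "Y 3 = (\<lambda>\<omega>. D 2 n \<omega> ^ k)"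
    by (auto simp: Y_def f_def numeral_2_eq_2 numeral_3_eq_3)
  have four: "{..<4} = {0, 1, 2, 3::nat}" by auto
  have ind: "indep_vars (\<lambda>_. borel) Y {..<4}"
    unfolding Y_def by (rule indep_vars_compose2[OF D_indep[OF X(1)]]) (auto simp: f_def)
  have int: "integrable M (Y l)" if "l \<in> {..<4}" for l
    using that X(2) D_power(1)[of 0] D_power(1)[of 1] D_power(1)[of 2] unfolding four by (auto simp: Y Y(2)[simplified])
  have prod: "(\<Prod>l<4. Y l \<omega>) = X \<omega> * (D 0 n \<omega> ^ i * D 1 n \<omega> ^ j * D 2 n \<omega> ^ k)" for \<omega>
    unfolding four by (simp add: Y Y(2)[simplified])
  have "(\<Prod>l<4. expectation (Y l)) = expectation X * (mom i * mom j * mom k)"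
    unfolding four by (simp add: Y Y(2)[simplified] D_power(2) D_power(2)[of 1, simplified])
  then show ?thesis
    using indep_vars_lebesgue_integral[OF _ ind int] indep_vars_integrable[OF _ ind int]
    by (simp add: prod has_bochner_integral_iff)
qed

text \<open>By independence a factor from the new increments costs no exponent, in contrast to
  \<open>Lp_mult\<close>; the integral of the power splits into two finite factors. This is why
  repeated steps do not exhaust the moments.\<close>

lemma Lp_D:
  assumes f: "f \<in> Lp (G n) p" and k: "k < 3"
  shows "(\<lambda>\<omega>. f \<omega> * D k n \<omega> ^ r) \<in> Lp (G (Suc n)) p"
proof (rule Lp_dominated[OF G_sub])
  show "(\<lambda>\<omega>. f \<omega> * D k n \<omega> ^ r) \<in> borel_measurable (G (Suc n))"
    using measurable_from_subalg[OF G_mono Lp_measurable[OF f]] D_measurable[OF k] by simp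
  have "(\<lambda>\<omega>. \<bar>f \<omega>\<bar> ^ p) \<in> borel_measurable (G n)" using Lp_measurable[OF f] by measurable
  then have int: "integrable M (\<lambda>\<omega>. \<bar>f \<omega>\<bar> ^ p * (D 0 n \<omega> ^ i * D 1 n \<omega> ^ j * D 2 n \<omega> ^ l))" for i j l
    using D_monomial[OF _ Lp_integrable_power[OF f]] by (blast intro: has_bochner_integral_integrable integrable.intros)
  have "integrable M (\<lambda>\<omega>. \<bar>f \<omega>\<bar> ^ p * D k n \<omega> ^ (p * r))"
  proof -
    consider "k = 0" | "k = 1" | "k = 2" using k by linarith
    then show ?thesis
      using int[of "p * r" 0 0] int[of 0 "p * r" 0] int[of 0 0 "p * r"] by cases auto
  qed
  then show "integrable M (\<lambda>\<omega>. \<bar>\<bar>f \<omega>\<bar> ^ p * D k n \<omega> ^ (p * r)\<bar>)" by (rule integrable_abs)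
  show "AE \<omega> in M. \<bar>f \<omega> * D k n \<omega> ^ r\<bar> ^ p \<le> \<bar>\<bar>f \<omega>\<bar> ^ p * D k n \<omega> ^ (p * r)\<bar>"
    by (simp add: abs_mult power_mult_distrib power_abs power_mult[symmetric] mult.commute)
qed

lemmas Lp_D1 = Lp_D[where r = 1, simplified]

lemma D_first:
  assumes "f \<in> Lp (G n) 1" "k < 3"
  shows "has_bochner_integral M (\<lambda>\<omega>. f \<omega> * D k n \<omega>) 0"
proof -
  note f = Lp_measurable[OF assms(1)] Lp_integrable[OF G_sub assms(1)]
  consider "k = 0" | "k = 1" | "k = 2" using assms(2) by linarith
  then show ?thesis
    using D_monomial[OF f, of 1 0 0] D_monomial[OF f, of 0 1 0] D_monomial[OF f, of 0 0 1]
    by cases (auto simp: mom_values)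
qed

lemma D_second:
  assumes "f \<in> Lp (G n) 1" "k < 3"
  shows "has_bochner_integral M (\<lambda>\<omega>. f \<omega> * (D k n \<omega>)\<^sup>2) (expectation f * dt)"
proof -
  note f = Lp_measurable[OF assms(1)] Lp_integrable[OF G_sub assms(1)]
  consider "k = 0" | "k = 1" | "k = 2" using assms(2) by linarith
  then show ?thesis
    using D_monomial[OF f, of 2 0 0] D_monomial[OF f, of 0 2 0] D_monomial[OF f, of 0 0 2]
    by cases (auto simp: mom_values)
qed

text \<open>Against \<open>\<alpha>\<close> the constant \<open>2 * dt\<close> cancels the two
  variances. Against the remaining terms every monomial contains some increment to an odd
  power.\<close>

lemma D_centered_squares:
  assumes "\<alpha> \<in> Lp (G n) 1" "\<beta> \<in> Lp (G n) 1" "\<gamma> \<in> Lp (G n) 1" "\<delta> \<in> Lp (G n) 1"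
  shows "has_bochner_integral M (\<lambda>\<omega>. ((D 0 n \<omega>)\<^sup>2 + (D 1 n \<omega>)\<^sup>2 - 2 * dt) *
    (\<alpha> \<omega> + \<beta> \<omega> * D 0 n \<omega> + \<gamma> \<omega> * D 1 n \<omega> + \<delta> \<omega> * D 2 n \<omega>)) 0"
proof -
  have *: "has_bochner_integral M (\<lambda>\<omega>. f \<omega> * (D 0 n \<omega> ^ (2 + i) * D 1 n \<omega> ^ j * D 2 n \<omega> ^ k)
      + f \<omega> * (D 0 n \<omega> ^ i * D 1 n \<omega> ^ (2 + j) * D 2 n \<omega> ^ k)
      - 2 * dt * (f \<omega> * (D 0 n \<omega> ^ i * D 1 n \<omega> ^ j * D 2 n \<omega> ^ k)))
    (expectation f * (mom (2 + i) * mom j * mom k) + expectation f * (mom i * mom (2 + j) * mom k)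
      - 2 * dt * (expectation f * (mom i * mom j * mom k)))"
    if "f \<in> Lp (G n) 1" for f i j k
    by (intro has_bochner_integral_add has_bochner_integral_diff has_bochner_integral_mult_right
      D_monomial Lp_measurable[OF that] Lp_integrable[OF G_sub that])
  have "has_bochner_integral M (\<lambda>\<omega>.
      (\<alpha> \<omega> * (D 0 n \<omega> ^ (2 + 0) * D 1 n \<omega> ^ 0 * D 2 n \<omega> ^ 0)
      + \<alpha> \<omega> * (D 0 n \<omega> ^ 0 * D 1 n \<omega> ^ (2 + 0) * D 2 n \<omega> ^ 0)
      - 2 * dt * (\<alpha> \<omega> * (D 0 n \<omega> ^ 0 * D 1 n \<omega> ^ 0 * D 2 n \<omega> ^ 0))) +
      (\<beta> \<omega> * (D 0 n \<omega> ^ (2 + 1) * D 1 n \<omega> ^ 0 * D 2 n \<omega> ^ 0)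
      + \<beta> \<omega> * (D 0 n \<omega> ^ 1 * D 1 n \<omega> ^ (2 + 0) * D 2 n \<omega> ^ 0)
      - 2 * dt * (\<beta> \<omega> * (D 0 n \<omega> ^ 1 * D 1 n \<omega> ^ 0 * D 2 n \<omega> ^ 0))) +
      (\<gamma> \<omega> * (D 0 n \<omega> ^ (2 + 0) * D 1 n \<omega> ^ 1 * D 2 n \<omega> ^ 0)
      + \<gamma> \<omega> * (D 0 n \<omega> ^ 0 * D 1 n \<omega> ^ (2 + 1) * D 2 n \<omega> ^ 0)
      - 2 * dt * (\<gamma> \<omega> * (D 0 n \<omega> ^ 0 * D 1 n \<omega> ^ 1 * D 2 n \<omega> ^ 0))) +
      (\<delta> \<omega> * (D 0 n \<omega> ^ (2 + 0) * D 1 n \<omega> ^ 0 * D 2 n \<omega> ^ 1)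
      + \<delta> \<omega> * (D 0 n \<omega> ^ 0 * D 1 n \<omega> ^ (2 + 0) * D 2 n \<omega> ^ 1)
      - 2 * dt * (\<delta> \<omega> * (D 0 n \<omega> ^ 0 * D 1 n \<omega> ^ 0 * D 2 n \<omega> ^ 1)))) (0 + 0 + 0 + 0)"
    using *[OF assms(1), of 0 0 0] *[OF assms(2), of 1 0 0] *[OF assms(3), of 0 1 0] *[OF assms(4), of 0 0 1]
    by (intro has_bochner_integral_add) (simp_all add: mom_values numeral_3_eq_3[symmetric])
  then show ?thesis
    by (rule has_bochner_integral_cong[THEN iffD1, rotated -1])
      (simp_all add: algebra_simps power2_eq_square power3_eq_cube numeral_3_eq_3[symmetric])
qed

end

section \<open>Measurable solutions of linear systems\<close>

text \<open>Written as an explicit quotient so that the solution of a random system depends visibly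
  measurably on its data, without an inverse matrix or a choice of solutions.\<close>

definition cramer :: "nat \<Rightarrow> (nat \<Rightarrow> nat \<Rightarrow> real) \<Rightarrow> (nat \<Rightarrow> real) \<Rightarrow> nat \<Rightarrow> real" where
  "cramer n A y k =
    Determinant.det (mat n n (\<lambda>(i, j). if j = k then y i else A i j)) / Determinant.det (mat n n (\<lambda>(i, j). A i j))"

text \<open>Nonsingularity is phrased as injectivity, the form in which a positivity argument
  provides it.\<close>

lemma cramer_unique:
  assumes sol: "\<And>i. i < n \<Longrightarrow> (\<Sum>j<n. A i j * x j) = y i"
    and inj: "\<And>z. (\<And>i. i < n \<Longrightarrow> (\<Sum>j<n. A i j * z j) = 0) \<Longrightarrow> (\<And>i. i < n \<Longrightarrow> z i = 0)"
    and k: "k < n"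
  shows "x k = cramer n A y k"
proof -
  let ?A = "mat n n (\<lambda>(i, j). A i j)"
  have mult: "(?A *\<^sub>v v) $ i = (\<Sum>j<n. A i j * v $ j)" if "v \<in> carrier_vec n" "i < n" for v i
    using that by (simp add: mult_mat_vec_def scalar_prod_def atLeast0LessThan)
  have "Determinant.det ?A \<noteq> 0"
  proof
    assume "Determinant.det ?A = 0"
    then obtain v where v: "v \<in> carrier_vec n" "v \<noteq> 0\<^sub>v n" "?A *\<^sub>v v = 0\<^sub>v n"
      using det_0_iff_vec_prod_zero[of ?A n] by auto
    have "(\<Sum>j<n. A i j * v $ j) = 0" if "i < n" for i using mult[OF v(1) that] v(3) that by simp
    then have "v $ i = 0" if "i < n" for i using inj[of "\<lambda>j. v $ j"] that by blast
    then have "v = 0\<^sub>v n" using v(1) by (intro eq_vecI) auto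
    then show False using v(2) by simp
  qed
  moreover have "replace_col ?A (?A *\<^sub>v vec n x) k = mat n n (\<lambda>(i, j). if j = k then y i else A i j)"
    unfolding replace_col_def using k sol by (intro eq_matI) (auto simp: mult simp del: index_mult_mat_vec)
  moreover have "Determinant.det (replace_col ?A (?A *\<^sub>v vec n x) k) = x k * Determinant.det ?A"
    using cramer_lemma_mat[of ?A n "vec n x" k] k by simp
  ultimately show ?thesis by (simp add: cramer_def)
qed

text \<open>By the Leibniz formula a determinant is a polynomial in its entries. Real division is
  measurable including at denominator zero, so no case distinction arises.\<close>

lemma cramer_measurable:
  assumes "\<And>i j. i < n \<Longrightarrow> j < n \<Longrightarrow> (\<lambda>\<omega>. A \<omega> i j) \<in> borel_measurable F"
    and "\<And>i. i < n \<Longrightarrow> (\<lambda>\<omega>. y \<omega> i) \<in> borel_measurable F"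
  shows "(\<lambda>\<omega>. cramer n (A \<omega>) (y \<omega>) k) \<in> borel_measurable F"
proof -
  have det: "(\<lambda>\<omega>. Determinant.det (mat n n (\<lambda>(i, j). B \<omega> i j))) \<in> borel_measurable F"
    if B: "\<And>i j. i < n \<Longrightarrow> j < n \<Longrightarrow> (\<lambda>\<omega>. B \<omega> i j) \<in> borel_measurable F" for B :: "'a \<Rightarrow> nat \<Rightarrow> nat \<Rightarrow> real"
  proof -
    have "Determinant.det (mat n n (\<lambda>(i, j). B \<omega> i j)) =
        (\<Sum>p\<in>{p. p permutes {0..<n}}. signof p * (\<Prod>i=0..<n. B \<omega> i (p i)))" for \<omega>
    proof -
      have "Determinant.det (mat n n (\<lambda>(i, j). B \<omega> i j)) =
        (\<Sum>p\<in>{p. p permutes {0..<n}}. signof p * (\<Prod>i=0..<n. mat n n (\<lambda>(i, j). B \<omega> i j) $$ (i, p i)))"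
        by (rule det_def') simp
      also have "\<dots> = (\<Sum>p\<in>{p. p permutes {0..<n}}. signof p * (\<Prod>i=0..<n. B \<omega> i (p i)))"
        by (intro sum.cong refl arg_cong2[where f = "(*)"] prod.cong) (auto dest: permutes_in_image)
      finally show ?thesis .
    qed
    moreover have "(\<lambda>\<omega>. \<Sum>p\<in>{p. p permutes {0..<n}}. signof p * (\<Prod>i=0..<n. B \<omega> i (p i))) \<in> borel_measurable F"
      using B by (intro borel_measurable_sum borel_measurable_times borel_measurable_prod borel_measurable_const)
        (metis atLeast0LessThan lessThan_iff mem_Collect_eq permutes_in_image)
    ultimately show ?thesis by simp
  qed
  show ?thesis
    unfolding cramer_def using assms by (intro borel_measurable_divide det) (auto split: if_split)
qed

text \<open>Eliminating \<open>q\<close> from the Crank--Nicolson system with symmetric \<open>L\<close> leaves a system with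
  matrix \<open>1 + s\<^sup>2 L\<^sup>2\<close> for \<open>p\<close>.\<close>

definition crank_nicolson_matrix :: "nat \<Rightarrow> real \<Rightarrow> (nat \<Rightarrow> nat \<Rightarrow> real) \<Rightarrow> nat \<Rightarrow> nat \<Rightarrow> real" where
  "crank_nicolson_matrix d s L i k = (if i = k then 1 else 0) + s\<^sup>2 * (\<Sum>j<d. L i j * L j k)"

lemma crank_nicolson_matrix_mult:
  assumes "i < d"
  shows "(\<Sum>k<d. crank_nicolson_matrix d s L i k * z k) = z i + s\<^sup>2 * (\<Sum>j<d. L i j * (\<Sum>k<d. L j k * z k))"
proof -
  have "(\<Sum>k<d. crank_nicolson_matrix d s L i k * z k)
      = (\<Sum>k<d. (if i = k then z k else 0) + s\<^sup>2 * (\<Sum>j<d. L i j * L j k * z k))"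
    by (rule sum.cong) (auto simp: crank_nicolson_matrix_def algebra_simps sum_distrib_left sum_distrib_right)
  also have "\<dots> = z i + s\<^sup>2 * (\<Sum>k<d. \<Sum>j<d. L i j * L j k * z k)"
    using assms by (simp add: sum.distrib sum_distrib_left)
  also have "(\<Sum>k<d. \<Sum>j<d. L i j * L j k * z k) = (\<Sum>j<d. \<Sum>k<d. L i j * L j k * z k)"
    by (rule sum.swap)
  also have "\<dots> = (\<Sum>j<d. L i j * (\<Sum>k<d. L j k * z k))" by (simp add: sum_distrib_left mult.assoc)
  finally show ?thesis .
qed

text \<open>Pairing with \<open>z\<close> and using symmetry of \<open>L\<close> gives
  \<open>|z|^2 + s^2 * |L z|^2 = 0\<close>. Thus the system is uniquely solvable for every
  realisation of the potential and every step size.\<close>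

lemma crank_nicolson_matrix_injective:
  assumes sym: "\<And>i j. L i j = L j i"
    and z: "\<And>i. i < d \<Longrightarrow> (\<Sum>k<d. crank_nicolson_matrix d s L i k * z k) = 0" and i: "i < d"
  shows "z i = 0"
proof -
  have "0 = (\<Sum>i<d. z i * (\<Sum>k<d. crank_nicolson_matrix d s L i k * z k))" using z by simp
  also have "\<dots> = (\<Sum>i<d. (z i)\<^sup>2 + s\<^sup>2 * (\<Sum>j<d. z i * L i j * (\<Sum>k<d. L j k * z k)))"
  proof (rule sum.cong)
    fix i assume "i \<in> {..<d}"
    then have "z i * (\<Sum>k<d. crank_nicolson_matrix d s L i k * z k)
        = z i * z i + s\<^sup>2 * (z i * (\<Sum>j<d. L i j * (\<Sum>k<d. L j k * z k)))"
      by (simp add: crank_nicolson_matrix_mult distrib_left)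
    then show "z i * (\<Sum>k<d. crank_nicolson_matrix d s L i k * z k)
        = (z i)\<^sup>2 + s\<^sup>2 * (\<Sum>j<d. z i * L i j * (\<Sum>k<d. L j k * z k))"
      unfolding sum_distrib_left[of "z i"] by (simp add: power2_eq_square mult.assoc)
  qed simp
  also have "\<dots> = (\<Sum>i<d. (z i)\<^sup>2) + s\<^sup>2 * (\<Sum>i<d. \<Sum>j<d. z i * L i j * (\<Sum>k<d. L j k * z k))"
    by (simp add: sum.distrib sum_distrib_left)
  also have "(\<Sum>i<d. \<Sum>j<d. z i * L i j * (\<Sum>k<d. L j k * z k))
      = (\<Sum>j<d. \<Sum>i<d. z i * L i j * (\<Sum>k<d. L j k * z k))" by (rule sum.swap)
  also have "\<dots> = (\<Sum>j<d. (\<Sum>k<d. L j k * z k)\<^sup>2)"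
    by (rule sum.cong) (auto simp: power2_eq_square sum_distrib_right sym mult.commute)
  finally have "(\<Sum>i<d. (z i)\<^sup>2) + s\<^sup>2 * (\<Sum>j<d. (\<Sum>k<d. L j k * z k)\<^sup>2) = 0" by simp
  moreover have "0 \<le> s\<^sup>2 * (\<Sum>j<d. (\<Sum>k<d. L j k * z k)\<^sup>2)" by (simp add: sum_nonneg)
  moreover have "0 \<le> (\<Sum>i<d. (z i)\<^sup>2)" by (simp add: sum_nonneg)
  ultimately have "(\<Sum>i<d. (z i)\<^sup>2) = 0" by linarith
  then show ?thesis using i by (simp add: sum_nonneg_eq_0_iff)
qed

lemma crank_nicolson_solution:
  fixes p q pt qt :: "nat \<Rightarrow> real"
  assumes sym: "\<And>i j. L i j = L j i"
    and p: "\<And>i. i < d \<Longrightarrow> p i = pt i - s * (\<Sum>j<d. L i j * (q j + qt j))"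
    and q: "\<And>i. i < d \<Longrightarrow> q i = qt i + s * (\<Sum>j<d. L i j * (p j + pt j))"
    and k: "k < d"
  shows "p k = cramer d (crank_nicolson_matrix d s L)
    (\<lambda>i. pt i - s * (\<Sum>j<d. L i j * (2 * qt j)) - s\<^sup>2 * (\<Sum>j<d. L i j * (\<Sum>k<d. L j k * pt k))) k"
proof (rule cramer_unique[OF _ _ k])
  fix i assume i: "i < d"
  have "p i = pt i - s * (\<Sum>j<d. L i j * (2 * qt j) + s * (L i j * (\<Sum>k<d. L j k * p k)) + s * (L i j * (\<Sum>k<d. L j k * pt k)))"
    unfolding p[OF i]
  proof (intro arg_cong2[where f = "(-)"] arg_cong2[where f = "(*)"] sum.cong refl)
    fix j assume "j \<in> {..<d}"
    then have "q j = qt j + s * ((\<Sum>k<d. L j k * p k) + (\<Sum>k<d. L j k * pt k))"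
      using q[of j] by (simp add: distrib_left sum.distrib)
    then show "L i j * (q j + qt j) =
        L i j * (2 * qt j) + s * (L i j * (\<Sum>k<d. L j k * p k)) + s * (L i j * (\<Sum>k<d. L j k * pt k))"
      by (simp add: algebra_simps)
  qed
  then show "(\<Sum>j<d. crank_nicolson_matrix d s L i j * p j) =
      pt i - s * (\<Sum>j<d. L i j * (2 * qt j)) - s\<^sup>2 * (\<Sum>j<d. L i j * (\<Sum>k<d. L j k * pt k))"
    unfolding crank_nicolson_matrix_mult[OF i]
    by (simp add: sum.distrib sum_distrib_left[symmetric] algebra_simps power2_eq_square)
qed (rule crank_nicolson_matrix_injective[OF sym])

section \<open>The scheme driven by the noise\<close>

text \<open>The basis \<open>e\<close> and the weights \<open>\<kappa>\<close> are parameters: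
  \<open>coordinate\<close> expresses coefficients by finitely many point evaluations, the route by
  which the measurability in \<open>Vh_random_variable\<close> reaches them. Steps are counted from
  \<open>0\<close>: \<open>D k n\<close> leads from \<open>n\<close> to
  \<open>Suc n\<close>.\<close>

locale fem_scheme = fem a b m + noise M D G dt
  for a b :: real and m :: nat and M :: "'w measure" and D G dt +
  fixes C1 C2 :: real and \<eta>1 \<eta>2 :: "real \<Rightarrow> real" and P Q U V :: "nat \<Rightarrow> 'w \<Rightarrow> real \<Rightarrow> real"
    and N d :: nat and e :: "nat \<Rightarrow> real \<Rightarrow> real" and S :: "real set" and \<kappa> :: "nat \<Rightarrow> real \<Rightarrow> real"
  assumes \<eta>1: "\<eta>1 \<in> L2_space a b" and \<eta>2: "\<eta>2 \<in> L2_space a b"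
    and e_Vh: "i < d \<Longrightarrow> e i \<in> Vh a b m"
    and expansion: "v \<in> Vh a b m \<Longrightarrow> v = (\<lambda>x. \<Sum>i<d. L2_inner a b v (e i) * e i x)"
    and coordinate: "i < d \<Longrightarrow> v \<in> Vh a b m \<Longrightarrow> L2_inner a b v (e i) = (\<Sum>x\<in>S. \<kappa> i x * v x)"
    and iterates: "X \<in> {P, Q, U, V} \<Longrightarrow> n \<le> N \<Longrightarrow> Vh_random_variable a b m M (X n)"
    and initial: "X \<in> {P, Q, U, V} \<Longrightarrow> Vh_random_variable a b m (G 0) (X 0)"
    and initial4: "X \<in> {P, Q} \<Longrightarrow> integrable M (\<lambda>\<omega>. (L2_inner a b (X 0 \<omega>) (X 0 \<omega>))\<^sup>2)"
    and initial2: "X \<in> {U, V} \<Longrightarrow> integrable M (\<lambda>\<omega>. L2_inner a b (X 0 \<omega>) (X 0 \<omega>))"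
    and scheme: "n < N \<Longrightarrow> AE \<omega> in M. fe_step a b m C1 C2 \<eta>1 \<eta>2 dt (D 0 n \<omega>) (D 1 n \<omega>) (D 2 n \<omega>)
      (P n \<omega>) (Q n \<omega>) (U n \<omega>) (V n \<omega>) (P (Suc n) \<omega>) (Q (Suc n) \<omega>) (U (Suc n) \<omega>) (V (Suc n) \<omega>)"
begin

abbreviation "p1 \<equiv> Ph a b m \<eta>1"
abbreviation "p2 \<equiv> Ph a b m \<eta>2"

lemma p_Vh: "p1 \<in> V\<^sub>h" "p2 \<in> V\<^sub>h"
  using Ph_L2 \<eta>1 \<eta>2 by auto

lemma linear_expansion:
  assumes "linear_on_fun V\<^sub>h l" "v \<in> V\<^sub>h"
  shows "l v = (\<Sum>i<d. ip v (e i) * l (e i))"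
proof -
  have "l v = l (\<lambda>x. \<Sum>i<d. ip v (e i) * e i x)" using expansion[OF assms(2)] by simp
  also have "\<dots> = (\<Sum>i<d. ip v (e i) * l (e i))"
    by (rule linear_on_fun_sum[OF Vh_subspace assms(1)]) (use e_Vh in auto)
  finally show ?thesis .
qed

lemma ip_self: "v \<in> V\<^sub>h \<Longrightarrow> ip v v = (\<Sum>i<d. (ip v (e i))\<^sup>2)"
  using linear_expansion[OF ip_linear[OF Vh_cont], of v v] by (simp add: power2_eq_square)

lemma coordinate_le:
  assumes "v \<in> V\<^sub>h" "i < d"
  shows "(ip v (e i))\<^sup>2 \<le> ip v v"
  unfolding ip_self[OF assms(1)] using assms(2)
  by (intro member_le_sum[of i "{..<d}" "\<lambda>i. (ip v (e i))\<^sup>2"]) auto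

lemma linear_forms:
  shows "u \<in> V\<^sub>h \<Longrightarrow> linear_on_fun V\<^sub>h (ip u)" "u \<in> V\<^sub>h \<Longrightarrow> linear_on_fun V\<^sub>h (\<lambda>w. ip w u)"
    "u \<in> V\<^sub>h \<Longrightarrow> linear_on_fun V\<^sub>h (stiff u)" "u \<in> V\<^sub>h \<Longrightarrow> linear_on_fun V\<^sub>h (\<lambda>w. stiff w u)"
    "u \<in> V\<^sub>h \<Longrightarrow> linear_on_fun V\<^sub>h (\<lambda>w. wave_form s w u)"
    "\<lbrakk>u \<in> V\<^sub>h; v \<in> V\<^sub>h\<rbrakk> \<Longrightarrow> linear_on_fun V\<^sub>h (tri u v)"
    "\<lbrakk>u \<in> V\<^sub>h; v \<in> V\<^sub>h\<rbrakk> \<Longrightarrow> linear_on_fun V\<^sub>h (\<lambda>w. tri u w v)"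
    "\<lbrakk>u \<in> V\<^sub>h; v \<in> V\<^sub>h\<rbrakk> \<Longrightarrow> linear_on_fun V\<^sub>h (\<lambda>w. tri w u v)"
  using Vh_cont inner_on_funD(4)[OF wave_form_inner]
  by (auto simp: linear_on_fun_def form_expand)

subsection \<open>Random finite element functions with moments\<close>

text \<open>Moments are imposed on the coordinates in the orthonormal basis. Linear functionals then
  inherit them as finite sums, and multilinear forms become polynomials in the coordinates.\<close>

definition "RLp F p X \<longleftrightarrow> (\<forall>\<omega>\<in>space M. X \<omega> \<in> V\<^sub>h) \<and> (\<forall>i<d. (\<lambda>\<omega>. ip (X \<omega>) (e i)) \<in> Lp F p)"

lemma RLpD: "RLp F p X \<Longrightarrow> \<omega> \<in> space M \<Longrightarrow> X \<omega> \<in> V\<^sub>h"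
  "RLp F p X \<Longrightarrow> i < d \<Longrightarrow> (\<lambda>\<omega>. ip (X \<omega>) (e i)) \<in> Lp F p"
  by (auto simp: RLp_def)

context
  fixes F
  assumes F: "subalgebra M F"
begin

lemma RLp_mono_exponent: "RLp F q X \<Longrightarrow> p \<le> q \<Longrightarrow> RLp F p X"
  using Lp_mono_exponent[OF F] unfolding RLp_def by blast

lemma RLp_linear:
  assumes X: "RLp F p X" and l: "linear_on_fun V\<^sub>h l"
  shows "(\<lambda>\<omega>. l (X \<omega>)) \<in> Lp F p"
proof (rule Lp_cong_space[OF F])
  show "(\<lambda>\<omega>. \<Sum>i<d. l (e i) * ip (X \<omega>) (e i)) \<in> Lp F p"
    by (intro Lp_sum[OF F] Lp_scale[OF F] RLpD(2)[OF X]) auto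
  show "l (X \<omega>) = (\<Sum>i<d. l (e i) * ip (X \<omega>) (e i))" if "\<omega> \<in> space M" for \<omega>
    using linear_expansion[OF l RLpD(1)[OF X that]] by (simp add: mult.commute)
qed

lemma RLp_bilinear:
  assumes X: "RLp F (2 * p) X" and Y: "RLp F (2 * p) Y"
    and l: "\<And>u. u \<in> V\<^sub>h \<Longrightarrow> linear_on_fun V\<^sub>h (\<lambda>v. \<beta> v u)" and r: "\<And>u. u \<in> V\<^sub>h \<Longrightarrow> linear_on_fun V\<^sub>h (\<beta> u)"
  shows "(\<lambda>\<omega>. \<beta> (X \<omega>) (Y \<omega>)) \<in> Lp F p"
proof (rule Lp_cong_space[OF F])
  show "(\<lambda>\<omega>. \<Sum>i<d. ip (X \<omega>) (e i) * \<beta> (e i) (Y \<omega>)) \<in> Lp F p"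
    by (intro Lp_sum[OF F] Lp_mult[OF F] RLpD(2)[OF X] RLp_linear[OF Y] r e_Vh) auto
  show "\<beta> (X \<omega>) (Y \<omega>) = (\<Sum>i<d. ip (X \<omega>) (e i) * \<beta> (e i) (Y \<omega>))" if "\<omega> \<in> space M" for \<omega>
    by (rule linear_expansion[OF l]) (use RLpD(1)[OF X] RLpD(1)[OF Y] that in auto)
qed

text \<open>Two factors with four moments give \<open>tri (e i) Y Y\<close> two moments, just enough
  for the product with a coordinate of \<open>X\<close>.\<close>

lemma RLp_trilinear:
  assumes X: "RLp F 2 X" and Y: "RLp F 4 Y"
  shows "(\<lambda>\<omega>. tri (X \<omega>) (Y \<omega>) (Y \<omega>)) \<in> Lp F 1"
proof (rule Lp_cong_space[OF F])
  have "(\<lambda>\<omega>. tri (e i) (Y \<omega>) (Y \<omega>)) \<in> Lp F 2" if "i < d" for i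
    by (rule RLp_bilinear[where p = 2 and \<beta> = "tri (e i)"]) (use Y e_Vh[OF that] in \<open>auto intro: linear_forms\<close>)
  then show "(\<lambda>\<omega>. \<Sum>i<d. ip (X \<omega>) (e i) * tri (e i) (Y \<omega>) (Y \<omega>)) \<in> Lp F 1"
    using RLpD(2)[OF X] by (intro Lp_sum[OF F] Lp_mult[OF F]) auto
  show "tri (X \<omega>) (Y \<omega>) (Y \<omega>) = (\<Sum>i<d. ip (X \<omega>) (e i) * tri (e i) (Y \<omega>) (Y \<omega>))"
    if "\<omega> \<in> space M" for \<omega>
    by (rule linear_expansion[OF linear_forms(8)]) (use RLpD(1)[OF X that] RLpD(1)[OF Y that] in auto)
qed

lemma charge_Lp:
  assumes "RLp F (2 * p) X" "RLp F (2 * p) Y"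
  shows "(\<lambda>\<omega>. charge a b (X \<omega>) (Y \<omega>)) \<in> Lp F p"
  unfolding charge_def
  by (intro Lp_add[OF F] RLp_bilinear[where \<beta> = ip]) (use assms in \<open>auto intro: linear_forms\<close>)

lemma energy_Lp:
  assumes "RLp F 4 X" "RLp F 4 Y" "RLp F 2 Z" "RLp F 2 W"
  shows "(\<lambda>\<omega>. energy a b m (X \<omega>) (Y \<omega>) (Z \<omega>) (W \<omega>)) \<in> Lp F 1"
proof (rule Lp_cong_space[OF F])
  note mono = RLp_mono_exponent[OF assms(1), of 2] RLp_mono_exponent[OF assms(2), of 2]
  have b: "(\<lambda>\<omega>. ip (X \<omega>) (X \<omega>)) \<in> Lp F 1" "(\<lambda>\<omega>. stiff (X \<omega>) (X \<omega>)) \<in> Lp F 1" if "RLp F 2 X" for X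
    using RLp_bilinear[of 1 X X ip] RLp_bilinear[of 1 X X stiff] that by (auto intro: linear_forms)
  show "(\<lambda>\<omega>. 2 * tri (Z \<omega>) (X \<omega>) (X \<omega>) + 2 * tri (Z \<omega>) (Y \<omega>) (Y \<omega>) - ip (Z \<omega>) (Z \<omega>)
    - 4 * ip (W \<omega>) (W \<omega>) + stiff (Z \<omega>) (Z \<omega>) + 2 * stiff (X \<omega>) (X \<omega>) + 2 * stiff (Y \<omega>) (Y \<omega>)) \<in> Lp F 1"
    by (intro Lp_add[OF F] Lp_diff[OF F] Lp_scale[OF F] RLp_trilinear b assms mono) auto
qed (use energy_forms assms RLpD(1) in auto)

end

lemma Lp_AE:
  assumes "f \<in> borel_measurable M" "g \<in> Lp (G n) p" "AE \<omega> in M. f \<omega> = g \<omega>"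
  shows "f \<in> Lp (G n) p"
proof (rule Lp_dominated[OF G_sub _ Lp_integrable_power[OF assms(2)]])
  show "f \<in> borel_measurable (G n)" by (rule AE_closed[OF assms(1) Lp_measurable[OF assms(2)] assms(3)])
  show "AE \<omega> in M. \<bar>f \<omega>\<bar> ^ p \<le> \<bar>g \<omega>\<bar> ^ p" using assms(3) by eventually_elim simp
qed

lemma Vh_random_variable_coordinate:
  assumes "Vh_random_variable a b m F X" "space F = space M" "i < d"
  shows "(\<lambda>\<omega>. ip (X \<omega>) (e i)) \<in> borel_measurable F"
proof -
  have "(\<lambda>\<omega>. \<Sum>x\<in>S. \<kappa> i x * X \<omega> x) \<in> borel_measurable F"
    using assms(1) by (intro borel_measurable_sum borel_measurable_times) (auto simp: Vh_random_variable_def)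
  moreover have "ip (X \<omega>) (e i) = (\<Sum>x\<in>S. \<kappa> i x * X \<omega> x)" if "\<omega> \<in> space F" for \<omega>
    using coordinate[OF assms(3)] assms(1) that by (auto simp: Vh_random_variable_def)
  ultimately show ?thesis using measurable_cong[of F "\<lambda>\<omega>. ip (X \<omega>) (e i)"] by simp
qed

lemma iterate_Vh:
  assumes "n \<le> N" "\<omega> \<in> space M"
  shows "P n \<omega> \<in> V\<^sub>h" "Q n \<omega> \<in> V\<^sub>h" "U n \<omega> \<in> V\<^sub>h" "V n \<omega> \<in> V\<^sub>h"
  using iterates[of _ n] assms by (auto simp: Vh_random_variable_def)

lemma iterate_coordinate:
  assumes "n \<le> N" "i < d"
  shows "(\<lambda>\<omega>. ip (P n \<omega>) (e i)) \<in> borel_measurable M" "(\<lambda>\<omega>. ip (Q n \<omega>) (e i)) \<in> borel_measurable M"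
    "(\<lambda>\<omega>. ip (U n \<omega>) (e i)) \<in> borel_measurable M" "(\<lambda>\<omega>. ip (V n \<omega>) (e i)) \<in> borel_measurable M"
  using Vh_random_variable_coordinate[OF iterates refl assms(2)] assms(1) by auto

lemma G_space: "space (G n) = space M"
  using G_sub by (simp add: subalgebra_def)

definition "regular n \<longleftrightarrow> RLp (G n) 4 (P n) \<and> RLp (G n) 4 (Q n) \<and> RLp (G n) 2 (U n) \<and> RLp (G n) 2 (V n)"

lemma regular_0: "regular 0"
proof -
  have meas: "(\<lambda>\<omega>. ip (X 0 \<omega>) (e i)) \<in> borel_measurable (G 0)" if "X \<in> {P, Q, U, V}" "i < d" for X i
    by (rule Vh_random_variable_coordinate[OF initial[OF that(1)] G_space that(2)])
  have Vh: "X 0 \<omega> \<in> V\<^sub>h" if "X \<in> {P, Q, U, V}" "\<omega> \<in> space M" for X \<omega>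
    using iterates[OF that(1), of 0] that(2) by (simp add: Vh_random_variable_def)
  have 4: "RLp (G 0) 4 (X 0)" if "X \<in> {P, Q}" for X
    unfolding RLp_def
  proof (intro conjI ballI allI impI)
    have X: "X \<in> {P, Q, U, V}" using that by auto
    then show "X 0 \<omega> \<in> V\<^sub>h" if "\<omega> \<in> space M" for \<omega> using Vh that by blast
    fix i assume i: "i < d"
    show "(\<lambda>\<omega>. ip (X 0 \<omega>) (e i)) \<in> Lp (G 0) 4"
    proof (rule Lp_dominated[OF G_sub meas[OF X i] initial4[OF that] AE_I2])
      fix \<omega> assume "\<omega> \<in> space M"
      then have "((ip (X 0 \<omega>) (e i))\<^sup>2)\<^sup>2 \<le> (ip (X 0 \<omega>) (X 0 \<omega>))\<^sup>2"
        using coordinate_le[OF Vh[OF X] i] by (intro power_mono) auto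
      then show "\<bar>ip (X 0 \<omega>) (e i)\<bar> ^ 4 \<le> (ip (X 0 \<omega>) (X 0 \<omega>))\<^sup>2" by simp
    qed
  qed
  have 2: "RLp (G 0) 2 (X 0)" if "X \<in> {U, V}" for X
    unfolding RLp_def
  proof (intro conjI ballI allI impI)
    have X: "X \<in> {P, Q, U, V}" using that by auto
    then show "X 0 \<omega> \<in> V\<^sub>h" if "\<omega> \<in> space M" for \<omega> using Vh that by blast
    fix i assume i: "i < d"
    show "(\<lambda>\<omega>. ip (X 0 \<omega>) (e i)) \<in> Lp (G 0) 2"
      by (rule Lp_dominated[OF G_sub meas[OF X i] initial2[OF that] AE_I2])
        (use coordinate_le[OF Vh[OF X] i] in simp)
  qed
  show ?thesis unfolding regular_def using 4[of P] 4[of Q] 2[of U] 2[of V] by auto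
qed

subsection \<open>One step of the random scheme\<close>

context
  fixes n
  assumes n: "n < N" and reg: "regular n"
begin

lemma PQUV: "RLp (G n) 4 (P n)" "RLp (G n) 4 (Q n)" "RLp (G n) 2 (U n)" "RLp (G n) 2 (V n)"
  "RLp (G n) 2 (P n)" "RLp (G n) 2 (Q n)"
  using reg RLp_mono_exponent[OF G_sub, of n 4 _ 2] by (auto simp: regular_def)

lemma step_AE: "AE \<omega> in M. \<omega> \<in> space M \<and>
  fem_step a b m C1 C2 dt (D 0 n \<omega>) (D 1 n \<omega>) (D 2 n \<omega>) \<eta>1 \<eta>2
    (P n \<omega>) (Q n \<omega>) (U n \<omega>) (V n \<omega>) (P (Suc n) \<omega>) (Q (Suc n) \<omega>) (U (Suc n) \<omega>) (V (Suc n) \<omega>)"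
  using scheme[OF n] AE_space
proof eventually_elim
  fix \<omega> assume "fe_step a b m C1 C2 \<eta>1 \<eta>2 dt (D 0 n \<omega>) (D 1 n \<omega>) (D 2 n \<omega>)
      (P n \<omega>) (Q n \<omega>) (U n \<omega>) (V n \<omega>) (P (Suc n) \<omega>) (Q (Suc n) \<omega>) (U (Suc n) \<omega>) (V (Suc n) \<omega>)"
    and "\<omega> \<in> space M"
  then show "\<omega> \<in> space M \<and>
      fem_step a b m C1 C2 dt (D 0 n \<omega>) (D 1 n \<omega>) (D 2 n \<omega>) \<eta>1 \<eta>2
    (P n \<omega>) (Q n \<omega>) (U n \<omega>) (V n \<omega>) (P (Suc n) \<omega>) (Q (Suc n) \<omega>) (U (Suc n) \<omega>) (V (Suc n) \<omega>)"
    using n dt_pos \<eta>1 \<eta>2 iterate_Vh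
    by (intro conjI fem_step.intro fem_axioms fem_step_axioms.intro) auto
qed

text \<open>The step for \<open>U\<close> is affine in the increments, with coefficients known at the previous time.\<close>

definition "U_coeff z \<omega> = wave_form dt (U n \<omega>) z + dt\<^sup>2 / 2 * (stiff (U n \<omega>) z - ip (U n \<omega>) z)
  + 2 * dt * ip (V n \<omega>) z + dt\<^sup>2 / 2 * (tri (P n \<omega>) (P n \<omega>) z + tri (Q n \<omega>) (Q n \<omega>) z)
  + dt\<^sup>2 * C1\<^sup>2 * dt * tri p1 p1 z"

lemma U_coeff_Lp:
  assumes z: "z \<in> V\<^sub>h"
  shows "U_coeff z \<in> Lp (G n) 2" "(\<lambda>\<omega>. - (dt\<^sup>2 * C1) * tri (Q n \<omega>) p1 z) \<in> Lp (G n) 2"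
    "(\<lambda>\<omega>. (dt\<^sup>2 * C1) * tri (P n \<omega>) p1 z) \<in> Lp (G n) 2"
proof -
  have t: "(\<lambda>\<omega>. tri (X \<omega>) (X \<omega>) z) \<in> Lp (G n) 2" if "RLp (G n) 4 X" for X
    by (rule RLp_bilinear[OF G_sub, where p = 2 and \<beta> = "\<lambda>u v. tri u v z"]) (use that z in \<open>auto intro: linear_forms\<close>)
  show "U_coeff z \<in> Lp (G n) 2"
    unfolding U_coeff_def[abs_def]
    by (intro Lp_add[OF G_sub] Lp_diff[OF G_sub] Lp_scale[OF G_sub] Lp_const[OF G_sub] t PQUV(1,2)
      PQUV(3,4)[THEN RLp_linear[OF G_sub]] linear_forms z)
  show "(\<lambda>\<omega>. - (dt\<^sup>2 * C1) * tri (Q n \<omega>) p1 z) \<in> Lp (G n) 2"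
    "(\<lambda>\<omega>. (dt\<^sup>2 * C1) * tri (P n \<omega>) p1 z) \<in> Lp (G n) 2"
    by (intro Lp_scale[OF G_sub] PQUV(5,6)[THEN RLp_linear[OF G_sub]] linear_forms z p_Vh)+
qed

text \<open>\<open>z\<close> represents \<open>l\<close> with respect to \<open>wave_form\<close>
  and is deterministic because that form is. Coordinates of \<open>U\<close> and the functional
  \<open>tri U p1 p1\<close> in the energy remainder are both instances of \<open>l\<close>.\<close>

lemma U_step:
  assumes l: "linear_on_fun V\<^sub>h l"
  obtains z where "z \<in> V\<^sub>h" "AE \<omega> in M. l (U (Suc n) \<omega>) = U_coeff z \<omega>
    + (- (dt\<^sup>2 * C1) * tri (Q n \<omega>) p1 z) * D 0 n \<omega> + ((dt\<^sup>2 * C1) * tri (P n \<omega>) p1 z) * D 1 n \<omega>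
    + (dt * C2 * ip p2 z) * D 2 n \<omega>"
proof -
  obtain z where z: "z \<in> V\<^sub>h" "\<And>v. v \<in> V\<^sub>h \<Longrightarrow> wave_form dt v z = l v"
    using wave_form_riesz[OF l] by blast
  show ?thesis
  proof (rule that[OF z(1)])
    show "AE \<omega> in M. l (U (Suc n) \<omega>) = U_coeff z \<omega>
      + (- (dt\<^sup>2 * C1) * tri (Q n \<omega>) p1 z) * D 0 n \<omega> + ((dt\<^sup>2 * C1) * tri (P n \<omega>) p1 z) * D 1 n \<omega>
      + (dt * C2 * ip p2 z) * D 2 n \<omega>"
      using step_AE
    proof eventually_elim
      fix \<omega> assume "\<omega> \<in> space M \<and>
        fem_step a b m C1 C2 dt (D 0 n \<omega>) (D 1 n \<omega>) (D 2 n \<omega>) \<eta>1 \<eta>2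
        (P n \<omega>) (Q n \<omega>) (U n \<omega>) (V n \<omega>) (P (Suc n) \<omega>) (Q (Suc n) \<omega>) (U (Suc n) \<omega>) (V (Suc n) \<omega>)"
      then interpret s: fem_step a b m C1 C2 dt "D 0 n \<omega>" "D 1 n \<omega>" "D 2 n \<omega>" \<eta>1 \<eta>2
        "P n \<omega>" "Q n \<omega>" "U n \<omega>" "V n \<omega>" "P (Suc n) \<omega>" "Q (Suc n) \<omega>" "U (Suc n) \<omega>" "V (Suc n) \<omega>"
        by blast
      show "l (U (Suc n) \<omega>) = U_coeff z \<omega>
        + (- (dt\<^sup>2 * C1) * tri (Q n \<omega>) p1 z) * D 0 n \<omega> + ((dt\<^sup>2 * C1) * tri (P n \<omega>) p1 z) * D 1 n \<omega>
        + (dt * C2 * ip p2 z) * D 2 n \<omega>"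
        using s.wave_form_U[OF z(1), unfolded s.source_def z(2)[OF s.V_Vh(3)]]
        unfolding U_coeff_def by (simp add: field_simps)
    qed
  qed
qed

lemma U_next: "RLp (G (Suc n)) 2 (U (Suc n))"
  unfolding RLp_def
proof (intro conjI ballI allI impI)
  show "U (Suc n) \<omega> \<in> V\<^sub>h" if "\<omega> \<in> space M" for \<omega> using iterate_Vh n that by auto
  fix i assume i: "i < d"
  obtain z where z: "z \<in> V\<^sub>h" and eq: "AE \<omega> in M. ip (U (Suc n) \<omega>) (e i) = U_coeff z \<omega>
    + (- (dt\<^sup>2 * C1) * tri (Q n \<omega>) p1 z) * D 0 n \<omega> + ((dt\<^sup>2 * C1) * tri (P n \<omega>) p1 z) * D 1 n \<omega>
    + (dt * C2 * ip p2 z) * D 2 n \<omega>"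
    using U_step[OF linear_forms(2)[OF e_Vh[OF i]]] by blast
  show "(\<lambda>\<omega>. ip (U (Suc n) \<omega>) (e i)) \<in> Lp (G (Suc n)) 2"
  proof (rule Lp_AE[OF _ _ eq])
    show "(\<lambda>\<omega>. ip (U (Suc n) \<omega>) (e i)) \<in> borel_measurable M" using iterate_coordinate n i by auto
    show "(\<lambda>\<omega>. U_coeff z \<omega>
      + (- (dt\<^sup>2 * C1) * tri (Q n \<omega>) p1 z) * D 0 n \<omega> + ((dt\<^sup>2 * C1) * tri (P n \<omega>) p1 z) * D 1 n \<omega>
      + (dt * C2 * ip p2 z) * D 2 n \<omega>) \<in> Lp (G (Suc n)) 2"
      by (intro Lp_add[OF G_sub] Lp_D1 U_coeff_Lp z Lp_mono_subalgebra[OF G_mono, of "U_coeff z"] Lp_const[OF G_sub]) auto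
  qed
qed

text \<open>Once \<open>U\<close> is controlled, \<open>V\<close> is read off from its difference
  quotient, \<open>V = (U - U0) / dt - Vt\<close>.\<close>

lemma V_next: "RLp (G (Suc n)) 2 (V (Suc n))"
  unfolding RLp_def
proof (intro conjI ballI allI impI)
  show "V (Suc n) \<omega> \<in> V\<^sub>h" if "\<omega> \<in> space M" for \<omega> using iterate_Vh n that by auto
  fix i assume i: "i < d"
  show "(\<lambda>\<omega>. ip (V (Suc n) \<omega>) (e i)) \<in> Lp (G (Suc n)) 2"
  proof (rule Lp_AE)
    show "(\<lambda>\<omega>. ip (V (Suc n) \<omega>) (e i)) \<in> borel_measurable M" using iterate_coordinate n i by auto
    show "(\<lambda>\<omega>. (1 / dt) * (ip (U (Suc n) \<omega>) (e i) - ip (U n \<omega>) (e i)) - ip (V n \<omega>) (e i)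
        - (C2 / 2 * ip p2 (e i)) * D 2 n \<omega>) \<in> Lp (G (Suc n)) 2"
      using Lp_mono_subalgebra[OF G_mono, OF RLpD(2)[OF PQUV(3) i]]
        Lp_mono_subalgebra[OF G_mono, OF RLpD(2)[OF PQUV(4) i]]
      by (intro Lp_diff[OF G_sub] Lp_scale[OF G_sub] RLpD(2)[OF U_next i] Lp_D1 Lp_const[OF G_sub]) auto
    show "AE \<omega> in M. ip (V (Suc n) \<omega>) (e i) = (1 / dt) * (ip (U (Suc n) \<omega>) (e i) - ip (U n \<omega>) (e i))
        - ip (V n \<omega>) (e i) - (C2 / 2 * ip p2 (e i)) * D 2 n \<omega>"
      using step_AE
    proof eventually_elim
      fix \<omega> assume "\<omega> \<in> space M \<and>
        fem_step a b m C1 C2 dt (D 0 n \<omega>) (D 1 n \<omega>) (D 2 n \<omega>) \<eta>1 \<eta>2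
        (P n \<omega>) (Q n \<omega>) (U n \<omega>) (V n \<omega>) (P (Suc n) \<omega>) (Q (Suc n) \<omega>) (U (Suc n) \<omega>) (V (Suc n) \<omega>)"
      then interpret s: fem_step a b m C1 C2 dt "D 0 n \<omega>" "D 1 n \<omega>" "D 2 n \<omega>" \<eta>1 \<eta>2
        "P n \<omega>" "Q n \<omega>" "U n \<omega>" "V n \<omega>" "P (Suc n) \<omega>" "Q (Suc n) \<omega>" "U (Suc n) \<omega>" "V (Suc n) \<omega>"
        by blast
      show "ip (V (Suc n) \<omega>) (e i) = (1 / dt) * (ip (U (Suc n) \<omega>) (e i) - ip (U n \<omega>) (e i))
        - ip (V n \<omega>) (e i) - (C2 / 2 * ip p2 (e i)) * D 2 n \<omega>"
        unfolding s.ip_U_eq[OF e_Vh[OF i]] s.ip_tilde[OF e_Vh[OF i]] using dt_pos by (simp add: field_simps)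
    qed
  qed
qed

section \<open>The Crank-Nicolson system for \<open>P\<close> and \<open>Q\<close> in
  coordinates\<close>

text \<open>The matrix of \<open>A + U\<close> in the orthonormal basis, with the new
  \<open>U\<close>. It is symmetric, and it is measurable at time \<open>Suc n\<close> because
  \<open>U\<close> has been dealt with before \<open>P\<close> and \<open>Q\<close>.\<close>

definition "hamiltonian \<omega> i j = stiff (e j) (e i) + tri (U (Suc n) \<omega>) (e j) (e i)"
definition "Pt_coord \<omega> i = ip (P n \<omega>) (e i) + (C1 * ip p1 (e i)) * D 1 n \<omega>"
definition "Qt_coord \<omega> i = ip (Q n \<omega>) (e i) - (C1 * ip p1 (e i)) * D 0 n \<omega>"

lemma coord_measurable:
  assumes "i < d"
  shows "(\<lambda>\<omega>. Pt_coord \<omega> i) \<in> borel_measurable (G (Suc n))"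
    "(\<lambda>\<omega>. Qt_coord \<omega> i) \<in> borel_measurable (G (Suc n))"
  unfolding Pt_coord_def Qt_coord_def
  using measurable_from_subalg[OF G_mono Lp_measurable[OF RLpD(2)[OF PQUV(1) assms]]]
    measurable_from_subalg[OF G_mono Lp_measurable[OF RLpD(2)[OF PQUV(2) assms]]]
    D_measurable[of 0 n] D_measurable[of 1 n]
  by auto

lemma hamiltonian_measurable:
  assumes "i < d" "j < d"
  shows "(\<lambda>\<omega>. hamiltonian \<omega> i j) \<in> borel_measurable (G (Suc n))"
  unfolding hamiltonian_def
  using Lp_measurable[OF RLp_linear[OF G_sub U_next linear_forms(8)[OF e_Vh[OF assms(2)] e_Vh[OF assms(1)]]]]
  by simp

lemma PQ_system:
  "AE \<omega> in M. (\<forall>i<d. ip (P (Suc n) \<omega>) (e i) = Pt_coord \<omega> i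
      - dt / 2 * (\<Sum>j<d. hamiltonian \<omega> i j * (ip (Q (Suc n) \<omega>) (e j) + Qt_coord \<omega> j))) \<and>
    (\<forall>i<d. ip (Q (Suc n) \<omega>) (e i) = Qt_coord \<omega> i
      + dt / 2 * (\<Sum>j<d. hamiltonian \<omega> i j * (ip (P (Suc n) \<omega>) (e j) + Pt_coord \<omega> j)))"
  using step_AE
proof eventually_elim
  fix \<omega> assume "\<omega> \<in> space M \<and>
    fem_step a b m C1 C2 dt (D 0 n \<omega>) (D 1 n \<omega>) (D 2 n \<omega>) \<eta>1 \<eta>2
    (P n \<omega>) (Q n \<omega>) (U n \<omega>) (V n \<omega>) (P (Suc n) \<omega>) (Q (Suc n) \<omega>) (U (Suc n) \<omega>) (V (Suc n) \<omega>)"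
  then interpret s: fem_step a b m C1 C2 dt "D 0 n \<omega>" "D 1 n \<omega>" "D 2 n \<omega>" \<eta>1 \<eta>2
    "P n \<omega>" "Q n \<omega>" "U n \<omega>" "V n \<omega>" "P (Suc n) \<omega>" "Q (Suc n) \<omega>" "U (Suc n) \<omega>" "V (Suc n) \<omega>"
    by blast
  have c: "ip s.Pt (e i) = Pt_coord \<omega> i" "ip s.Qt (e i) = Qt_coord \<omega> i" if "i < d" for i
    unfolding Pt_coord_def Qt_coord_def s.ip_tilde[OF e_Vh[OF that]] by simp_all
  have H: "stiff u (e i) + stiff v (e i) + tri (U (Suc n) \<omega>) u (e i) + tri (U (Suc n) \<omega>) v (e i)
      = (\<Sum>j<d. hamiltonian \<omega> i j * (ip u (e j) + ip v (e j)))"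
    if "u \<in> V\<^sub>h" "v \<in> V\<^sub>h" "i < d" for u v i
  proof -
    have "stiff w (e i) + tri (U (Suc n) \<omega>) w (e i) = (\<Sum>j<d. hamiltonian \<omega> i j * ip w (e j))"
      if w: "w \<in> V\<^sub>h" for w
      using linear_expansion[OF linear_forms(4)[OF e_Vh] w] linear_expansion[OF linear_forms(7)[OF s.V_Vh(3) e_Vh] w]
        \<open>i < d\<close> by (simp add: hamiltonian_def algebra_simps sum.distrib)
    from this[OF that(1)] this[OF that(2)] show ?thesis
      by (simp add: distrib_left sum.distrib)
  qed
  have cong: "(\<Sum>j<d. hamiltonian \<omega> i j * (x j + ip s.Qt (e j))) = (\<Sum>j<d. hamiltonian \<omega> i j * (x j + Qt_coord \<omega> j))"
    "(\<Sum>j<d. hamiltonian \<omega> i j * (x j + ip s.Pt (e j))) = (\<Sum>j<d. hamiltonian \<omega> i j * (x j + Pt_coord \<omega> j))" for x i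
    using c by (auto intro: sum.cong)
  show "(\<forall>i<d. ip (P (Suc n) \<omega>) (e i) = Pt_coord \<omega> i
      - dt / 2 * (\<Sum>j<d. hamiltonian \<omega> i j * (ip (Q (Suc n) \<omega>) (e j) + Qt_coord \<omega> j))) \<and>
    (\<forall>i<d. ip (Q (Suc n) \<omega>) (e i) = Qt_coord \<omega> i
      + dt / 2 * (\<Sum>j<d. hamiltonian \<omega> i j * (ip (P (Suc n) \<omega>) (e j) + Pt_coord \<omega> j)))"
  proof (intro conjI allI impI)
    fix i assume i: "i < d"
    show "ip (P (Suc n) \<omega>) (e i) = Pt_coord \<omega> i
        - dt / 2 * (\<Sum>j<d. hamiltonian \<omega> i j * (ip (Q (Suc n) \<omega>) (e j) + Qt_coord \<omega> j))"
      using s.P_eq[OF e_Vh[OF i]] unfolding H[OF s.V_Vh(2) s.t_Vh(2) i] cong c(1)[OF i] .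
    show "ip (Q (Suc n) \<omega>) (e i) = Qt_coord \<omega> i
        + dt / 2 * (\<Sum>j<d. hamiltonian \<omega> i j * (ip (P (Suc n) \<omega>) (e j) + Pt_coord \<omega> j))"
      using s.Q_eq[OF e_Vh[OF i]] unfolding H[OF s.V_Vh(1) s.t_Vh(1) i] cong c(2)[OF i] .
  qed
qed

text \<open>The coordinates of \<open>P\<close> agree almost surely with Cramer's quotient of
  measurable data, and closedness of \<open>G\<close> under almost sure modification transfers
  measurability. \<open>Q\<close> then follows from its own equation.\<close>

lemma PQ_measurable:
  assumes k: "k < d"
  shows "(\<lambda>\<omega>. ip (P (Suc n) \<omega>) (e k)) \<in> borel_measurable (G (Suc n))"
    "(\<lambda>\<omega>. ip (Q (Suc n) \<omega>) (e k)) \<in> borel_measurable (G (Suc n))"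
proof -
  have P: "(\<lambda>\<omega>. ip (P (Suc n) \<omega>) (e k)) \<in> borel_measurable (G (Suc n))" if k: "k < d" for k
  proof (rule AE_closed)
    show "(\<lambda>\<omega>. ip (P (Suc n) \<omega>) (e k)) \<in> borel_measurable M" using iterate_coordinate n k by auto
    let ?L = hamiltonian and ?s = "dt / 2"
    show "(\<lambda>\<omega>. cramer d (crank_nicolson_matrix d ?s (?L \<omega>)) (\<lambda>i. Pt_coord \<omega> i
        - ?s * (\<Sum>j<d. ?L \<omega> i j * (2 * Qt_coord \<omega> j))
        - ?s\<^sup>2 * (\<Sum>j<d. ?L \<omega> i j * (\<Sum>k<d. ?L \<omega> j k * Pt_coord \<omega> k))) k) \<in> borel_measurable (G (Suc n))"
      unfolding crank_nicolson_matrix_def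
      by (intro cramer_measurable borel_measurable_add borel_measurable_diff borel_measurable_times
        borel_measurable_sum borel_measurable_const hamiltonian_measurable coord_measurable) auto
    show "AE \<omega> in M. ip (P (Suc n) \<omega>) (e k) = cramer d (crank_nicolson_matrix d ?s (?L \<omega>)) (\<lambda>i. Pt_coord \<omega> i
        - ?s * (\<Sum>j<d. ?L \<omega> i j * (2 * Qt_coord \<omega> j))
        - ?s\<^sup>2 * (\<Sum>j<d. ?L \<omega> i j * (\<Sum>k<d. ?L \<omega> j k * Pt_coord \<omega> k))) k"
      using PQ_system
    proof eventually_elim
      fix \<omega> assume "(\<forall>i<d. ip (P (Suc n) \<omega>) (e i) = Pt_coord \<omega> i
          - ?s * (\<Sum>j<d. ?L \<omega> i j * (ip (Q (Suc n) \<omega>) (e j) + Qt_coord \<omega> j))) \<and>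
        (\<forall>i<d. ip (Q (Suc n) \<omega>) (e i) = Qt_coord \<omega> i
          + ?s * (\<Sum>j<d. ?L \<omega> i j * (ip (P (Suc n) \<omega>) (e j) + Pt_coord \<omega> j)))"
      moreover have "?L \<omega> i j = ?L \<omega> j i" for i j
        using stiff_commute[of "e i"] tri_commute23[of _ "e i"] by (simp add: hamiltonian_def)
      ultimately show "ip (P (Suc n) \<omega>) (e k) = cramer d (crank_nicolson_matrix d ?s (?L \<omega>)) (\<lambda>i. Pt_coord \<omega> i
        - ?s * (\<Sum>j<d. ?L \<omega> i j * (2 * Qt_coord \<omega> j))
        - ?s\<^sup>2 * (\<Sum>j<d. ?L \<omega> i j * (\<Sum>k<d. ?L \<omega> j k * Pt_coord \<omega> k))) k"
        by (intro crank_nicolson_solution[where q = "\<lambda>i. ip (Q (Suc n) \<omega>) (e i)", OF _ _ _ k]) auto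
    qed
  qed
  from P[OF k] show "(\<lambda>\<omega>. ip (P (Suc n) \<omega>) (e k)) \<in> borel_measurable (G (Suc n))" .
  show "(\<lambda>\<omega>. ip (Q (Suc n) \<omega>) (e k)) \<in> borel_measurable (G (Suc n))"
  proof (rule AE_closed)
    show "(\<lambda>\<omega>. ip (Q (Suc n) \<omega>) (e k)) \<in> borel_measurable M" using iterate_coordinate n k by auto
    show "(\<lambda>\<omega>. Qt_coord \<omega> k + dt / 2 * (\<Sum>j<d. hamiltonian \<omega> k j * (ip (P (Suc n) \<omega>) (e j) + Pt_coord \<omega> j)))
        \<in> borel_measurable (G (Suc n))"
      using k P by (intro borel_measurable_add borel_measurable_times
        borel_measurable_sum borel_measurable_const hamiltonian_measurable coord_measurable) auto
    show "AE \<omega> in M. ip (Q (Suc n) \<omega>) (e k)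
        = Qt_coord \<omega> k + dt / 2 * (\<Sum>j<d. hamiltonian \<omega> k j * (ip (P (Suc n) \<omega>) (e j) + Pt_coord \<omega> j))"
      using PQ_system by eventually_elim (use k in blast)
  qed
qed

section \<open>Moments of \<open>P, Q\<close> and mean increments of charge and energy\<close>

lemma charge_increment_AE:
  "AE \<omega> in M. charge a b (P (Suc n) \<omega>) (Q (Suc n) \<omega>) = charge a b (P n \<omega>) (Q n \<omega>)
    + (2 * C1 * ip (P n \<omega>) p1) * D 1 n \<omega> - (2 * C1 * ip (Q n \<omega>) p1) * D 0 n \<omega>
    + (C1\<^sup>2 * ip p1 p1) * (D 0 n \<omega>)\<^sup>2 + (C1\<^sup>2 * ip p1 p1) * (D 1 n \<omega>)\<^sup>2"
  using step_AE
proof eventually_elim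
  fix \<omega> assume "\<omega> \<in> space M \<and>
    fem_step a b m C1 C2 dt (D 0 n \<omega>) (D 1 n \<omega>) (D 2 n \<omega>) \<eta>1 \<eta>2
    (P n \<omega>) (Q n \<omega>) (U n \<omega>) (V n \<omega>) (P (Suc n) \<omega>) (Q (Suc n) \<omega>) (U (Suc n) \<omega>) (V (Suc n) \<omega>)"
  then have s: "fem_step a b m C1 C2 dt (D 0 n \<omega>) (D 1 n \<omega>) (D 2 n \<omega>) \<eta>1 \<eta>2
    (P n \<omega>) (Q n \<omega>) (U n \<omega>) (V n \<omega>) (P (Suc n) \<omega>) (Q (Suc n) \<omega>) (U (Suc n) \<omega>) (V (Suc n) \<omega>)" by simp
  show "charge a b (P (Suc n) \<omega>) (Q (Suc n) \<omega>) = charge a b (P n \<omega>) (Q n \<omega>)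
    + (2 * C1 * ip (P n \<omega>) p1) * D 1 n \<omega> - (2 * C1 * ip (Q n \<omega>) p1) * D 0 n \<omega>
    + (C1\<^sup>2 * ip p1 p1) * (D 0 n \<omega>)\<^sup>2 + (C1\<^sup>2 * ip p1 p1) * (D 1 n \<omega>)\<^sup>2"
    unfolding fem_step.charge_increment[OF s] by (simp add: algebra_simps)
qed

text \<open>The charge on the right is expressed by the past and the increments alone, hence has two
  moments; the fourth power of any coordinate is at most the squared charge. The random matrix of
  the system plays no part in this bound.\<close>

lemma PQ_next: "RLp (G (Suc n)) 4 (P (Suc n))" "RLp (G (Suc n)) 4 (Q (Suc n))"
proof -
  define c where "c = (\<lambda>\<omega>. charge a b (P n \<omega>) (Q n \<omega>)
    + (2 * C1 * ip (P n \<omega>) p1) * D 1 n \<omega> - (2 * C1 * ip (Q n \<omega>) p1) * D 0 n \<omega>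
    + (C1\<^sup>2 * ip p1 p1) * (D 0 n \<omega>)\<^sup>2 + (C1\<^sup>2 * ip p1 p1) * (D 1 n \<omega>)\<^sup>2)"
  have ch: "(\<lambda>\<omega>. charge a b (P n \<omega>) (Q n \<omega>)) \<in> Lp (G n) 2"
    using charge_Lp[OF G_sub, of n 2 "P n" "Q n"] PQUV by simp
  have "c \<in> Lp (G (Suc n)) 2"
    unfolding c_def
    by (intro Lp_add[OF G_sub] Lp_diff[OF G_sub] Lp_D1 Lp_D Lp_const[OF G_sub] Lp_scale[OF G_sub] ch
      Lp_mono_subalgebra[OF G_mono ch] RLp_linear[OF G_sub PQUV(5)] RLp_linear[OF G_sub PQUV(6)] linear_forms p_Vh) auto
  then have int: "integrable M (\<lambda>\<omega>. \<bar>c \<omega>\<bar> ^ 2)" by (rule Lp_integrable_power)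
  have bound: "\<bar>ip v (e i)\<bar> ^ 4 \<le> \<bar>charge a b u w\<bar> ^ 2" if "v \<in> {u, w}" "v \<in> V\<^sub>h" "i < d" for u v w i
  proof -
    have "(ip v (e i))\<^sup>2 \<le> charge a b u w"
      using coordinate_le[OF that(2,3)] that(1) ip_nonneg[of u] ip_nonneg[of w] by (auto simp: charge_def)
    then have "((ip v (e i))\<^sup>2)\<^sup>2 \<le> (charge a b u w)\<^sup>2" by (intro power_mono) auto
    then show ?thesis by simp
  qed
  have "(\<lambda>\<omega>. ip (P (Suc n) \<omega>) (e i)) \<in> Lp (G (Suc n)) 4" "(\<lambda>\<omega>. ip (Q (Suc n) \<omega>) (e i)) \<in> Lp (G (Suc n)) 4"
    if i: "i < d" for i
  proof -
    have *: "AE \<omega> in M. \<bar>ip (P (Suc n) \<omega>) (e i)\<bar> ^ 4 \<le> \<bar>c \<omega>\<bar> ^ 2 \<and> \<bar>ip (Q (Suc n) \<omega>) (e i)\<bar> ^ 4 \<le> \<bar>c \<omega>\<bar> ^ 2"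
      using charge_increment_AE AE_space
    proof eventually_elim
      case (elim \<omega>)
      have "c \<omega> = charge a b (P (Suc n) \<omega>) (Q (Suc n) \<omega>)" using elim(1) by (simp add: c_def)
      then show ?case using bound[OF _ _ i] iterate_Vh(1,2)[of "Suc n" \<omega>] n elim(2) by auto
    qed
    show "(\<lambda>\<omega>. ip (P (Suc n) \<omega>) (e i)) \<in> Lp (G (Suc n)) 4"
      by (rule Lp_dominated[OF G_sub PQ_measurable(1)[OF i] int]) (use * in auto)
    show "(\<lambda>\<omega>. ip (Q (Suc n) \<omega>) (e i)) \<in> Lp (G (Suc n)) 4"
      by (rule Lp_dominated[OF G_sub PQ_measurable(2)[OF i] int]) (use * in auto)
  qed
  then show "RLp (G (Suc n)) 4 (P (Suc n))" "RLp (G (Suc n)) 4 (Q (Suc n))"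
    using iterate_Vh(1,2)[of "Suc n"] n by (auto simp: RLp_def)
qed

lemma regular_Suc: "regular (Suc n)"
  unfolding regular_def using PQ_next U_next V_next by blast

lemma charge_expectation_step:
  "expectation (\<lambda>\<omega>. charge a b (P (Suc n) \<omega>) (Q (Suc n) \<omega>))
    = expectation (\<lambda>\<omega>. charge a b (P n \<omega>) (Q n \<omega>)) + 2 * C1\<^sup>2 * ip p1 p1 * dt"
proof -
  have ch: "(\<lambda>\<omega>. charge a b (P k \<omega>) (Q k \<omega>)) \<in> Lp (G k) 1" if "regular k" for k
    by (rule charge_Lp[OF G_sub]) (use that RLp_mono_exponent[OF G_sub, of k 4 _ 2] in \<open>auto simp: regular_def\<close>)
  have "has_bochner_integral M (\<lambda>\<omega>. charge a b (P n \<omega>) (Q n \<omega>)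
    + (2 * C1 * ip (P n \<omega>) p1) * D 1 n \<omega> - (2 * C1 * ip (Q n \<omega>) p1) * D 0 n \<omega>
    + (C1\<^sup>2 * ip p1 p1) * (D 0 n \<omega>)\<^sup>2 + (C1\<^sup>2 * ip p1 p1) * (D 1 n \<omega>)\<^sup>2)
    (expectation (\<lambda>\<omega>. charge a b (P n \<omega>) (Q n \<omega>)) + 0 - 0
      + expectation (\<lambda>_. C1\<^sup>2 * ip p1 p1) * dt + expectation (\<lambda>_. C1\<^sup>2 * ip p1 p1) * dt)"
    by (intro has_bochner_integral_add has_bochner_integral_diff has_bochner_integral_integrable
      D_first D_second Lp_integrable[OF G_sub ch[OF reg]] Lp_scale[OF G_sub] Lp_const[OF G_sub]
      RLp_linear[OF G_sub RLp_mono_exponent[OF G_sub PQUV(1)]] RLp_linear[OF G_sub RLp_mono_exponent[OF G_sub PQUV(2)]]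
      linear_forms p_Vh) auto
  from has_bochner_integral_integral_eq[OF this]
  show ?thesis
    using integral_cong_AE[OF _ _ charge_increment_AE]
      measurable_from_subalg[OF G_sub Lp_measurable[OF ch[OF regular_Suc]]] 
      borel_measurable_has_bochner_integral[OF \<open>has_bochner_integral M _ _\<close>]
    by (simp add: prob_space)
qed

lemma energy_expectation_step:
  "expectation (\<lambda>\<omega>. energy a b m (P (Suc n) \<omega>) (Q (Suc n) \<omega>) (U (Suc n) \<omega>) (V (Suc n) \<omega>))
    = expectation (\<lambda>\<omega>. energy a b m (P n \<omega>) (Q n \<omega>) (U n \<omega>) (V n \<omega>))
      - C2\<^sup>2 * ip p2 p2 * dt + 4 * C1\<^sup>2 * stiff p1 p1 * dt
      + 4 * C1\<^sup>2 * expectation (\<lambda>\<omega>. tri (U n \<omega>) p1 p1) * dt"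
proof -
  let ?E = "\<lambda>k \<omega>. energy a b m (P k \<omega>) (Q k \<omega>) (U k \<omega>) (V k \<omega>)"
  have en: "?E k \<in> Lp (G k) 1" if "regular k" for k
    by (rule energy_Lp[OF G_sub]) (use that in \<open>auto simp: regular_def\<close>)
  obtain z where z: "z \<in> V\<^sub>h" and Ueq: "AE \<omega> in M. tri (U (Suc n) \<omega>) p1 p1 = U_coeff z \<omega>
    + (- (dt\<^sup>2 * C1) * tri (Q n \<omega>) p1 z) * D 0 n \<omega> + ((dt\<^sup>2 * C1) * tri (P n \<omega>) p1 z) * D 1 n \<omega>
    + (dt * C2 * ip p2 z) * D 2 n \<omega>"
    using U_step[OF linear_forms(8)[OF p_Vh(1) p_Vh(1)]] by blast
  let ?A = "\<lambda>\<omega>. 4 * C1 * (stiff (P n \<omega>) p1 + tri (U n \<omega>) (P n \<omega>) p1)"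
  let ?B = "\<lambda>\<omega>. 4 * C1 * (stiff (Q n \<omega>) p1 + tri (U n \<omega>) (Q n \<omega>) p1)"
  let ?C = "\<lambda>\<omega>. 4 * C2 * ip (V n \<omega>) p2"
  \<comment> \<open>The only contribution of the new \<open>U\<close>, rewritten by its affine
    representation so that \<open>D_centered_squares\<close> applies.\<close>
  let ?R = "\<lambda>\<omega>. ((D 0 n \<omega>)\<^sup>2 + (D 1 n \<omega>)\<^sup>2 - 2 * dt) * (U_coeff z \<omega>
    + (- (dt\<^sup>2 * C1) * tri (Q n \<omega>) p1 z) * D 0 n \<omega> + ((dt\<^sup>2 * C1) * tri (P n \<omega>) p1 z) * D 1 n \<omega>
    + (dt * C2 * ip p2 z) * D 2 n \<omega>)"
  define f where "f = (\<lambda>\<omega>. ?E n \<omega> + ?A \<omega> * D 1 n \<omega> - ?B \<omega> * D 0 n \<omega>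
    + (2 * C1\<^sup>2 * stiff p1 p1) * (D 0 n \<omega>)\<^sup>2 + (2 * C1\<^sup>2 * stiff p1 p1) * (D 1 n \<omega>)\<^sup>2
    - ?C \<omega> * D 2 n \<omega> - (C2\<^sup>2 * ip p2 p2) * (D 2 n \<omega>)\<^sup>2 + (4 * C1\<^sup>2 * dt) * tri (U n \<omega>) p1 p1
    + (2 * C1\<^sup>2) * ?R \<omega>)"
  have eq: "AE \<omega> in M. ?E (Suc n) \<omega> = f \<omega>"
    using step_AE Ueq
  proof eventually_elim
    case (elim \<omega>)
    then have s: "fem_step a b m C1 C2 dt (D 0 n \<omega>) (D 1 n \<omega>) (D 2 n \<omega>) \<eta>1 \<eta>2
      (P n \<omega>) (Q n \<omega>) (U n \<omega>) (V n \<omega>) (P (Suc n) \<omega>) (Q (Suc n) \<omega>) (U (Suc n) \<omega>) (V (Suc n) \<omega>)" by simp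
    show ?case
      unfolding f_def fem_step.energy_increment[OF s] elim(2)[symmetric] by (simp add: algebra_simps)
  qed
  have bil: "(\<lambda>\<omega>. tri (U n \<omega>) (X \<omega>) p1) \<in> Lp (G n) 1" if "RLp (G n) 2 X" for X
    by (rule RLp_bilinear[OF G_sub, where \<beta> = "\<lambda>u v. tri u v p1"]) (use PQUV(3) that p_Vh in \<open>auto intro: linear_forms\<close>)
  have lin: "(\<lambda>\<omega>. l (X \<omega>)) \<in> Lp (G n) 1" if "RLp (G n) 2 X" "linear_on_fun V\<^sub>h l" for X l
    by (rule RLp_linear[OF G_sub RLp_mono_exponent[OF G_sub that(1)] that(2)]) simp
  have ABC: "?A \<in> Lp (G n) 1" "?B \<in> Lp (G n) 1" "?C \<in> Lp (G n) 1"
    by (intro Lp_scale[OF G_sub] Lp_add[OF G_sub] bil[OF PQUV(5)] bil[OF PQUV(6)] PQUV(4-6)[THEN lin] linear_forms p_Vh)+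
  have coeff: "U_coeff z \<in> Lp (G n) 1" "(\<lambda>\<omega>. - (dt\<^sup>2 * C1) * tri (Q n \<omega>) p1 z) \<in> Lp (G n) 1"
    "(\<lambda>\<omega>. (dt\<^sup>2 * C1) * tri (P n \<omega>) p1 z) \<in> Lp (G n) 1"
    using U_coeff_Lp[OF z] Lp_mono_exponent[OF G_sub, of _ n 2 1] by auto
  have R: "has_bochner_integral M ?R 0"
    by (rule D_centered_squares) (intro coeff Lp_const[OF G_sub])+
  \<comment> \<open>Each of two increments contributes
    \<open>2 * C1\<^sup>2 * stiff p1 p1 * dt\<close>, which explains the factor \<open>4\<close> in
    the law. The zeros are the terms linear in the increments and the centred remainder.\<close>
  have hbi: "has_bochner_integral M f (expectation (?E n) + 0 - 0
    + expectation (\<lambda>_. 2 * C1\<^sup>2 * stiff p1 p1) * dt + expectation (\<lambda>_. 2 * C1\<^sup>2 * stiff p1 p1) * dt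
    - 0 - expectation (\<lambda>_. C2\<^sup>2 * ip p2 p2) * dt + (4 * C1\<^sup>2 * dt) * expectation (\<lambda>\<omega>. tri (U n \<omega>) p1 p1)
    + (2 * C1\<^sup>2) * 0)"
    unfolding f_def
    by (intro has_bochner_integral_add has_bochner_integral_diff has_bochner_integral_integrable
      has_bochner_integral_mult_right R D_first ABC D_second Lp_const[OF G_sub]
      Lp_integrable[OF G_sub en[OF reg]] Lp_integrable[OF G_sub lin[OF PQUV(3) linear_forms(8)[OF p_Vh(1) p_Vh(1)]]]) auto
  have "expectation (?E (Suc n)) = expectation f"
    using measurable_from_subalg[OF G_sub Lp_measurable[OF en[OF regular_Suc]]]
      borel_measurable_has_bochner_integral[OF hbi] eq by (rule integral_cong_AE)
  also have "\<dots> = expectation (?E n) - C2\<^sup>2 * ip p2 p2 * dt + 4 * C1\<^sup>2 * stiff p1 p1 * dt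
      + 4 * C1\<^sup>2 * expectation (\<lambda>\<omega>. tri (U n \<omega>) p1 p1) * dt"
    unfolding has_bochner_integral_integral_eq[OF hbi] by (simp add: prob_space)
  finally show ?thesis .
qed

end

section \<open>Iteration over the time steps\<close>

lemma regular: "n \<le> N \<Longrightarrow> regular n"
  by (induction n) (auto intro: regular_0 regular_Suc)

lemma evolution_integrable:
  assumes "n \<le> N"
  shows "integrable M (\<lambda>\<omega>. charge a b (P n \<omega>) (Q n \<omega>))"
    "integrable M (\<lambda>\<omega>. energy a b m (P n \<omega>) (Q n \<omega>) (U n \<omega>) (V n \<omega>))"
    "integrable M (\<lambda>\<omega>. tri (U n \<omega>) p1 p1)"
proof -
  note reg = regular[OF assms, unfolded regular_def]
  show "integrable M (\<lambda>\<omega>. charge a b (P n \<omega>) (Q n \<omega>))"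
    by (rule Lp_integrable[OF G_sub charge_Lp[OF G_sub]]) (use reg RLp_mono_exponent[OF G_sub, of n 4 _ 2] in auto)
  show "integrable M (\<lambda>\<omega>. energy a b m (P n \<omega>) (Q n \<omega>) (U n \<omega>) (V n \<omega>))"
    by (rule Lp_integrable[OF G_sub energy_Lp[OF G_sub]]) (use reg in auto)
  show "integrable M (\<lambda>\<omega>. tri (U n \<omega>) p1 p1)"
  proof (rule Lp_integrable[OF G_sub RLp_linear[OF G_sub, where l = "\<lambda>u. tri u p1 p1"]])
    show "RLp (G n) 1 (U n)" using reg RLp_mono_exponent[OF G_sub, of n 2 _ 1] by auto
    show "linear_on_fun V\<^sub>h (\<lambda>u. tri u p1 p1)" by (intro linear_forms p_Vh)
  qed
qed

lemma charge_evolution: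
  "n \<le> N \<Longrightarrow> expectation (\<lambda>\<omega>. charge a b (P n \<omega>) (Q n \<omega>))
    = expectation (\<lambda>\<omega>. charge a b (P 0 \<omega>) (Q 0 \<omega>)) + 2 * C1\<^sup>2 * ip p1 p1 * (real n * dt)"
proof (induction n)
  case (Suc n)
  then show ?case using charge_expectation_step[of n] regular[of n] by (simp add: algebra_simps)
qed simp

lemma energy_evolution:
  "n \<le> N \<Longrightarrow> expectation (\<lambda>\<omega>. energy a b m (P n \<omega>) (Q n \<omega>) (U n \<omega>) (V n \<omega>))
    = expectation (\<lambda>\<omega>. energy a b m (P 0 \<omega>) (Q 0 \<omega>) (U 0 \<omega>) (V 0 \<omega>))
      - C2\<^sup>2 * ip p2 p2 * (real n * dt) + 4 * C1\<^sup>2 * stiff p1 p1 * (real n * dt)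
      + 4 * C1\<^sup>2 * (\<Sum>i<n. expectation (\<lambda>\<omega>. tri (U i \<omega>) p1 p1) * dt)"
proof (induction n)
  case (Suc n)
  then show ?case using energy_expectation_step[of n] regular[of n] by (simp add: algebra_simps)
qed simp

end

text \<open>The initial values may be random: \<open>F0\<close> carries them and is independent of
  the Wiener processes. Integrability belongs to the conclusion because the integral of a
  nonintegrable function is zero by convention, so the equations alone would not assert finite
  means.\<close>

theorem mainTheorem9:
  fixes \<Omega> F0 :: "'w measure"
    and B :: "nat \<Rightarrow> real \<Rightarrow> 'w \<Rightarrow> real"
    and a b C1 C2 T dt :: real and m N :: nat
    and \<eta>1 \<eta>2 :: "real \<Rightarrow> real"
    and P Q U V :: "nat \<Rightarrow> 'w \<Rightarrow> real \<Rightarrow> real"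
  assumes "prob_space \<Omega>"
    and "a < b" and "0 < m" and "0 < T" and "0 < dt" and "N = nat \<lfloor>T / dt\<rfloor>"
    and "\<eta>1 \<in> L2_space a b" and "\<eta>2 \<in> L2_space a b"
    and wiener: "\<And>k. k \<in> {0, 1, 2} \<Longrightarrow> wiener_process \<Omega> (B k)"
    and wiener_indep: "prob_space.indep_sets \<Omega> (\<lambda>k. gen_sigma \<Omega> {0..} (B k)) {0, 1, 2}"
    and initial_sigma: "subalgebra \<Omega> F0"
    and initial_indep: "prob_space.indep_set \<Omega> (sets F0)
          (gen_sigma \<Omega> ({0, 1, 2} \<times> {0..}) (\<lambda>(k, t). B k t))"
    and initial_meas: "\<And>X. X \<in> {P, Q, U, V} \<Longrightarrow> Vh_random_variable a b m F0 (X 0)"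
    and initial_moment4: "\<And>X. X \<in> {P, Q} \<Longrightarrow>
          integrable \<Omega> (\<lambda>\<omega>. (L2_inner a b (X 0 \<omega>) (X 0 \<omega>))\<^sup>2)"
    and initial_moment2: "\<And>X. X \<in> {U, V} \<Longrightarrow>
          integrable \<Omega> (\<lambda>\<omega>. L2_inner a b (X 0 \<omega>) (X 0 \<omega>))"
    and iterates: "\<And>X n. X \<in> {P, Q, U, V} \<Longrightarrow> n \<le> N \<Longrightarrow> Vh_random_variable a b m \<Omega> (X n)"
    and scheme: "\<And>n. n \<in> {1..N} \<Longrightarrow> AE \<omega> in \<Omega>.
          fe_step a b m C1 C2 \<eta>1 \<eta>2 dt
            (B 0 (real n * dt) \<omega> - B 0 (real (n - 1) * dt) \<omega>)
            (B 1 (real n * dt) \<omega> - B 1 (real (n - 1) * dt) \<omega>)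
            (B 2 (real n * dt) \<omega> - B 2 (real (n - 1) * dt) \<omega>)
            (P (n - 1) \<omega>) (Q (n - 1) \<omega>) (U (n - 1) \<omega>) (V (n - 1) \<omega>)
            (P n \<omega>) (Q n \<omega>) (U n \<omega>) (V n \<omega>)"
  shows "\<forall>n\<in>{0..N}.
      integrable \<Omega> (\<lambda>\<omega>. charge a b (P n \<omega>) (Q n \<omega>)) \<and>
      integrable \<Omega> (\<lambda>\<omega>. energy a b m (P n \<omega>) (Q n \<omega>) (U n \<omega>) (V n \<omega>)) \<and>
      integrable \<Omega> (\<lambda>\<omega>. L2_inner a b (U n \<omega>) (\<lambda>x. (Ph a b m \<eta>1 x)\<^sup>2)) \<and>
      prob_space.expectation \<Omega> (\<lambda>\<omega>. charge a b (P n \<omega>) (Q n \<omega>))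
        = prob_space.expectation \<Omega> (\<lambda>\<omega>. charge a b (P 0 \<omega>) (Q 0 \<omega>))
          + 2 * C1\<^sup>2 * L2_inner a b (Ph a b m \<eta>1) (Ph a b m \<eta>1) * (real n * dt) \<and>
      prob_space.expectation \<Omega> (\<lambda>\<omega>. energy a b m (P n \<omega>) (Q n \<omega>) (U n \<omega>) (V n \<omega>))
        = prob_space.expectation \<Omega> (\<lambda>\<omega>. energy a b m (P 0 \<omega>) (Q 0 \<omega>) (U 0 \<omega>) (V 0 \<omega>))
          - C2\<^sup>2 * L2_inner a b (Ph a b m \<eta>2) (Ph a b m \<eta>2) * (real n * dt)
          + 4 * C1\<^sup>2 * L2_inner a b (Ph a b m \<eta>1) (Ah a b m (Ph a b m \<eta>1)) * (real n * dt)
          + 4 * C1\<^sup>2 * (\<Sum>i<n. prob_space.expectation \<Omega>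
              (\<lambda>\<omega>. L2_inner a b (U i \<omega>) (\<lambda>x. (Ph a b m \<eta>1 x)\<^sup>2)) * dt)"
proof -
  interpret prob_space \<Omega> by fact
  interpret fem a b m by unfold_locales fact+
  \<comment> \<open>The scheme numbers its increments from \<open>1\<close>, whereas
    \<open>D\<close> counts from \<open>0\<close>: step \<open>Suc n\<close> of the scheme uses
    \<open>D k n\<close>.\<close>
  define D where "D = (\<lambda>k j \<omega>. B k (real (Suc j) * dt) \<omega> - B k (real j * dt) \<omega>)"
  obtain G where G: "noise \<Omega> D G dt" "subalgebra (G 0) F0"
    using noise_exists[OF assms(5) wiener wiener_indep initial_sigma initial_indep]
    unfolding D_def by blast
  interpret noise \<Omega> D G dt by (rule G(1))
  obtain d :: nat and e where e: "\<And>i. i < d \<Longrightarrow> e i \<in> V\<^sub>h"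
    "\<And>v. v \<in> V\<^sub>h \<Longrightarrow> v = (\<lambda>x. \<Sum>i<d. ip v (e i) * e i x)"
    "\<forall>i<d. \<exists>\<kappa>. \<forall>v\<in>V\<^sub>h. ip v (e i) = (\<Sum>x\<in>node ` {..m}. \<kappa> x * v x)"
    using orthonormal_basis_exists[OF _ Vh_subspace ip_inner Vh_separated, of "node ` {..m}"] by blast
  from e(3) obtain \<kappa> where \<kappa>: "\<And>i v. i < d \<Longrightarrow> v \<in> V\<^sub>h \<Longrightarrow> ip v (e i) = (\<Sum>x\<in>node ` {..m}. \<kappa> i x * v x)"
    by metis
  interpret fem_scheme a b m \<Omega> D G dt C1 C2 \<eta>1 \<eta>2 P Q U V N d e "node ` {..m}" \<kappa>
  proof unfold_locales
    show "Vh_random_variable a b m (G 0) (X 0)" if "X \<in> {P, Q, U, V}" for X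
    proof -
      have X: "Vh_random_variable a b m F0 (X 0)" by (rule initial_meas[OF that])
      have "space (G 0) = space F0" using G(2) by (simp add: subalgebra_def)
      moreover have "(\<lambda>\<omega>. X 0 \<omega> x) \<in> borel_measurable (G 0)" for x
        using X by (intro measurable_from_subalg[OF G(2)]) (simp add: Vh_random_variable_def)
      ultimately show ?thesis using X by (simp add: Vh_random_variable_def)
    qed
    fix n assume "n < N"
    then show "AE \<omega> in \<Omega>. fe_step a b m C1 C2 \<eta>1 \<eta>2 dt (D 0 n \<omega>) (D 1 n \<omega>) (D 2 n \<omega>)
      (P n \<omega>) (Q n \<omega>) (U n \<omega>) (V n \<omega>) (P (Suc n) \<omega>) (Q (Suc n) \<omega>) (U (Suc n) \<omega>) (V (Suc n) \<omega>)"
      using scheme[of "Suc n"] unfolding D_def by simp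
  qed (fact assms e \<kappa> initial_moment4 initial_moment2 iterates)+
  have t: "L2_inner a b (U i \<omega>) (\<lambda>x. (p1 x)\<^sup>2) = tri (U i \<omega>) p1 p1" for i \<omega>
    by (simp add: tri_def L2_inner_def power2_eq_square mult.assoc)
  have A: "ip p1 (Ah a b m p1) = stiff p1 p1"
    using Ah(2)[OF p_Vh(1) p_Vh(1)] by (simp add: ip_commute)
  show ?thesis
    unfolding t A
  proof (intro ballI)
    fix n assume "n \<in> {0..N}"
    then have "n \<le> N" by simp
    note evolution_integrable[OF this] charge_evolution[OF this] energy_evolution[OF this]
    then show "integrable \<Omega> (\<lambda>\<omega>. charge a b (P n \<omega>) (Q n \<omega>)) \<and>
      integrable \<Omega> (\<lambda>\<omega>. energy a b m (P n \<omega>) (Q n \<omega>) (U n \<omega>) (V n \<omega>)) \<and>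
      integrable \<Omega> (\<lambda>\<omega>. tri (U n \<omega>) p1 p1) \<and>
      expectation (\<lambda>\<omega>. charge a b (P n \<omega>) (Q n \<omega>))
        = expectation (\<lambda>\<omega>. charge a b (P 0 \<omega>) (Q 0 \<omega>)) + 2 * C1\<^sup>2 * ip p1 p1 * (real n * dt) \<and>
      expectation (\<lambda>\<omega>. energy a b m (P n \<omega>) (Q n \<omega>) (U n \<omega>) (V n \<omega>))
        = expectation (\<lambda>\<omega>. energy a b m (P 0 \<omega>) (Q 0 \<omega>) (U 0 \<omega>) (V 0 \<omega>))
          - C2\<^sup>2 * ip p2 p2 * (real n * dt) + 4 * C1\<^sup>2 * stiff p1 p1 * (real n * dt)
          + 4 * C1\<^sup>2 * (\<Sum>i<n. expectation (\<lambda>\<omega>. tri (U i \<omega>) p1 p1) * dt)"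
      by (intro conjI)
  qed
qed

end
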